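(* Let $q \in \mathrm{SU}(2)$ and let $C^0, C^1 \subseteq T^*_q(\mathrm{SU}(2))$ be the two parts of the conjugate locus defined by $$C^0 = \left\{\lambda_0 : H(q,\lambda_0)\neq 0,\ |\lambda_0| \cos \left(\tfrac{|\lambda_0|}{2}\right)-2 \sin \left(\tfrac{|\lambda_0|}{2}\right) = 0 \right\},\qquad C^1 = \left\{\lambda_0 : H(q,\lambda_0)\neq 0,\ \sin\left(\tfrac{|\lambda_0|}{2}\right) = 0 \right\}.$$ Then there is a non-empty dense subset of $C^0$ such that for every $\lambda_0$ in this subset the exponential map $\exp_q : T^*_q(\mathrm{SU}(2)) \to \mathrm{SU}(2)$ is equivalent, in a neighbourhood of $\lambda_0$, to $f : \mathbb{R}^3 \to \mathbb{R}^3 : (x,y,z) \mapsto (x^2,y,z)$. Moreover, for every $\lambda_0 \in C^1$, $\exp_q$ is equivalent, in a neighbourhood of $\lambda_0$, to $f : \mathbb{R}^3 \to \mathbb{R}^3 : (x,y,z) \mapsto (xz,y,z)$.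
   Context: Let $X_0 = \frac12\begin{pmatrix} i & 0\\ 0& -i\end{pmatrix}$, $X_1 = \frac12\begin{pmatrix} 0 & 1\\ -1& 0\end{pmatrix}$, $X_2 = \frac12\begin{pmatrix} 0 & i\\ i& 0\end{pmatrix}$ be the basis of $\mathfrak{su}(2)$, regarded as left-invariant vector fields on $\mathrm{SU}(2)$; they satisfy $[X_1,X_2]=X_0$, $[X_2,X_0]=X_1$, $[X_0,X_1]=X_2$. The sub-Riemannian structure on $\mathrm{SU}(2)$ is the left-invariant one with distribution spanned by $X_1,X_2$ and metric making $X_1,X_2$ orthonormal. Let $\langle\cdot,\cdot\rangle$ be the left-invariant metric making $X_0,X_1,X_2$ orthonormal; it identifies vectors and covectors, so that a covector at $q$ is written $\lambda_0 = u_0X_1+v_0X_2+w_0X_0$, with $|\lambda_0|^2=u_0^2+v_0^2+w_0^2$. The Hamiltonian is $H(q,\lambda_0)=\frac12(u_0^2+v_0^2)$. The exponential map is $\exp_q(\lambda_0)=\pi(e^{\vec H}(q,\lambda_0))$, where $e^{t\vec H}$ is the Hamiltonian flow of $H$ on $T^*(\mathrm{SU}(2))$ and $\pi:T^*(\mathrm{SU}(2))\to\mathrm{SU}(2)$ is the bundle projection; it is defined on all of $T_q^*(\mathrm{SU}(2))$. "$\exp_q$ is equivalent to $f$ in a neighbourhood of $\lambda_0$" means that there are coordinate charts centered at $\lambda_0$ (in the source) and at $\exp_q(\lambda_0)$ (in the target) in which $\exp_q$ is represented by $f$. *)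

theory Defs
  imports "HOL-Analysis.Analysis"
begin

text \<open>
  All manifolds below are embedded submanifolds of Euclidean spaces. Smooth maps between subsets
  of Euclidean spaces are maps that extend locally to smooth maps of open sets, and tangent vectors
  are velocities of curves.
\<close>

primrec Ck_on :: "nat \<Rightarrow> ('a::euclidean_space \<Rightarrow> 'b::euclidean_space) \<Rightarrow> 'a set \<Rightarrow> bool" where
  "Ck_on 0 f S \<longleftrightarrow> continuous_on S f"
| "Ck_on (Suc k) f S \<longleftrightarrow>
     (\<forall>x\<in>S. f differentiable (at x)) \<and> (\<forall>v. Ck_on k (\<lambda>x. frechet_derivative f (at x) v) S)"

text \<open>Derivatives are taken in the ambient space, so this is meant for open \<open>S\<close>.\<close>

definition smooth_open :: "('a::euclidean_space \<Rightarrow> 'b::euclidean_space) \<Rightarrow> 'a set \<Rightarrow> bool" where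
  "smooth_open f S \<longleftrightarrow> (\<forall>k. Ck_on k f S)"

definition smooth_subset :: "('a::euclidean_space \<Rightarrow> 'b::euclidean_space) \<Rightarrow> 'a set \<Rightarrow> bool" where
  "smooth_subset f S \<longleftrightarrow>
     (\<forall>x\<in>S. \<exists>W F. open W \<and> x \<in> W \<and> smooth_open F W \<and> (\<forall>y\<in>S \<inter> W. F y = f y))"

definition centered_chart ::
  "'a::euclidean_space set \<Rightarrow> 'a \<Rightarrow> 'a set \<Rightarrow> ('a \<Rightarrow> 'b::euclidean_space) \<Rightarrow> bool" where
  "centered_chart M p U \<phi> \<longleftrightarrow>
     openin (top_of_set M) U \<and> p \<in> U \<and> \<phi> p = 0 \<and>
     open (\<phi> ` U) \<and> inj_on \<phi> U \<and>
     smooth_subset \<phi> U \<and> smooth_open (inv_into U \<phi>) (\<phi> ` U)"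

definition locally_equivalent ::
  "'a::euclidean_space set \<Rightarrow> 'b::euclidean_space set \<Rightarrow> ('a \<Rightarrow> 'b) \<Rightarrow> 'a \<Rightarrow>
   ('c::euclidean_space \<Rightarrow> 'd::euclidean_space) \<Rightarrow> bool" where
  "locally_equivalent M N F p f \<longleftrightarrow>
     (\<exists>U \<phi> V \<psi>. centered_chart M p U \<phi> \<and> centered_chart N (F p) V \<psi> \<and>
        F ` U \<subseteq> V \<and> (\<forall>x\<in>U. \<psi> (F x) = f (\<phi> x)))"

definition tangent_space :: "'a::euclidean_space set \<Rightarrow> 'a \<Rightarrow> 'a set" where
  "tangent_space M p =
     {v. \<exists>c :: real \<Rightarrow> 'a. c 0 = p \<and> (\<forall>t. c t \<in> M) \<and> (c has_vector_derivative v) (at 0)}"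

definition exterior_derivative ::
  "('a::euclidean_space \<Rightarrow> 'a \<Rightarrow> real) \<Rightarrow> 'a \<Rightarrow> 'a \<Rightarrow> 'a \<Rightarrow> real" where
  "exterior_derivative \<Theta> p \<xi> \<eta> =
     frechet_derivative (\<lambda>p. \<Theta> p \<eta>) (at p) \<xi> - frechet_derivative (\<lambda>p. \<Theta> p \<xi>) (at p) \<eta>"


type_synonym cmat = "complex^2^2"

definition adjoint_mat :: "cmat \<Rightarrow> cmat" where
  "adjoint_mat A = (\<chi> i j. cnj (A $ j $ i))"

definition SU2 :: "cmat set" where
  "SU2 = {A. A ** adjoint_mat A = mat 1 \<and> det A = 1}"

definition X0 :: cmat where "X0 = (1/2) *\<^sub>R vector [vector [\<i>, 0], vector [0, - \<i>]]"
definition X1 :: cmat where "X1 = (1/2) *\<^sub>R vector [vector [0, 1], vector [- 1, 0]]"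
definition X2 :: cmat where "X2 = (1/2) *\<^sub>R vector [vector [0, \<i>], vector [\<i>, 0]]"

text \<open>
  The left-invariant field of \<open>X\<close> at \<open>q\<close> is \<open>q ** X\<close>. The left-invariant metric for which
  \<open>X0\<close>, \<open>X1\<close>, \<open>X2\<close> are orthonormal is twice the restriction of the Euclidean inner product
  of the space of matrices; see \<open>metric_left_invariant\<close> and \<open>metric_orthonormal\<close>.
\<close>

definition metric :: "cmat \<Rightarrow> cmat \<Rightarrow> real" where
  "metric V W = 2 * (V \<bullet> W)"

text \<open>
  Covectors are identified with tangent vectors by this metric, so the cotangent bundle is a
  submanifold of the space of pairs of matrices. The span is over the reals.
\<close>

definition cotangent_space :: "cmat \<Rightarrow> cmat set" where
  "cotangent_space q = span {q ** X1, q ** X2, q ** X0}"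

definition cotangent_bundle :: "(cmat \<times> cmat) set" where
  "cotangent_bundle = {(q, \<mu>). q \<in> SU2 \<and> \<mu> \<in> cotangent_space q}"

definition covector_norm :: "cmat \<Rightarrow> real" where
  "covector_norm \<mu> = sqrt (metric \<mu> \<mu>)"

definition Hamiltonian :: "cmat \<times> cmat \<Rightarrow> real" where
  "Hamiltonian = (\<lambda>(q, \<mu>). ((metric \<mu> (q ** X1))\<^sup>2 + (metric \<mu> (q ** X2))\<^sup>2) / 2)"

text \<open>
  The tautological one-form sends a tangent vector \<open>\<xi>\<close> at \<open>(q, \<mu>)\<close> to the value of \<open>\<mu>\<close> on the
  projection of \<open>\<xi>\<close> to the base. The formula also makes sense on the ambient space; since exterior
  derivatives commute with restriction, the symplectic form may be computed there and
  restricted to tangent vectors of the bundle. The sign is the one for which Hamilton's equations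
  in canonical coordinates read \<open>x' = \<partial>H/\<partial>p\<close>, \<open>p' = - \<partial>H/\<partial>x\<close> when \<open>\<omega>(\<xi>, \<cdot>) = dH\<close>.
\<close>

definition tautological_form :: "cmat \<times> cmat \<Rightarrow> cmat \<times> cmat \<Rightarrow> real" where
  "tautological_form p \<xi> = metric (snd p) (fst \<xi>)"

definition symplectic_form :: "cmat \<times> cmat \<Rightarrow> cmat \<times> cmat \<Rightarrow> cmat \<times> cmat \<Rightarrow> real" where
  "symplectic_form p \<xi> \<eta> = - exterior_derivative tautological_form p \<xi> \<eta>"

definition Hamiltonian_field :: "cmat \<times> cmat \<Rightarrow> cmat \<times> cmat" where
  "Hamiltonian_field p =
     (THE \<xi>. \<xi> \<in> tangent_space cotangent_bundle p \<and>
        (\<forall>\<eta>\<in>tangent_space cotangent_bundle p.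
           symplectic_form p \<xi> \<eta> = frechet_derivative Hamiltonian (at p) \<eta>))"

definition Hamiltonian_trajectory :: "(real \<Rightarrow> cmat \<times> cmat) \<Rightarrow> bool" where
  "Hamiltonian_trajectory \<gamma> \<longleftrightarrow>
     (\<forall>t. \<gamma> t \<in> cotangent_bundle \<and> (\<gamma> has_vector_derivative Hamiltonian_field (\<gamma> t)) (at t))"

definition Hamiltonian_flow :: "real \<Rightarrow> cmat \<times> cmat \<Rightarrow> cmat \<times> cmat" where
  "Hamiltonian_flow t p = (THE \<gamma>. Hamiltonian_trajectory \<gamma> \<and> \<gamma> 0 = p) t"

definition exp_map :: "cmat \<Rightarrow> cmat \<Rightarrow> cmat" where
  "exp_map q \<mu> = fst (Hamiltonian_flow 1 (q, \<mu>))"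

definition conj_locus_0 :: "cmat \<Rightarrow> cmat set" where
  "conj_locus_0 q = {\<mu> \<in> cotangent_space q. Hamiltonian (q, \<mu>) \<noteq> 0 \<and>
     covector_norm \<mu> * cos (covector_norm \<mu> / 2) - 2 * sin (covector_norm \<mu> / 2) = 0}"

definition conj_locus_1 :: "cmat \<Rightarrow> cmat set" where
  "conj_locus_1 q = {\<mu> \<in> cotangent_space q. Hamiltonian (q, \<mu>) \<noteq> 0 \<and>
     sin (covector_norm \<mu> / 2) = 0}"


lemma brackets:
  "X1 ** X2 - X2 ** X1 = X0" "X2 ** X0 - X0 ** X2 = X1" "X0 ** X1 - X1 ** X0 = X2"
  by (auto simp: X0_def X1_def X2_def matrix_matrix_mult_def vec_eq_iff forall_2 sum_2
      vector_2 complex_eq_iff)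

lemma metric_orthonormal:
  "metric X0 X0 = 1" "metric X1 X1 = 1" "metric X2 X2 = 1"
  "metric X0 X1 = 0" "metric X0 X2 = 0" "metric X1 X2 = 0"
  by (auto simp: metric_def X0_def X1_def X2_def inner_vec_def sum_2 vector_2 inner_complex_def)

lemma metric_trace: "metric V W = 2 * Re (trace (adjoint_mat V ** W))"
  by (simp add: metric_def trace_def adjoint_mat_def matrix_matrix_mult_def inner_vec_def sum_2
      inner_complex_def algebra_simps)

lemma adjoint_mat_mult: "adjoint_mat (A ** B) = adjoint_mat B ** adjoint_mat A"
  by (simp add: adjoint_mat_def matrix_matrix_mult_def vec_eq_iff sum_2 mult.commute)

lemma metric_left_invariant:
  assumes "q \<in> SU2"
  shows "metric (q ** V) (q ** W) = metric V W"
proof -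
  have "adjoint_mat q ** q = mat 1"
    using assms by (simp add: SU2_def matrix_left_right_inverse)
  then have "adjoint_mat (q ** V) ** (q ** W) = adjoint_mat V ** W"
    by (metis adjoint_mat_mult matrix_mul_assoc matrix_mul_lid)
  then show ?thesis
    by (simp add: metric_trace)
qed

end

theory Submission
  imports Defs
begin

text \<open>
  In the left trivialisation, Hamilton's equations on \<open>SU(2)\<close> have the solution
  \<open>exp (t m) exp (- t w X0)\<close> with \<open>m = u X1 + v X2 + w X0\<close>. Put \<open>\<theta> = |m| / 2\<close> and \<open>c = w / |m|\<close>. In
  quaternionic coordinates the exponential map is then \<open>m \<mapsto> (z, \<zeta>)\<close> with
  \<open>z = exp (- i c \<theta>) (cos \<theta> + i c sin \<theta>)\<close> and \<open>\<zeta> = (sin \<theta> / |m|) (u + i v) exp (i w / 2)\<close>.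

  Where \<open>sin \<theta> = 0\<close>, the modulus factor of \<open>\<zeta>\<close> vanishes to first order, its argument is a free
  coordinate, and the argument of \<open>z\<close> has nonzero derivative in \<open>w\<close>: in the coordinates given by
  these three functions, \<open>\<zeta>\<close> is the blow-down of polar coordinates.

  Where \<open>tan \<theta> = \<theta>\<close>, one uses \<open>\<theta>\<close>, \<open>y = |\<zeta>|\<^sup>2 = (1 - c\<^sup>2) (sin \<theta>)\<^sup>2\<close> and \<open>arg \<zeta>\<close> as coordinates, which is
  possible for \<open>w \<noteq> 0\<close>. Along the curves of constant \<open>y\<close>, the derivative of \<open>z\<close> in \<open>\<theta>\<close> is a nonzero
  multiple of \<open>sin \<theta> - \<theta> cos \<theta>\<close>. So the argument of \<open>z\<close> relative to its value at the critical angle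
  \<open>\<theta>\<^sub>0\<close> for the same \<open>y\<close> vanishes to exactly second order in \<open>\<theta> - \<theta>\<^sub>0\<close>, and Hadamard's lemma extracts
  its smooth square root.
\<close>

section \<open>Smooth germs\<close>

text \<open>On both loci the degeneration comes from the modulus factor sin \<theta> / |m| of
  \<zeta>: its gradient is a multiple of the left side of the equation of C^0, and the factor itself
  vanishes on C^1. The condition H \<noteq> 0 says u + i v \<noteq> 0, so the remaining factor of
  \<zeta> has a well-defined argument. The function y is chosen because it can be read off in the
  source and in the target alike: the target chart evaluates the critical value of z at y =
  |\<zeta>|^2, which straightens the fold with y as a parameter. The condition w \<noteq> 0 makes
  \<theta> and y independent, and keeps c smooth in them, since c^2 = 1 - y / (sin \<theta>)^2 is
  solved by a square root. Points of C^0 with w = 0 are limits of points with w \<noteq> 0 on the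
  same sphere |m| = const. Quotients Im / Re and imaginary parts of products stand in for arguments,
  so no branch has to be chosen. As the field and the flow are definite descriptions, uniqueness has
  to be proved along with existence before any formula is available.\<close>

lemma has_frechet_derivative:
  "f differentiable (at x) \<Longrightarrow> (f has_derivative frechet_derivative f (at x)) (at x)"
  by (simp add: frechet_derivative_works)

lemma Ck_on_subset: "Ck_on k f S \<Longrightarrow> T \<subseteq> S \<Longrightarrow> Ck_on k f T"
  by (induction k arbitrary: f) (auto intro: continuous_on_subset)

lemma Ck_on_SucD: "Ck_on (Suc k) f S \<Longrightarrow> Ck_on k f S"
proof (induction k arbitrary: f)
  case 0
  then show ?case
    by (auto intro!: continuous_at_imp_continuous_on differentiable_imp_continuous_within)
next
  case (Suc k)
  then show ?case by auto
qed

lemma Ck_on_cong: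
  assumes "open S" "\<And>x. x \<in> S \<Longrightarrow> f x = g x" "Ck_on k f S"
  shows "Ck_on k g S"
  using assms(2,3)
proof (induction k arbitrary: f g)
  case 0
  have "continuous_on S f" using 0 by simp
  then have "continuous_on S g" by (rule continuous_on_eq) (rule 0)
  then show ?case by simp
next
  case (Suc k)
  have d: "(g has_derivative frechet_derivative f (at x)) (at x)" if "x \<in> S" for x
    using Suc.prems that
    by (intro has_derivative_transform_within_open[OF has_frechet_derivative \<open>open S\<close> that]) auto
  have "Ck_on k (\<lambda>x. frechet_derivative g (at x) v) S" for v
  proof (rule Suc.IH)
    show "frechet_derivative f (at x) v = frechet_derivative g (at x) v" if "x \<in> S" for x
      using frechet_derivative_at[OF d[OF that]] by simp
  qed (use Suc.prems(2) in simp)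
  then show ?case
    using d by (auto simp: differentiable_def)
qed

text \<open>\<open>frechet_derivative\<close> is fixed only by a choice; this rule lets the
  inductions below work with a derivative written out by hand.\<close>

lemma Ck_on_SucI:
  assumes "open S" "\<And>x. x \<in> S \<Longrightarrow> (f has_derivative f' x) (at x)"
    "\<And>v. Ck_on k (\<lambda>x. f' x v) S"
  shows "Ck_on (Suc k) f S"
proof -
  have "f' x = frechet_derivative f (at x)" if "x \<in> S" for x
    by (rule frechet_derivative_at[OF assms(2)[OF that]])
  then have "Ck_on k (\<lambda>x. frechet_derivative f (at x) v) S" for v
    by (intro Ck_on_cong[OF assms(1) _ assms(3)[of v]]) auto
  with assms(2) show ?thesis
    by (auto simp: differentiable_def)
qed

lemma Ck_on_imp_continuous_on: "Ck_on k f S \<Longrightarrow> continuous_on S f"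
proof (induction k)
  case (Suc k)
  then show ?case using Ck_on_SucD by blast
qed simp

lemma Ck_on_const: "Ck_on k (\<lambda>x. c) S"
  by (induction k arbitrary: c) auto

lemma Ck_on_linear:
  assumes "bounded_linear f" "open S"
  shows "Ck_on k f S"
proof (cases k)
  case 0
  then show ?thesis using assms by (simp add: linear_continuous_on)
next
  case (Suc j)
  show ?thesis unfolding Suc
    by (rule Ck_on_SucI[OF assms(2), where f' = "\<lambda>_. f"])
      (use assms bounded_linear_imp_has_derivative in \<open>auto simp: Ck_on_const\<close>)
qed

lemma Ck_on_add:
  assumes "open S" "Ck_on k f S" "Ck_on k g S"
  shows "Ck_on k (\<lambda>x. f x + g x) S"
  using assms(2,3)
proof (induction k arbitrary: f g)
  case 0
  then show ?case by (auto intro: continuous_intros)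
next
  case (Suc k)
  let ?f = "\<lambda>x. frechet_derivative f (at x)" and ?g = "\<lambda>x. frechet_derivative g (at x)"
  show ?case
  proof (rule Ck_on_SucI[OF assms(1)])
    fix x assume "x \<in> S"
    then have "f differentiable at x" "g differentiable at x"
      using Suc.prems by auto
    then show "((\<lambda>x. f x + g x) has_derivative (\<lambda>v. ?f x v + ?g x v)) (at x)"
      by (intro has_derivative_add has_frechet_derivative)
  next
    fix v
    show "Ck_on k (\<lambda>x. ?f x v + ?g x v) S"
      using Suc.prems by (intro Suc.IH) auto
  qed
qed

lemma Ck_on_sum:
  assumes "open S" "\<And>i. i \<in> I \<Longrightarrow> Ck_on k (f i) S"
  shows "Ck_on k (\<lambda>x. \<Sum>i\<in>I. f i x) S"
  using assms(2)
  by (induction I rule: infinite_finite_induct)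
    (simp_all add: Ck_on_const Ck_on_add[OF assms(1)])

text \<open>One Leibniz rule from which multiplication, scaling and inner products are all
  obtained.\<close>

lemma Ck_on_bilinear:
  assumes "bounded_bilinear b" "open S" "Ck_on k f S" "Ck_on k g S"
  shows "Ck_on k (\<lambda>x. b (f x) (g x)) S"
  using assms(3,4)
proof (induction k arbitrary: f g)
  case 0
  then show ?case by (auto intro: bounded_bilinear.continuous_on[OF assms(1)])
next
  case (Suc k)
  let ?f = "\<lambda>x. frechet_derivative f (at x)" and ?g = "\<lambda>x. frechet_derivative g (at x)"
  show ?case
  proof (rule Ck_on_SucI[OF assms(2)])
    fix x assume "x \<in> S"
    then have "f differentiable at x" "g differentiable at x"
      using Suc.prems by auto
    then show "((\<lambda>x. b (f x) (g x)) has_derivative (\<lambda>v. b (f x) (?g x v) + b (?f x v) (g x))) (at x)"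
      by (intro bounded_bilinear.FDERIV[OF assms(1)] has_frechet_derivative)
  next
    fix v
    have "Ck_on k (\<lambda>x. ?f x v) S" "Ck_on k (\<lambda>x. ?g x v) S"
      using Suc.prems by auto
    then show "Ck_on k (\<lambda>x. b (f x) (?g x v) + b (?f x v) (g x)) S"
      using Ck_on_SucD[OF Suc.prems(1)] Ck_on_SucD[OF Suc.prems(2)]
      by (intro Ck_on_add[OF assms(2)] Suc.IH)
  qed
qed

lemma Ck_on_compose:
  assumes "open S" "open T" "Ck_on k f T" "Ck_on k g S" "g ` S \<subseteq> T"
  shows "Ck_on k (\<lambda>x. f (g x)) S"
  using assms(3,4)
proof (induction k arbitrary: f)
  case 0
  then show ?case
    using assms(5) by (auto intro: continuous_on_compose2)
next
  case (Suc k)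
  let ?f = "\<lambda>y. frechet_derivative f (at y)" and ?g = "\<lambda>x. frechet_derivative g (at x)"
  have df: "(f has_derivative ?f y) (at y)" if "y \<in> T" for y
    using Suc.prems that by (auto intro: has_frechet_derivative)
  have dg: "(g has_derivative ?g x) (at x)" if "x \<in> S" for x
    using Suc.prems that by (auto intro: has_frechet_derivative)
  show ?case
  proof (rule Ck_on_SucI[OF assms(1)])
    fix x assume x: "x \<in> S"
    have gx: "g x \<in> T" using x assms(5) by auto
    \<comment> \<open>\<open>Ck_on\<close> controls derivatives in fixed directions, whereas the
      chain rule evaluates \<open>?f (g x)\<close> in the moving direction \<open>?g x v\<close>.
      Expanding that direction in the basis gives a sum of products accessible to the induction
      hypothesis.\<close>
    have *: "?f (g x) w = (\<Sum>b\<in>Basis. (w \<bullet> b) *\<^sub>R ?f (g x) b)" for w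
      using linear_sum[OF has_derivative_linear[OF df[OF gx]], of "\<lambda>b. (w \<bullet> b) *\<^sub>R b" Basis]
        linear_scale[OF has_derivative_linear[OF df[OF gx]]]
      by (simp add: euclidean_representation)
    show "((\<lambda>x. f (g x)) has_derivative
        (\<lambda>v. \<Sum>b\<in>Basis. (?g x v \<bullet> b) *\<^sub>R ?f (g x) b)) (at x)"
      by (rule has_derivative_eq_rhs[OF has_derivative_compose[OF dg[OF x] df[OF gx]]], rule ext, rule *)
  next
    fix v
    have "Ck_on k (\<lambda>x. ?g x v \<bullet> b) S" for b
      using Suc.prems(2) by (intro Ck_on_bilinear[OF bounded_bilinear_inner assms(1)]) (auto simp: Ck_on_const)
    moreover have "Ck_on k (\<lambda>x. ?f (g x) b) S" for b
      using Suc.prems Ck_on_SucD[OF Suc.prems(2)] by (intro Suc.IH) auto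
    ultimately show "Ck_on k (\<lambda>x. \<Sum>b\<in>Basis. (?g x v \<bullet> b) *\<^sub>R ?f (g x) b) S"
      by (intro Ck_on_sum Ck_on_bilinear[OF bounded_bilinear_scaleR] assms(1))
  qed
qed

text \<open>Working with germs makes the domains of partial functions disappear from the calculations:
  only side conditions at the point itself remain.\<close>

definition smooth_at :: "('a::euclidean_space \<Rightarrow> 'b::euclidean_space) \<Rightarrow> 'a \<Rightarrow> bool" where
  "smooth_at f x \<longleftrightarrow> (\<exists>W. open W \<and> x \<in> W \<and> smooth_open f W)"

lemma smooth_openD: "smooth_open f S \<Longrightarrow> Ck_on k f S"
  by (simp add: smooth_open_def)

lemma smooth_open_frechet_derivative:
  "smooth_open f S \<Longrightarrow> smooth_open (\<lambda>x. frechet_derivative f (at x) v) S"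
  unfolding smooth_open_def
proof
  fix k assume "\<forall>k. Ck_on k f S"
  then have "Ck_on (Suc k) f S" ..
  then show "Ck_on k (\<lambda>x. frechet_derivative f (at x) v) S" by simp
qed

section \<open>Closure properties of smooth germs\<close>

named_theorems smooth_intros

lemma smooth_open_subset: "smooth_open f S \<Longrightarrow> T \<subseteq> S \<Longrightarrow> smooth_open f T"
  unfolding smooth_open_def by (intro allI, rule Ck_on_subset[where S = S]) simp_all

lemma smooth_open_compose:
  assumes "open S" "open T" "smooth_open f T" "smooth_open g S" "g ` S \<subseteq> T"
  shows "smooth_open (\<lambda>x. f (g x)) S"
  unfolding smooth_open_def
proof
  fix k
  show "Ck_on k (\<lambda>x. f (g x)) S"
    by (rule Ck_on_compose[OF assms(1,2) _ _ assms(5)]) (use assms(3,4) in \<open>simp_all add: smooth_open_def\<close>)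
qed

lemma smooth_open_imp_smooth_at: "smooth_open f S \<Longrightarrow> open S \<Longrightarrow> x \<in> S \<Longrightarrow> smooth_at f x"
  by (auto simp: smooth_at_def)

lemma smooth_at_imp_differentiable: "smooth_at f x \<Longrightarrow> f differentiable (at x)"
proof -
  assume "smooth_at f x"
  then obtain W where "x \<in> W" "smooth_open f W"
    unfolding smooth_at_def by blast
  with smooth_openD[of f W "Suc 0"] show ?thesis by simp
qed

lemma smooth_at_imp_isCont: "smooth_at f x \<Longrightarrow> isCont f x"
  by (simp add: differentiable_imp_continuous_within smooth_at_imp_differentiable)

lemma smooth_at_tendsto: "smooth_at f x \<Longrightarrow> (f \<longlongrightarrow> f x) (nhds x)"
  using smooth_at_imp_isCont[of f x] by (simp add: continuous_at tendsto_at_iff_tendsto_nhds)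

lemma smooth_at_const [smooth_intros]: "smooth_at (\<lambda>x. c) x"
  unfolding smooth_at_def smooth_open_def by (rule exI[of _ UNIV]) (simp add: Ck_on_const)

lemma smooth_at_linear: "bounded_linear f \<Longrightarrow> smooth_at f x"
  unfolding smooth_at_def smooth_open_def by (rule exI[of _ UNIV]) (simp add: Ck_on_linear)

lemma smooth_at_bilinear:
  assumes "bounded_bilinear b" "smooth_at f x" "smooth_at g x"
  shows "smooth_at (\<lambda>x. b (f x) (g x)) x"
proof -
  obtain U V where UV: "open U" "x \<in> U" "smooth_open f U" "open V" "x \<in> V" "smooth_open g V"
    using assms by (auto simp: smooth_at_def)
  have "smooth_open f (U \<inter> V)" "smooth_open g (U \<inter> V)"
    by (rule smooth_open_subset[OF UV(3)], blast, rule smooth_open_subset[OF UV(6)], blast)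
  then have "smooth_open (\<lambda>x. b (f x) (g x)) (U \<inter> V)"
    by (simp add: smooth_open_def Ck_on_bilinear[OF assms(1)] open_Int UV)
  then show ?thesis
    unfolding smooth_at_def using open_Int[OF UV(1,4)] UV(2,5) by blast
qed

lemma smooth_at_compose:
  assumes "smooth_at f (g x)" "smooth_at g x"
  shows "smooth_at (\<lambda>x. f (g x)) x"
proof -
  obtain U V where UV: "open U" "x \<in> U" "smooth_open g U" "open V" "g x \<in> V" "smooth_open f V"
    using assms by (auto simp: smooth_at_def)
  have "continuous_on U g"
    by (rule Ck_on_imp_continuous_on[OF smooth_openD[OF UV(3)]])
  then have "open (U \<inter> g -` V)"
    using UV continuous_open_preimage by blast
  moreover have "smooth_open (\<lambda>x. f (g x)) (U \<inter> g -` V)"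
    by (rule smooth_open_compose[OF calculation UV(4,6) smooth_open_subset[OF UV(3)]]) auto
  ultimately show ?thesis
    unfolding smooth_at_def using \<open>open (U \<inter> g -` V)\<close> UV(2,5) by blast
qed

lemma smooth_at_add [smooth_intros]:
  assumes "smooth_at f x" "smooth_at g x"
  shows "smooth_at (\<lambda>x. f x + g x) x"
proof -
  obtain U V where UV: "open U" "x \<in> U" "smooth_open f U" "open V" "x \<in> V" "smooth_open g V"
    using assms by (auto simp: smooth_at_def)
  have "smooth_open f (U \<inter> V)" "smooth_open g (U \<inter> V)"
    by (rule smooth_open_subset[OF UV(3)], blast, rule smooth_open_subset[OF UV(6)], blast)
  then have "smooth_open (\<lambda>x. f x + g x) (U \<inter> V)"
    by (simp add: smooth_open_def Ck_on_add open_Int UV)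
  then show ?thesis
    unfolding smooth_at_def using open_Int[OF UV(1,4)] UV(2,5) by blast
qed

lemma smooth_at_id [smooth_intros]: "smooth_at (\<lambda>x. x) x"
  by (rule smooth_at_linear) (rule bounded_linear_ident)

lemma smooth_at_linear_compose:
  "bounded_linear f \<Longrightarrow> smooth_at g x \<Longrightarrow> smooth_at (\<lambda>x. f (g x)) x"
  by (rule smooth_at_compose[OF smooth_at_linear])

lemma smooth_at_minus [smooth_intros]: "smooth_at f x \<Longrightarrow> smooth_at (\<lambda>x. - f x) x"
  by (rule smooth_at_linear_compose[OF bounded_linear_minus[OF bounded_linear_ident]])

lemma smooth_at_diff [smooth_intros]:
  "smooth_at f x \<Longrightarrow> smooth_at g x \<Longrightarrow> smooth_at (\<lambda>x. f x - g x) x"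
  unfolding diff_conv_add_uminus by (intro smooth_at_add smooth_at_minus)

lemma smooth_at_sum:
  "(\<And>i. i \<in> I \<Longrightarrow> smooth_at (f i) x) \<Longrightarrow> smooth_at (\<lambda>x. \<Sum>i\<in>I. f i x) x"
proof (induction I rule: infinite_finite_induct)
  case (insert i I)
  have "smooth_at (\<lambda>x. f i x + (\<Sum>i\<in>I. f i x)) x"
    by (intro smooth_at_add insert) auto
  then show ?case using insert.hyps by simp
qed (simp_all only: sum.infinite sum.empty smooth_at_const not_False_eq_True)

lemma smooth_at_mult [smooth_intros]:
  fixes f g :: "'a::euclidean_space \<Rightarrow> 'b::{euclidean_space, real_normed_algebra}"
  shows "smooth_at f x \<Longrightarrow> smooth_at g x \<Longrightarrow> smooth_at (\<lambda>x. f x * g x) x"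
  by (rule smooth_at_bilinear[OF bounded_bilinear_mult])

lemma smooth_at_prod:
  fixes f :: "'i \<Rightarrow> 'a::euclidean_space \<Rightarrow> 'b::{euclidean_space, real_normed_field}"
  shows "(\<And>i. i \<in> I \<Longrightarrow> smooth_at (f i) x) \<Longrightarrow> smooth_at (\<lambda>x. \<Prod>i\<in>I. f i x) x"
proof (induction I rule: infinite_finite_induct)
  case (insert i I)
  have "smooth_at (\<lambda>x. f i x * (\<Prod>i\<in>I. f i x)) x"
    by (intro smooth_at_mult insert) auto
  then show ?case using insert.hyps by simp
qed (simp_all only: prod.infinite prod.empty smooth_at_const not_False_eq_True)

lemma smooth_at_power [smooth_intros]:
  fixes f :: "'a::euclidean_space \<Rightarrow> 'b::{euclidean_space, real_normed_field}"
  shows "smooth_at f x \<Longrightarrow> smooth_at (\<lambda>x. f x ^ n) x"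
proof (induction n)
  case (Suc n)
  then show ?case unfolding power_Suc by (intro smooth_at_mult)
qed (simp only: power_0 smooth_at_const)

lemma smooth_at_scaleR [smooth_intros]:
  "smooth_at f x \<Longrightarrow> smooth_at g x \<Longrightarrow> smooth_at (\<lambda>x. f x *\<^sub>R g x) x"
  by (rule smooth_at_bilinear[OF bounded_bilinear_scaleR])

lemma smooth_at_Pair [smooth_intros]:
  assumes "smooth_at f x" "smooth_at g x"
  shows "smooth_at (\<lambda>x. (f x, g x)) x"
proof -
  have bl: "bounded_linear (\<lambda>y::'b. (y, 0::'c))" "bounded_linear (\<lambda>z::'c. (0::'b, z))"
    by (auto intro!: bounded_linear_Pair bounded_linear_ident bounded_linear_zero)
  have "smooth_at (\<lambda>x. (f x, 0) + (0, g x)) x"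
    by (rule smooth_at_add[OF smooth_at_linear_compose[OF bl(1) assms(1)] smooth_at_linear_compose[OF bl(2) assms(2)]])
  then show ?thesis by simp
qed

lemma smooth_at_componentwise:
  fixes f :: "'a::euclidean_space \<Rightarrow> 'b::euclidean_space"
  assumes "\<And>b. b \<in> Basis \<Longrightarrow> smooth_at (\<lambda>x. f x \<bullet> b) x"
  shows "smooth_at f x"
proof -
  have "smooth_at (\<lambda>x. \<Sum>b\<in>Basis. (f x \<bullet> b) *\<^sub>R b) x"
    using assms by (intro smooth_at_sum smooth_at_scaleR smooth_at_const) auto
  then show ?thesis
    by (simp add: euclidean_representation)
qed

lemma smooth_at_fst [smooth_intros]: "smooth_at f x \<Longrightarrow> smooth_at (\<lambda>x. fst (f x)) x"
  by (rule smooth_at_linear_compose[OF bounded_linear_fst])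

lemma smooth_at_snd [smooth_intros]: "smooth_at f x \<Longrightarrow> smooth_at (\<lambda>x. snd (f x)) x"
  by (rule smooth_at_linear_compose[OF bounded_linear_snd])

lemma smooth_at_vec_nth [smooth_intros]: "smooth_at f x \<Longrightarrow> smooth_at (\<lambda>x. f x $ i) x"
  by (rule smooth_at_linear_compose[OF bounded_linear_vec_nth])

lemma smooth_at_Re [smooth_intros]: "smooth_at f x \<Longrightarrow> smooth_at (\<lambda>x. Re (f x)) x"
  by (rule smooth_at_linear_compose[OF bounded_linear_Re])

lemma smooth_at_Im [smooth_intros]: "smooth_at f x \<Longrightarrow> smooth_at (\<lambda>x. Im (f x)) x"
  by (rule smooth_at_linear_compose[OF bounded_linear_Im])

lemma smooth_at_cnj [smooth_intros]: "smooth_at f x \<Longrightarrow> smooth_at (\<lambda>x. cnj (f x)) x"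
  by (rule smooth_at_linear_compose[OF bounded_linear_cnj])

lemma smooth_at_of_real [smooth_intros]: "smooth_at f x \<Longrightarrow> smooth_at (\<lambda>x. of_real (f x) :: complex) x"
  by (rule smooth_at_linear_compose[OF bounded_linear_of_real])

lemma smooth_at_Complex [smooth_intros]:
  assumes "smooth_at f x" "smooth_at g x"
  shows "smooth_at (\<lambda>x. Complex (f x) (g x)) x"
  unfolding Complex_eq by (intro smooth_at_add smooth_at_mult smooth_at_of_real smooth_at_const assms)

lemma smooth_at_vec:
  fixes f :: "'a::euclidean_space \<Rightarrow> 'b::euclidean_space^'n"
  assumes "\<And>i. smooth_at (\<lambda>x. f x $ i) x"
  shows "smooth_at f x"
proof (rule smooth_at_componentwise)
  fix b :: "'b^'n" assume "b \<in> Basis"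
  then obtain i u where "b = axis i u"
    by (auto simp: Basis_vec_def)
  moreover have "smooth_at (\<lambda>x. f x $ i \<bullet> u) x"
    by (rule smooth_at_bilinear[OF bounded_bilinear_inner assms smooth_at_const])
  ultimately show "smooth_at (\<lambda>x. f x \<bullet> b) x"
    by (simp add: inner_axis)
qed

lemma smooth_at_vector3 [smooth_intros]:
  fixes f g h :: "'a::euclidean_space \<Rightarrow> real"
  assumes "smooth_at f x" "smooth_at g x" "smooth_at h x"
  shows "smooth_at (\<lambda>x. vector [f x, g x, h x] :: real^3) x"
proof (rule smooth_at_vec)
  fix i :: 3
  show "smooth_at (\<lambda>x. (vector [f x, g x, h x] :: real^3) $ i) x"
    using exhaust_3[of i] assms by auto
qed

text \<open>Bootstrapping for functions whose derivative is an expression in the function itself,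
  such as \<open>inverse\<close> and \<open>sqrt\<close>: each order of differentiability yields the
  next.\<close>

lemma smooth_open_real_derivative:
  fixes f :: "real \<Rightarrow> real"
  assumes "open S" "\<And>x. x \<in> S \<Longrightarrow> (f has_real_derivative f' x) (at x)"
    "\<And>k. Ck_on k f S \<Longrightarrow> Ck_on k f' S"
  shows "smooth_open f S"
  unfolding smooth_open_def
proof
  fix k show "Ck_on k f S"
  proof (induction k)
    case 0
    have "isCont f x" if "x \<in> S" for x
      by (rule DERIV_isCont[OF assms(2)[OF that]])
    then show ?case
      by (simp add: continuous_at_imp_continuous_on)
  next
    case (Suc k)
    show ?case
    proof (rule Ck_on_SucI[OF assms(1)])
      show "(f has_derivative (\<lambda>v. f' x * v)) (at x)" if "x \<in> S" for x
        using assms(2)[OF that] by (simp add: has_field_derivative_def)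
      show "Ck_on k (\<lambda>x. f' x * v) S" for v
        by (rule Ck_on_bilinear[OF bounded_bilinear_mult assms(1) assms(3)[OF Suc] Ck_on_const])
    qed
  qed
qed

lemma smooth_open_sin_cos: "smooth_open (sin :: real \<Rightarrow> real) UNIV" "smooth_open (cos :: real \<Rightarrow> real) UNIV"
proof -
  \<comment> \<open>Linear combinations of sine and cosine are closed under differentiation, so one
    induction treats both functions.\<close>
  have *: "Ck_on k (\<lambda>x. a * sin x + b * cos x) UNIV" for k and a b :: real
  proof (induction k arbitrary: a b)
    case 0
    then show ?case by (auto intro!: continuous_intros)
  next
    case (Suc k)
    show ?case
    proof (rule Ck_on_SucI)
      show "((\<lambda>x. a * sin x + b * cos x) has_derivative (\<lambda>v. (- b * sin x + a * cos x) * v)) (at x)" for x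
        by (auto intro!: derivative_eq_intros simp: algebra_simps)
      show "Ck_on k (\<lambda>x. (- b * sin x + a * cos x) * v) UNIV" for v
        by (rule Ck_on_bilinear[OF bounded_bilinear_mult open_UNIV Suc Ck_on_const])
    qed simp
  qed
  show "smooth_open (sin :: real \<Rightarrow> real) UNIV" "smooth_open (cos :: real \<Rightarrow> real) UNIV"
    using *[of _ 1 0] *[of _ 0 1] by (simp_all add: smooth_open_def)
qed

lemma smooth_open_inverse: "smooth_open (inverse :: real \<Rightarrow> real) (- {0})"
proof (rule smooth_open_real_derivative)
  show "(inverse has_real_derivative (- 1) * (inverse x * inverse x)) (at x)" if "x \<in> - {0}" for x :: real
    using that by (auto intro!: derivative_eq_intros simp: power2_eq_square)
  show "Ck_on k (\<lambda>x::real. (- 1) * (inverse x * inverse x)) (- {0})"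
    if "Ck_on k (inverse :: real \<Rightarrow> real) (- {0})" for k
    by (rule Ck_on_bilinear[OF bounded_bilinear_mult _ Ck_on_const
          Ck_on_bilinear[OF bounded_bilinear_mult _ that that]]) (simp_all add: open_Compl)
qed (simp add: open_Compl)

lemma smooth_open_sqrt: "smooth_open sqrt {0<..}"
proof (rule smooth_open_real_derivative)
  show "(sqrt has_real_derivative inverse (sqrt x) * (1/2)) (at x)" if "x \<in> {0<..}" for x
    using that by (auto intro!: derivative_eq_intros)
  show "Ck_on k (\<lambda>x. inverse (sqrt x) * (1/2)) {0<..}" if k: "Ck_on k sqrt {0<..}" for k
  proof (rule Ck_on_bilinear[OF bounded_bilinear_mult _ _ Ck_on_const])
    show "Ck_on k (\<lambda>x. inverse (sqrt x)) {0<..}"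
      by (rule Ck_on_compose[OF _ _ smooth_openD[OF smooth_open_inverse] k])
        (auto simp: open_Compl)
  qed simp
qed simp

lemma smooth_at_sin [smooth_intros]: "smooth_at f x \<Longrightarrow> smooth_at (\<lambda>x. sin (f x) :: real) x"
  by (rule smooth_at_compose[where f = sin, OF smooth_open_imp_smooth_at[OF smooth_open_sin_cos(1)]]) auto

lemma smooth_at_cos [smooth_intros]: "smooth_at f x \<Longrightarrow> smooth_at (\<lambda>x. cos (f x) :: real) x"
  by (rule smooth_at_compose[where f = cos, OF smooth_open_imp_smooth_at[OF smooth_open_sin_cos(2)]]) auto

lemma smooth_at_sqrt [smooth_intros]: "smooth_at f x \<Longrightarrow> f x > 0 \<Longrightarrow> smooth_at (\<lambda>x. sqrt (f x)) x"
  by (rule smooth_at_compose[where f = sqrt, OF smooth_open_imp_smooth_at[OF smooth_open_sqrt]]) auto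

lemma smooth_at_divide [smooth_intros]:
  fixes f g :: "'a::euclidean_space \<Rightarrow> real"
  assumes "smooth_at f x" "smooth_at g x" "g x \<noteq> 0"
  shows "smooth_at (\<lambda>x. f x / g x) x"
proof -
  have "smooth_at (\<lambda>x. inverse (g x)) x"
    by (rule smooth_at_compose[where f = inverse, OF smooth_open_imp_smooth_at[OF smooth_open_inverse]])
      (use assms in auto)
  then show ?thesis
    using assms(1) by (simp add: divide_inverse smooth_at_mult)
qed

section \<open>Smooth inverse functions and Hadamard's lemma\<close>

lemma smooth_open_iff_smooth_at:
  fixes f :: "'a::euclidean_space \<Rightarrow> 'b::euclidean_space"
  assumes "open S"
  shows "smooth_open f S \<longleftrightarrow> (\<forall>x\<in>S. smooth_at f x)"
proof
  have *: "Ck_on k h S" if "\<forall>x\<in>S. \<exists>W. open W \<and> x \<in> W \<and> Ck_on k h W"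
    for k and h :: "'a \<Rightarrow> 'b"
    using that
  proof (induction k arbitrary: h)
    case 0
    have "isCont h x" if "x \<in> S" for x
    proof -
      obtain W where W: "open W" "x \<in> W" "continuous_on W h"
        using bspec[OF 0 \<open>x \<in> S\<close>] by (elim exE conjE) (simp only: Ck_on.simps)
      then show ?thesis
        using continuous_on_eq_continuous_at[OF W(1)] by blast
    qed
    then show ?case
      by (simp add: continuous_at_imp_continuous_on)
  next
    case (Suc k)
    have "h differentiable (at x)" if "x \<in> S" for x
      using bspec[OF Suc.prems \<open>x \<in> S\<close>] by (elim exE conjE) (simp only: Ck_on.simps)
    moreover have "Ck_on k (\<lambda>x. frechet_derivative h (at x) v) S" for v
    proof (rule Suc.IH, rule ballI)
      fix x assume "x \<in> S"
      then obtain W where "open W" "x \<in> W" "Ck_on (Suc k) h W"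
        using bspec[OF Suc.prems] by blast
      then show "\<exists>W. open W \<and> x \<in> W \<and> Ck_on k (\<lambda>x. frechet_derivative h (at x) v) W"
        by (intro exI[of _ W]) simp
    qed
    ultimately show ?case by simp
  qed
  assume "\<forall>x\<in>S. smooth_at f x"
  then have "\<forall>x\<in>S. \<exists>W. open W \<and> x \<in> W \<and> Ck_on k f W" for k
    unfolding smooth_at_def smooth_open_def by blast
  then show "smooth_open f S"
    unfolding smooth_open_def by (intro allI *)
next
  assume "smooth_open f S"
  with assms show "\<forall>x\<in>S. smooth_at f x"
    unfolding smooth_at_def by blast
qed

lemma smooth_at_det:
  fixes A :: "'a::euclidean_space \<Rightarrow> real^'n^'n"
  assumes "\<And>i j. smooth_at (\<lambda>x. A x $ i $ j) x"
  shows "smooth_at (\<lambda>x. det (A x)) x"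
  unfolding det_def by (intro smooth_at_sum smooth_at_mult smooth_at_const smooth_at_prod assms)

text \<open>The C^1 inverse function theorem gives a differentiable inverse g whose derivative at y
  is the inverse of \<open>F (g y)\<close>. This has the form \<open>R v (g y)\<close> with
  \<open>R v\<close> smooth, so if g is C^k then its derivative is C^k, and g is C^(k+1).\<close>

lemma smooth_inverse_function:
  fixes f :: "real^'n \<Rightarrow> real^'n"
  assumes f: "smooth_at f x0" and D: "(f has_derivative D) (at x0)" "\<And>h. D h = 0 \<Longrightarrow> h = 0"
    and W: "open W" "x0 \<in> W"
  obtains U g where "open U" "x0 \<in> U" "U \<subseteq> W" "open (f ` U)" "smooth_open f U"
    "\<And>x. x \<in> U \<Longrightarrow> g (f x) = x" "smooth_open g (f ` U)"
proof -
  obtain W0 where W0: "open W0" "x0 \<in> W0" "smooth_open f W0"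
    using f unfolding smooth_at_def by blast
  define U0 where "U0 = W0 \<inter> W"
  have U0: "open U0" "x0 \<in> U0"
    unfolding U0_def using W0 W by (simp_all add: open_Int)
  have sf: "smooth_open f U0"
    by (rule smooth_open_subset[OF W0(3)]) (simp add: U0_def)
  define F where "F x = frechet_derivative f (at x)" for x
  have F: "(f has_derivative F x) (at x)" if "x \<in> U0" for x
    unfolding F_def
    by (rule has_frechet_derivative, rule smooth_at_imp_differentiable,
        rule smooth_open_imp_smooth_at[OF sf U0(1) that])
  have sF: "smooth_open (\<lambda>x. F x v) U0" for v
    unfolding F_def by (rule smooth_open_frechet_derivative[OF sf])
  define f' where "f' x = Blinfun (F x)" for x
  have f': "blinfun_apply (f' x) = F x" if "x \<in> U0" for x
    unfolding f'_def by (rule bounded_linear_Blinfun_apply[OF has_derivative_bounded_linear[OF F[OF that]]])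
  have "linear D" by (rule has_derivative_linear[OF D(1)])
  moreover have "inj D"
    using linear_injective_0[OF \<open>linear D\<close>] D(2) by blast
  ultimately obtain D' where D': "linear D'" "\<And>x. D' (D x) = x"
    using linear_injective_isomorphism by blast
  have "F x0 = D"
    by (rule has_derivative_unique[OF F[OF U0(2)] D(1)])
  have 1: "Blinfun D' o\<^sub>L f' x0 = id_blinfun"
    by (rule blinfun_eqI) (use f'[OF U0(2)] D' \<open>F x0 = D\<close>
        bounded_linear_Blinfun_apply[of D'] in \<open>simp add: linear_conv_bounded_linear\<close>)
  have 2: "continuous_on U0 f'"
  proof (rule continuous_on_blinfun_componentwise)
    fix i :: "real^'n"
    have "continuous_on U0 (\<lambda>x. F x i)"
      by (rule Ck_on_imp_continuous_on[OF smooth_openD[OF sF]])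
    then show "continuous_on U0 (\<lambda>x. blinfun_apply (f' x) i)"
      by (rule continuous_on_eq) (simp add: f')
  qed
  have 3: "(f has_derivative blinfun_apply (f' x)) (at x)" if "x \<in> U0" for x
    unfolding f'[OF that] by (rule F[OF that])
  obtain U V g g' where UV: "open U" "U \<subseteq> U0" "x0 \<in> U" "open V" "f x0 \<in> V" "homeomorphism U V f g"
    and g': "\<And>y. y \<in> V \<Longrightarrow> (g has_derivative g' y) (at y)"
      "\<And>y. y \<in> V \<Longrightarrow> g' y = inv (blinfun_apply (f' (g y)))"
      "\<And>y. y \<in> V \<Longrightarrow> bij (blinfun_apply (f' (g y)))"
    using inverse_function_theorem[where f = f and f' = f' and U = U0 and ?x0.0 = x0, OF U0(1) 3 2 U0(2) 1]
    by blast
  have V: "V = f ` U" and gf: "\<And>x. x \<in> U \<Longrightarrow> g (f x) = x" and gV: "g ` V \<subseteq> U"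
    using UV(6) unfolding homeomorphism_def by auto
  \<comment> \<open>Cramer's rule for the solution of \<open>matrix (F x) *v z = v\<close>:
    determinants are polynomial in the entries, so smoothness of the inverse reduces to a nonzero
    denominator.\<close>
  define R where "R v x = (\<chi> k. det (\<chi> i j. if j = k then v $ i else matrix (F x) $ i $ j) / det (matrix (F x)))"
    for v x
  have g'R: "g' y v = R v (g y)" and det: "det (matrix (F (g y))) \<noteq> 0" if "y \<in> V" for y v
  proof -
    have gy: "g y \<in> U0" using gV UV(2) that by blast
    have lin: "linear (F (g y))" by (rule has_derivative_linear[OF F[OF gy]])
    have bij: "bij (F (g y))" using g'(3)[OF that] by (simp add: f'[OF gy])
    then show det: "det (matrix (F (g y))) \<noteq> 0"
      using det_nz_iff_inj[OF lin] bij_is_inj by blast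
    have "F (g y) (g' y v) = v"
      using g'(2)[OF that] bij by (simp add: f'[OF gy] bij_is_surj surj_f_inv_f)
    then have "matrix (F (g y)) *v g' y v = v"
      using fun_cong[OF matrix_vector_mul(2)[OF lin]] by simp
    then show "g' y v = R v (g y)"
      unfolding R_def using cramer[OF det] by blast
  qed
  have sR: "smooth_open (R v) U" for v
    unfolding smooth_open_iff_smooth_at[OF UV(1)]
  proof
    fix x assume "x \<in> U"
    then have x: "x \<in> U0" "f x \<in> V" "g (f x) = x" using UV(2) V gf by auto
    have dx: "det (matrix (F x)) \<noteq> 0" using det[OF x(2)] x(3) by simp
    have m: "smooth_at (\<lambda>x. matrix (F x) $ i $ j) x" for i j
      unfolding matrix_def
      using smooth_at_vec_nth[OF smooth_open_imp_smooth_at[OF sF[of "axis j 1"] U0(1) x(1)], of i]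
      by simp
    have "smooth_at (\<lambda>x. (\<chi> i j. if j = k then v $ i else matrix (F x) $ i $ j) $ i $ j) x" for i j k
      using m[of i j] by (cases "j = k") (simp_all add: smooth_at_const)
    then have "smooth_at (\<lambda>x. det (\<chi> i j. if j = k then v $ i else matrix (F x) $ i $ j)) x" for k
      by (rule smooth_at_det)
    from smooth_at_divide[OF this smooth_at_det[OF m] dx]
    have "smooth_at (\<lambda>x. R v x $ k) x" for k
      unfolding R_def vec_lambda_beta .
    then show "smooth_at (R v) x"
      by (rule smooth_at_vec)
  qed
  have "Ck_on k g V" for k
  proof (induction k)
    case 0
    then show ?case using UV(6) by (simp add: homeomorphism_def)
  next
    case (Suc k)
    show ?case
    proof (rule Ck_on_SucI[OF UV(4) g'(1)])
      fix v
      have "Ck_on k (\<lambda>y. R v (g y)) V"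
        by (rule Ck_on_compose[OF UV(4,1) smooth_openD[OF sR] Suc gV])
      then show "Ck_on k (\<lambda>y. g' y v) V"
        by (rule Ck_on_cong[OF UV(4), rotated]) (simp add: g'R)
    qed
  qed
  then have "smooth_open g (f ` U)"
    unfolding smooth_open_def V[symmetric] by blast
  moreover have "smooth_open f U"
    by (rule smooth_open_subset[OF sf UV(2)])
  moreover have "U \<subseteq> W" using UV(2) unfolding U0_def by blast
  moreover have "open (f ` U)" using UV(4) V by simp
  ultimately show ?thesis
    using that UV(1,3) gf by blast
qed

text \<open>Iterated differentiation under the integral sign. The integrand lives on an open set
  around {0..1} \<times> W because \<open>Ck_on\<close> takes derivatives in the ambient space,
  hence also in the direction of t.\<close>

lemma Ck_on_integral:
  fixes \<Phi> :: "real \<times> 'a::euclidean_space \<Rightarrow> 'b::euclidean_space"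
  assumes "open \<Omega>" "open W" "{0..1} \<times> W \<subseteq> \<Omega>" "Ck_on k \<Phi> \<Omega>"
  shows "Ck_on k (\<lambda>x. integral {0..1} (\<lambda>t. \<Phi> (t, x))) W"
  using assms(4)
proof (induction k arbitrary: \<Phi>)
  case 0
  have "continuous_on (W \<times> {0..1}) (\<lambda>p. \<Phi> (snd p, fst p))"
    by (rule continuous_on_compose2[of \<Omega> \<Phi>])
      (use 0 assms(3) in \<open>auto intro!: continuous_intros\<close>)
  then have "continuous_on W (\<lambda>x. integral (cbox 0 1) (\<lambda>t. \<Phi> (t, x)))"
    by (intro integral_continuous_on_param) (simp add: case_prod_unfold)
  then show ?case by simp
next
  case (Suc k)
  define D where "D p v = frechet_derivative \<Phi> (at p) (0, v)" for p v
  have D: "((\<lambda>x. \<Phi> (t, x)) has_derivative D (t, x)) (at x)" if "(t, x) \<in> \<Omega>" for t x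
  proof -
    have "((\<lambda>x. (t, x)) has_derivative (\<lambda>v. (0, v))) (at x)"
      by (auto intro!: derivative_eq_intros)
    moreover have "(\<Phi> has_derivative frechet_derivative \<Phi> (at (t, x))) (at (t, x))"
      by (rule has_frechet_derivative) (use Suc.prems that in simp)
    ultimately show ?thesis
      unfolding D_def by (rule has_derivative_compose)
  qed
  have Ck: "Ck_on k (\<lambda>p. D p v) \<Omega>" for v
    unfolding D_def using Suc.prems by simp
  have cD: "continuous_on (S \<times> {0..1}) (\<lambda>p. D (snd p, fst p) v)" if "S \<subseteq> W" for v S
  proof -
    have "continuous_on (S \<times> {0..1::real}) (\<lambda>p. (snd p, fst p))"
      by (intro continuous_intros)
    moreover have "(\<lambda>p. (snd p, fst p)) ` (S \<times> {0..1::real}) \<subseteq> \<Omega>"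
    proof (rule image_subsetI)
      fix p assume "p \<in> S \<times> {0..1::real}"
      then have "(snd p, fst p) \<in> {0..1} \<times> W"
        using that unfolding mem_Times_iff fst_conv snd_conv by blast
      with assms(3) show "(snd p, fst p) \<in> \<Omega>" by (rule subsetD)
    qed
    ultimately show ?thesis
      by (rule continuous_on_compose2[OF Ck_on_imp_continuous_on[OF Ck]])
  qed
  define f' where "f' x t = Blinfun (D (t, x))" for x t
  have f': "blinfun_apply (f' x t) = D (t, x)" if "x \<in> W" "t \<in> {0..1}" for x t
    unfolding f'_def
    by (rule bounded_linear_Blinfun_apply[OF has_derivative_bounded_linear[OF D]],
        rule subsetD[OF assms(3)]) (use that in simp)
  have cf': "continuous_on (S \<times> {0..1}) (\<lambda>p. f' (fst p) (snd p))" if "S \<subseteq> W" for S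
  proof (rule continuous_on_blinfun_componentwise)
    fix i :: 'a
    show "continuous_on (S \<times> {0..1}) (\<lambda>p. blinfun_apply (f' (fst p) (snd p)) i)"
    proof (rule continuous_on_eq[OF cD[OF that, of i]])
      fix p assume "p \<in> S \<times> {0..1::real}"
      then have "fst p \<in> W" "snd p \<in> {0..1}"
        using that unfolding mem_Times_iff by blast+
      then show "D (snd p, fst p) i = blinfun_apply (f' (fst p) (snd p)) i"
        by (simp only: f')
    qed
  qed
  show ?case
  proof (rule Ck_on_SucI[OF assms(2)])
    fix x assume x: "x \<in> W"
    \<comment> \<open>The Leibniz rule is applied on a convex neighbourhood of x.\<close>
    obtain e where e: "e > 0" "ball x e \<subseteq> W"
      using assms(2) x open_contains_ball by blast
    have "((\<lambda>x. integral (cbox 0 1) (\<lambda>t. \<Phi> (t, x))) has_derivative integral (cbox 0 1) (f' x)) (at x within ball x e)"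
    proof (rule leibniz_rule)
      fix y t assume y: "y \<in> ball x e" and t: "t \<in> cbox (0::real) 1"
      have "y \<in> W" by (rule subsetD[OF e(2) y])
      then have "(t, y) \<in> {0..1} \<times> W" using t by simp
      with assms(3) have "(t, y) \<in> \<Omega>" by (rule subsetD)
      have "t \<in> {0..1}" using t by simp
      show "((\<lambda>x. \<Phi> (t, x)) has_derivative blinfun_apply (f' y t)) (at y within ball x e)"
        unfolding f'[OF \<open>y \<in> W\<close> \<open>t \<in> {0..1}\<close>]
        by (rule has_derivative_at_withinI[OF D[OF \<open>(t, y) \<in> \<Omega>\<close>]])
    next
      fix y assume y: "y \<in> ball x e"
      have "y \<in> W" by (rule subsetD[OF e(2) y])
      have "continuous_on (cbox (0::real) 1) (\<lambda>t. (t, y))"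
        by (intro continuous_intros)
      moreover have "(\<lambda>t. (t, y)) ` cbox (0::real) 1 \<subseteq> \<Omega>"
      proof (rule image_subsetI)
        fix t :: real assume "t \<in> cbox 0 1"
        then have "(t, y) \<in> {0..1} \<times> W" using \<open>y \<in> W\<close> by simp
        with assms(3) show "(t, y) \<in> \<Omega>" by (rule subsetD)
      qed
      ultimately have "continuous_on (cbox 0 1) (\<lambda>t. \<Phi> (t, y))"
        by (rule continuous_on_compose2[OF Ck_on_imp_continuous_on[OF Suc.prems]])
      then show "(\<lambda>t. \<Phi> (t, y)) integrable_on cbox 0 1"
        by (rule integrable_continuous)
    next
      show "continuous_on (ball x e \<times> cbox 0 1) (\<lambda>(x, t). f' x t)"
        using cf'[OF e(2)] by (simp add: case_prod_unfold)
    qed (use e in simp_all)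
    then have 1: "((\<lambda>x. integral {0..1} (\<lambda>t. \<Phi> (t, x))) has_derivative integral {0..1} (f' x)) (at x)"
      using e(1) at_within_open[of x "ball x e"] by simp
    have "continuous_on {0..1::real} (\<lambda>t. (x, t))"
      by (intro continuous_intros)
    moreover have "(\<lambda>t. (x, t)) ` {0..1::real} \<subseteq> {x} \<times> {0..1}"
      by auto
    ultimately have "continuous_on {0..1} (f' x)"
      using continuous_on_compose2[OF cf'[of "{x}"], of "{0..1}" "\<lambda>t. (x, t)"] x by simp
    then have "blinfun_apply (integral {0..1} (f' x)) v = integral {0..1} (\<lambda>t. f' x t v)" for v
      by (intro blinfun_apply_integral integrable_continuous_interval)
    also have "integral {0..1} (\<lambda>t. f' x t v) = integral {0..1} (\<lambda>t. D (t, x) v)" for v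
      by (rule integral_cong) (simp add: f'[OF x])
    finally have 2: "blinfun_apply (integral {0..1} (f' x)) = (\<lambda>v. integral {0..1} (\<lambda>t. D (t, x) v))"
      by (rule ext)
    show "((\<lambda>x. integral {0..1} (\<lambda>t. \<Phi> (t, x))) has_derivative (\<lambda>v. integral {0..1} (\<lambda>t. D (t, x) v))) (at x)"
      using 1 unfolding 2 .
  next
    fix v
    show "Ck_on k (\<lambda>x. integral {0..1} (\<lambda>t. D (t, x) v)) W"
      by (rule Suc.IH[OF Ck])
  qed
qed

text \<open>K is the mean of the partial derivative of F in the first variable over the segment from
  (a, y) to (x, y); the factorisation is the fundamental theorem of calculus along that segment. The
  last conclusion tells when K vanishes on the line x = a as well, so that the lemma can be applied
  to K again.\<close>

lemma Hadamard_lemma: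
  fixes F :: "real \<times> real \<Rightarrow> real"
  assumes F: "smooth_at F (a, b)" and zero: "\<forall>\<^sub>F y in nhds b. F (a, y) = 0"
  obtains K where "smooth_at K (a, b)" "\<forall>\<^sub>F p in nhds (a, b). F p = (fst p - a) * K p"
    "\<forall>\<^sub>F y in nhds b. K (a, y) = frechet_derivative F (at (a, y)) (1, 0)"
proof -
  obtain W where W: "open W" "(a, b) \<in> W" "smooth_open F W"
    using F unfolding smooth_at_def by blast
  obtain A B where AB: "open A" "a \<in> A" "open B" "b \<in> B" "A \<times> B \<subseteq> W"
    using W(1,2) by (auto elim: open_prod_elim)
  obtain e where e: "e > 0" "ball a e \<subseteq> A"
    using AB open_contains_ball by blast
  obtain B' where B': "open B'" "b \<in> B'" "\<And>y. y \<in> B' \<Longrightarrow> F (a, y) = 0"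
    using zero by (auto simp: eventually_nhds)
  \<comment> \<open>The first factor is convex, so the box contains the segments over which K
    averages.\<close>
  define I J where "I = ball a e" and "J = B \<inter> B'"
  have IJ: "open I" "open J" "a \<in> I" "b \<in> J" "I \<times> J \<subseteq> W" "convex I"
    using e AB B' by (auto simp: I_def J_def)
  have sF: "smooth_open F (I \<times> J)"
    by (rule smooth_open_subset[OF W(3) IJ(5)])
  have open_IJ: "open (I \<times> J)"
    by (rule open_Times[OF IJ(1,2)])
  define D where "D p = frechet_derivative F (at p) (1, 0)" for p
  have sD: "smooth_open D (I \<times> J)"
    unfolding D_def by (rule smooth_open_frechet_derivative[OF sF])
  define m :: "real \<times> real \<times> real \<Rightarrow> real \<times> real"
    where "m q = (a + fst q * (fst (snd q) - a), snd (snd q))" for q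
  have sm: "smooth_at m q" for q
    unfolding m_def by (intro smooth_intros)
  have "continuous_on UNIV m"
    unfolding m_def by (intro continuous_intros)
  then have \<Omega>: "open (m -` (I \<times> J))"
    by (rule open_vimage[OF open_IJ])
  have mI: "m (t, p) \<in> I \<times> J" if "t \<in> {0..1}" "p \<in> I \<times> J" for t p
  proof -
    have "(1 - t) *\<^sub>R a + t *\<^sub>R fst p \<in> I"
      by (rule convexD_alt[OF IJ(6)]) (use that IJ in auto)
    also have "(1 - t) *\<^sub>R a + t *\<^sub>R fst p = fst (m (t, p))"
      by (simp add: m_def algebra_simps)
    finally show ?thesis using that by (simp add: m_def mem_Times_iff)
  qed
  have sDm: "smooth_open (\<lambda>q. D (m q)) (m -` (I \<times> J))"
    by (rule smooth_open_compose[OF \<Omega> open_IJ sD]) (use sm in \<open>auto simp: smooth_open_iff_smooth_at[OF \<Omega>]\<close>)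
  define K where "K p = integral {0..1} (\<lambda>t. D (m (t, p)))" for p
  have "Ck_on k K (I \<times> J)" for k
    unfolding K_def
    by (rule Ck_on_integral[OF \<Omega> open_IJ _ smooth_openD[OF sDm]]) (use mI in auto)
  then have 1: "smooth_at K (a, b)"
    by (intro smooth_open_imp_smooth_at[of K "I \<times> J"]) (use IJ open_IJ in \<open>auto simp: smooth_open_def\<close>)
  have FK: "F p = (fst p - a) * K p" if p: "p \<in> I \<times> J" for p
  proof -
    have "((\<lambda>t. F (m (t, p))) has_vector_derivative (fst p - a) * D (m (t, p))) (at t)"
      if "t \<in> {0..1}" for t
    proof -
      have "((\<lambda>t. m (t, p)) has_derivative (\<lambda>h. (h * (fst p - a), 0))) (at t)"
        unfolding m_def by (auto intro!: derivative_eq_intros)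
      moreover have dF: "(F has_derivative frechet_derivative F (at (m (t, p)))) (at (m (t, p)))"
        by (rule has_frechet_derivative, rule smooth_at_imp_differentiable,
            rule smooth_open_imp_smooth_at[OF sF open_IJ mI[OF that p]])
      ultimately have "((\<lambda>t. F (m (t, p))) has_derivative
          (\<lambda>h. frechet_derivative F (at (m (t, p))) (h * (fst p - a), 0))) (at t)"
        by (rule has_derivative_compose)
      moreover have "frechet_derivative F (at (m (t, p))) (h * (fst p - a), 0) = h *\<^sub>R ((fst p - a) * D (m (t, p)))" for h
        using linear_scale[OF has_derivative_linear[OF dF], of "h * (fst p - a)" "(1, 0)"]
        by (simp add: D_def)
      ultimately show ?thesis
        by (simp add: has_vector_derivative_def)
    qed
    then have "((\<lambda>t. (fst p - a) * D (m (t, p))) has_integral F (m (1, p)) - F (m (0, p))) {0..1}"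
      by (intro fundamental_theorem_of_calculus) (auto intro: has_vector_derivative_at_within)
    moreover have z: "F (m (0, p)) = 0" "m (1, p) = p"
      using p B' by (auto simp: m_def J_def)
    ultimately have "((\<lambda>t. (fst p - a) * D (m (t, p))) has_integral F p) {0..1}"
      unfolding z diff_zero by blast
    from integral_unique[OF this] show ?thesis
      unfolding K_def integral_mult_right by (rule sym)
  qed
  have 2: "\<forall>\<^sub>F p in nhds (a, b). F p = (fst p - a) * K p"
    unfolding eventually_nhds using open_IJ IJ(3,4) FK by (intro exI[of _ "I \<times> J"]) blast
  have 3: "K (a, y) = frechet_derivative F (at (a, y)) (1, 0)" for y
    by (simp add: K_def m_def D_def)
  show ?thesis
    by (rule that[OF 1 2]) (simp add: 3)
qed

section \<open>Quaternions and left trivialisation\<close>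

text \<open>The matrix of the quaternion a + b j; the unit quaternions form SU(2).\<close>

definition quat :: "complex \<Rightarrow> complex \<Rightarrow> cmat" where
  "quat a b = vector [vector [a, b], vector [- cnj b, cnj a]]"

text \<open>The coordinates are (u, v, w) with respect to \<open>X1\<close>, \<open>X2\<close>,
  \<open>X0\<close>, so index 3 belongs to \<open>X0\<close>.\<close>

definition su2 :: "real^3 \<Rightarrow> cmat" where
  "su2 x = quat (Complex 0 (x $ 3 / 2)) (Complex (x $ 1 / 2) (x $ 2 / 2))"

lemma quat_nth [simp]:
  "quat a b $ 1 $ 1 = a" "quat a b $ 1 $ 2 = b" "quat a b $ 2 $ 1 = - cnj b" "quat a b $ 2 $ 2 = cnj a"
  by (simp_all add: quat_def vector_2)

lemma cmat_eq_iff: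
  "(A :: cmat) = B \<longleftrightarrow> A $ 1 $ 1 = B $ 1 $ 1 \<and> A $ 1 $ 2 = B $ 1 $ 2 \<and> A $ 2 $ 1 = B $ 2 $ 1 \<and> A $ 2 $ 2 = B $ 2 $ 2"
  by (simp add: vec_eq_iff forall_2)

lemma quat_eq_iff: "quat a b = quat c d \<longleftrightarrow> a = c \<and> b = d"
  by (auto simp: cmat_eq_iff)

lemma quat_mult: "quat a b ** quat c d = quat (a * c - b * cnj d) (a * d + b * cnj c)"
  by (simp add: cmat_eq_iff matrix_matrix_mult_def sum_2 algebra_simps)

lemma quat_add: "quat a b + quat c d = quat (a + c) (b + d)"
  by (simp add: cmat_eq_iff)

lemma quat_diff: "quat a b - quat c d = quat (a - c) (b - d)"
  by (simp add: cmat_eq_iff)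

lemma quat_minus: "- quat a b = quat (- a) (- b)"
  by (simp add: cmat_eq_iff)

lemma quat_scaleR: "r *\<^sub>R quat a b = quat (r *\<^sub>R a) (r *\<^sub>R b)"
  by (simp add: cmat_eq_iff)

lemma mat_1_quat: "mat 1 = quat 1 0"
  by (simp add: cmat_eq_iff mat_def)

lemma adjoint_mat_quat: "adjoint_mat (quat a b) = quat (cnj a) (- b)"
  by (simp add: cmat_eq_iff adjoint_mat_def)

lemma metric_quat: "metric (quat a b) (quat c d) = 4 * (a \<bullet> c + b \<bullet> d)"
  by (simp add: metric_def inner_vec_def sum_2 inner_complex_def)

lemma quat_in_SU2_iff: "quat a b \<in> SU2 \<longleftrightarrow> (cmod a)\<^sup>2 + (cmod b)\<^sup>2 = 1"
proof -
  have det: "det (quat a b) = a * cnj a + b * cnj b"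
    by (simp add: det_2)
  have mult: "quat a b ** adjoint_mat (quat a b) = quat (a * cnj a + b * cnj b) 0"
    by (simp add: adjoint_mat_quat quat_mult)
  have "a * cnj a + b * cnj b = of_real ((cmod a)\<^sup>2 + (cmod b)\<^sup>2)"
    by (simp only: complex_norm_square of_real_add)
  then show ?thesis
    unfolding SU2_def mem_Collect_eq det mult mat_1_quat quat_eq_iff
    by (simp only: of_real_eq_1_iff simp_thms)
qed

text \<open>Orthogonality of the rows and the value of the determinant are two linear equations for
  the second row; they determine it from the first.\<close>

lemma SU2_eq_quat:
  assumes "A \<in> SU2"
  shows "A = quat (A $ 1 $ 1) (A $ 1 $ 2)"
proof -
  define a b c d where abcd: "a = A $ 1 $ 1" "b = A $ 1 $ 2" "c = A $ 2 $ 1" "d = A $ 2 $ 2"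
  have 1: "a * cnj a + b * cnj b = 1" and 2: "c * cnj a + d * cnj b = 0" and 3: "a * d - b * c = 1"
    using assms
    by (simp_all add: SU2_def adjoint_mat_def matrix_matrix_mult_def sum_2 cmat_eq_iff mat_def det_2 abcd)
  have "d = d * (a * cnj a + b * cnj b) - b * (c * cnj a + d * cnj b)"
    using 1 2 by simp
  also have "\<dots> = (a * d - b * c) * cnj a" by (simp add: algebra_simps)
  finally have "d = cnj a" using 3 by simp
  have "c = c * (a * cnj a + b * cnj b) - a * (c * cnj a + d * cnj b)"
    using 1 2 by simp
  also have "\<dots> = - (a * d - b * c) * cnj b" by (simp add: algebra_simps)
  finally have "c = - cnj b" using 3 by simp
  with \<open>d = cnj a\<close> show ?thesis
    by (simp add: cmat_eq_iff abcd)
qed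

lemma SU2_quatE:
  assumes "A \<in> SU2"
  obtains a b where "A = quat a b" "(cmod a)\<^sup>2 + (cmod b)\<^sup>2 = 1"
  using SU2_eq_quat[OF assms] assms quat_in_SU2_iff by metis

lemma SU2_adjoint:
  assumes "q \<in> SU2"
  shows "adjoint_mat q ** q = mat 1" "q ** adjoint_mat q = mat 1"
  using assms by (simp_all add: SU2_def matrix_left_right_inverse)

lemma adjoint_mat_1: "adjoint_mat (mat 1) = mat 1"
  by (simp add: mat_1_quat adjoint_mat_quat)

lemma SU2_mult: "p \<in> SU2 \<Longrightarrow> q \<in> SU2 \<Longrightarrow> p ** q \<in> SU2"
proof -
  assume pq: "p \<in> SU2" "q \<in> SU2"
  have "(p ** q) ** adjoint_mat (p ** q) = p ** (q ** adjoint_mat q) ** adjoint_mat p"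
    by (simp add: adjoint_mat_mult matrix_mul_assoc)
  then show ?thesis
    using pq by (simp add: SU2_def det_mul)
qed

lemma SU2_adjoint_mem: "q \<in> SU2 \<Longrightarrow> adjoint_mat q \<in> SU2"
  by (elim SU2_quatE) (simp add: adjoint_mat_quat quat_in_SU2_iff)

lemma SU2_cancel_left [simp]:
  "q \<in> SU2 \<Longrightarrow> adjoint_mat q ** (q ** A) = A"
  "q \<in> SU2 \<Longrightarrow> q ** (adjoint_mat q ** A) = A"
  by (simp_all add: SU2_adjoint matrix_mul_assoc)

lemma SU2_left_eq_iff: "q \<in> SU2 \<Longrightarrow> q ** A = q ** B \<longleftrightarrow> A = B"
  by (metis SU2_cancel_left(1))

lemma bounded_bilinear_cmat_mult: "bounded_bilinear ((**) :: cmat \<Rightarrow> cmat \<Rightarrow> cmat)"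
proof -
  have right: "linear (\<lambda>B::cmat. A ** B)" for A :: cmat
  proof (rule linearI)
    show "A ** (B + C) = A ** B + A ** C" for B C by (rule matrix_add_ldistrib)
    show "A ** (r *\<^sub>R B) = r *\<^sub>R (A ** B)" for r B
      by (simp add: vec_eq_iff matrix_matrix_mult_def scaleR_sum_right)
  qed
  have left: "linear (\<lambda>A::cmat. A ** B)" for B :: cmat
  proof (rule linearI)
    show "(A + C) ** B = A ** B + C ** B" for A C :: cmat
      by (simp add: vec_eq_iff matrix_matrix_mult_def sum.distrib distrib_right)
    show "(r *\<^sub>R A) ** B = r *\<^sub>R (A ** B)" for r and A :: cmat
      by (simp add: vec_eq_iff matrix_matrix_mult_def scaleR_sum_right)
  qed
  have "bilinear ((**) :: cmat \<Rightarrow> cmat \<Rightarrow> cmat)"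
    unfolding bilinear_def by (intro conjI allI left right)
  then show ?thesis
    by (rule bilinear_conv_bounded_bilinear[THEN iffD1])
qed

lemmas bounded_linear_cmat_mult_left = bounded_bilinear.bounded_linear_left[OF bounded_bilinear_cmat_mult]
lemmas bounded_linear_cmat_mult_right = bounded_bilinear.bounded_linear_right[OF bounded_bilinear_cmat_mult]
lemmas has_vector_derivative_cmat_mult = bounded_bilinear.has_vector_derivative[OF bounded_bilinear_cmat_mult]

lemma bounded_linear_adjoint_mat: "bounded_linear (adjoint_mat :: cmat \<Rightarrow> cmat)"
  unfolding linear_conv_bounded_linear[symmetric]
  by (intro linearI) (simp_all add: cmat_eq_iff adjoint_mat_def)

lemmas has_vector_derivative_adjoint_mat = bounded_linear.has_vector_derivative[OF bounded_linear_adjoint_mat]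

lemma bounded_linear_quat: "bounded_linear (\<lambda>z. quat (fst z) (snd z))"
  unfolding linear_conv_bounded_linear[symmetric]
  by (intro linearI) (simp_all add: cmat_eq_iff)

lemma bounded_linear_cmat_nth: "bounded_linear (\<lambda>A::cmat. A $ i $ j)"
  by (rule bounded_linear_compose[OF bounded_linear_vec_nth bounded_linear_vec_nth])

lemma has_vector_derivative_quat:
  assumes "(a has_vector_derivative a') (at t)" "(b has_vector_derivative b') (at t)"
  shows "((\<lambda>t. quat (a t) (b t)) has_vector_derivative quat a' b') (at t)"
  using bounded_linear.has_vector_derivative[OF bounded_linear_quat has_vector_derivative_Pair[OF assms]]
  by simp

lemma bounded_linear_su2: "bounded_linear su2"
  unfolding linear_conv_bounded_linear[symmetric]
  by (intro linearI) (simp_all add: su2_def cmat_eq_iff complex_eq_iff algebra_simps)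

lemmas su2_add = linear_add[OF bounded_linear.linear[OF bounded_linear_su2]]

text \<open>Defined linearly on all matrices, so that coordinates on the Lie algebra extend smoothly
  to the ambient space.\<close>

definition su2_inv :: "cmat \<Rightarrow> real^3" where
  "su2_inv A = vector [2 * Re (A $ 1 $ 2), 2 * Im (A $ 1 $ 2), 2 * Im (A $ 1 $ 1)]"

lemma su2_inv_su2 [simp]: "su2_inv (su2 x) = x"
  by (simp add: su2_inv_def su2_def vec_eq_iff forall_3)

lemma su2_eq_iff: "su2 x = su2 y \<longleftrightarrow> x = y"
  by (metis su2_inv_su2)

lemma bounded_linear_su2_inv: "bounded_linear su2_inv"
  unfolding linear_conv_bounded_linear[symmetric]
  by (intro linearI) (simp_all add: su2_inv_def vec_eq_iff forall_3 algebra_simps)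

lemma X_su2: "X0 = su2 (axis 3 1)" "X1 = su2 (axis 1 1)" "X2 = su2 (axis 2 1)"
  by (simp_all add: X0_def X1_def X2_def su2_def cmat_eq_iff complex_eq_iff axis_def)

lemma su2_eq_sum: "su2 x = x $ 1 *\<^sub>R X1 + x $ 2 *\<^sub>R X2 + x $ 3 *\<^sub>R X0"
  by (simp add: X0_def X1_def X2_def su2_def cmat_eq_iff complex_eq_iff)

lemma adjoint_mat_su2: "adjoint_mat (su2 x) = - su2 x"
  by (simp add: su2_def adjoint_mat_quat quat_minus quat_eq_iff complex_eq_iff)

lemma metric_su2: "metric (su2 x) (su2 y) = x \<bullet> y"
  by (simp add: su2_def metric_quat inner_complex_def inner_vec_def sum_3)

text \<open>The symmetric part of the product is a real multiple of the identity and hence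
  orthogonal to su(2); what remains is half the commutator.\<close>

lemma metric_su2_mult: "metric (su2 x ** su2 y) (su2 z) = (cross3 x y \<bullet> z) / 2"
  by (simp add: su2_def metric_quat quat_mult inner_complex_def inner_vec_def sum_3 cross3_def algebra_simps)

lemma su2_commutator: "su2 x ** su2 y - su2 y ** su2 x = su2 (cross3 x y)"
  by (simp add: su2_def quat_mult quat_diff quat_eq_iff complex_eq_iff cross3_def algebra_simps)

lemma cotangent_space_eq: "cotangent_space q = range (\<lambda>x. q ** su2 x)"
proof -
  have lin: "q ** su2 x = x $ 1 *\<^sub>R (q ** X1) + x $ 2 *\<^sub>R (q ** X2) + x $ 3 *\<^sub>R (q ** X0)" for x
    unfolding su2_eq_sum
    by (simp add: bounded_bilinear.add_right[OF bounded_bilinear_cmat_mult]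
        bounded_bilinear.scaleR_right[OF bounded_bilinear_cmat_mult])
  show ?thesis
  proof (intro equalityI subsetI)
    fix \<mu> assume "\<mu> \<in> cotangent_space q"
    then obtain u v w where "\<mu> - u *\<^sub>R (q ** X1) - v *\<^sub>R (q ** X2) - w *\<^sub>R (q ** X0) = 0"
      unfolding cotangent_space_def span_breakdown_eq by auto
    then have "\<mu> = q ** su2 (vector [u, v, w])"
      unfolding lin by (simp add: algebra_simps)
    then show "\<mu> \<in> range (\<lambda>x. q ** su2 x)" by blast
  next
    fix \<mu> assume "\<mu> \<in> range (\<lambda>x. q ** su2 x)"
    then show "\<mu> \<in> cotangent_space q"
      unfolding cotangent_space_def lin by (auto intro!: span_add span_scale intro: span_base)
  qed
qed

lemma cotangent_spaceE:
  assumes "\<mu> \<in> cotangent_space q"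
  obtains x where "\<mu> = q ** su2 x"
  using assms unfolding cotangent_space_eq by blast

lemma su2_of_cotangent:
  assumes "q \<in> SU2" "\<mu> \<in> cotangent_space q"
  shows "\<mu> = q ** su2 (su2_inv (adjoint_mat q ** \<mu>))"
  using assms(2,1) by (elim cotangent_spaceE) simp

lemma covector_norm_su2: "q \<in> SU2 \<Longrightarrow> covector_norm (q ** su2 x) = norm x"
  by (simp add: covector_norm_def metric_left_invariant metric_su2 norm_eq_sqrt_inner)

lemma Hamiltonian_su2: "q \<in> SU2 \<Longrightarrow> Hamiltonian (q, q ** su2 x) = ((x $ 1)\<^sup>2 + (x $ 2)\<^sup>2) / 2"
  by (simp add: Hamiltonian_def metric_left_invariant X_su2 metric_su2 inner_axis)

section \<open>The Hamiltonian vector field\<close>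

text \<open>After translation to the identity, differentiating |a|^2 + |b|^2 = 1 at (1, 0) kills the
  real part of the first entry, and such quaternions are the elements of su(2).\<close>

lemma tangent_space_SU2:
  assumes c: "\<And>t. c t \<in> SU2" "(c has_vector_derivative v) (at 0)"
  obtains a where "v = c 0 ** su2 a"
proof -
  define A where "A t = adjoint_mat (c 0) ** c t" for t
  define A' where "A' = adjoint_mat (c 0) ** v"
  have A: "A t \<in> SU2" for t
    unfolding A_def by (intro SU2_mult SU2_adjoint_mem c(1))
  have dA: "(A has_vector_derivative A') (at 0)"
    unfolding A_def A'_def by (rule bounded_linear.has_vector_derivative[OF bounded_linear_cmat_mult_right c(2)])
  note da = bounded_linear.has_vector_derivative[OF bounded_linear_cmat_nth dA]
  have "((\<lambda>t. quat (A t $ 1 $ 1) (A t $ 1 $ 2)) has_vector_derivative quat (A' $ 1 $ 1) (A' $ 1 $ 2)) (at 0)"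
    by (rule has_vector_derivative_quat[OF da da])
  then have "(A has_vector_derivative quat (A' $ 1 $ 1) (A' $ 1 $ 2)) (at 0)"
    using SU2_eq_quat[OF A] by simp
  then have A'_quat: "A' = quat (A' $ 1 $ 1) (A' $ 1 $ 2)"
    by (rule vector_derivative_unique_at[OF dA])
  have A0: "A 0 = quat 1 0"
    unfolding A_def SU2_adjoint(1)[OF c(1)] by (rule mat_1_quat)
  have "(cmod (A t $ 1 $ 1))\<^sup>2 + (cmod (A t $ 1 $ 2))\<^sup>2 = 1" for t
    using A[of t] SU2_eq_quat[OF A[of t]] quat_in_SU2_iff by metis
  then have "A t $ 1 $ 1 \<bullet> A t $ 1 $ 1 + A t $ 1 $ 2 \<bullet> A t $ 1 $ 2 = 1" for t
    by (simp add: dot_square_norm)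
  moreover have "((\<lambda>t. A t $ 1 $ 1 \<bullet> A t $ 1 $ 1 + A t $ 1 $ 2 \<bullet> A t $ 1 $ 2) has_vector_derivative
      (A 0 $ 1 $ 1 \<bullet> A' $ 1 $ 1 + A' $ 1 $ 1 \<bullet> A 0 $ 1 $ 1) + (A 0 $ 1 $ 2 \<bullet> A' $ 1 $ 2 + A' $ 1 $ 2 \<bullet> A 0 $ 1 $ 2)) (at 0)"
    by (intro has_vector_derivative_add bounded_bilinear.has_vector_derivative[OF bounded_bilinear_inner] da)
  ultimately have "((\<lambda>t::real. 1::real) has_vector_derivative 2 * Re (A' $ 1 $ 1)) (at 0)"
    by (simp add: A0 inner_complex_def)
  then have "Re (A' $ 1 $ 1) = 0"
    using vector_derivative_unique_at[OF has_vector_derivative_const[of "1::real"]] by fastforce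
  then have "A' = su2 (su2_inv A')"
    by (subst A'_quat) (simp add: su2_def su2_inv_def quat_eq_iff complex_eq_iff)
  then have "v = c 0 ** su2 (su2_inv A')"
    unfolding A'_def using c(1) SU2_cancel_left(2) by metis
  then show ?thesis by (rule that)
qed

lemma SU2_curve:
  obtains \<kappa> :: "real \<Rightarrow> cmat" where "\<kappa> 0 = mat 1" "\<And>t. \<kappa> t \<in> SU2"
    "(\<kappa> has_vector_derivative su2 a) (at 0)"
proof
  \<comment> \<open>The quaternion 1 + t a divided by its norm; as \<open>su2\<close> halves the
    coordinates, the squared norm is 1 + t^2 |a|^2 / 4. The normalising factor is stationary at 0,
    so the velocity there is \<open>su2 a\<close>.\<close>
  define \<kappa> where "\<kappa> t = (1 / sqrt (1 + t\<^sup>2 * (norm a)\<^sup>2 / 4)) *\<^sub>R (mat 1 + t *\<^sub>R su2 a)" for t :: real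
  show "\<kappa> 0 = mat 1" by (simp add: \<kappa>_def)
  show "\<kappa> t \<in> SU2" for t
  proof -
    define s where "s = 1 + t\<^sup>2 * (norm a)\<^sup>2 / 4"
    have s: "s > 0" unfolding s_def by (rule add_pos_nonneg) simp_all
    have na: "(norm a)\<^sup>2 = (a $ 1)\<^sup>2 + (a $ 2)\<^sup>2 + (a $ 3)\<^sup>2"
      by (simp add: norm_vec_def L2_set_def sum_3)
    define z1 z2 where z: "z1 = Complex 1 (t * a $ 3 / 2)" "z2 = Complex (t * a $ 1 / 2) (t * a $ 2 / 2)"
    define r where "r = 1 / sqrt s"
    have "mat 1 + t *\<^sub>R su2 a = quat z1 z2"
      unfolding z mat_1_quat su2_def quat_scaleR quat_add quat_eq_iff by (simp add: complex_eq_iff)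
    then have \<kappa>: "\<kappa> t = quat (r *\<^sub>R z1) (r *\<^sub>R z2)"
      unfolding \<kappa>_def quat_scaleR[symmetric] r_def s_def by simp
    have "(cmod z1)\<^sup>2 + (cmod z2)\<^sup>2 = s"
      unfolding cmod_power2 s_def na z by (simp add: power_divide power_mult_distrib distrib_left add_divide_distrib)
    moreover have "r\<^sup>2 * s = 1"
      using s by (simp add: r_def power_divide)
    ultimately have "(cmod (r *\<^sub>R z1))\<^sup>2 + (cmod (r *\<^sub>R z2))\<^sup>2 = 1"
      by (simp add: power_mult_distrib distrib_left[symmetric])
    then show ?thesis
      unfolding \<kappa> quat_in_SU2_iff .
  qed
  have "((\<lambda>t. 1 / sqrt (1 + t\<^sup>2 * (norm a)\<^sup>2 / 4)) has_real_derivative 0) (at 0)"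
    by (auto intro!: derivative_eq_intros)
  moreover have "((\<lambda>t. mat 1 + t *\<^sub>R su2 a) has_vector_derivative su2 a) (at 0)"
    by (auto intro!: derivative_eq_intros)
  ultimately have "(\<kappa> has_vector_derivative
      (1 / sqrt (1 + 0\<^sup>2 * (norm a)\<^sup>2 / 4)) *\<^sub>R su2 a + 0 *\<^sub>R (mat 1 + 0 *\<^sub>R su2 a)) (at 0)"
    unfolding \<kappa>_def by (rule has_vector_derivative_scaleR)
  then show "(\<kappa> has_vector_derivative su2 a) (at 0)" by simp
qed

text \<open>The parameter a is the velocity of the base point in the left trivialisation, b that of
  the covector coordinates; the term \<open>su2 a ** su2 m\<close> comes from the product
  rule.\<close>

lemma tangent_space_cotangent_bundle:
  assumes q: "q \<in> SU2"
  shows "tangent_space cotangent_bundle (q, q ** su2 m) =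
    {(q ** su2 a, q ** (su2 a ** su2 m + su2 b)) | a b. True}"
proof (intro equalityI subsetI)
  fix \<xi> assume "\<xi> \<in> tangent_space cotangent_bundle (q, q ** su2 m)"
  then obtain c where c: "c 0 = (q, q ** su2 m)" "\<And>t. c t \<in> cotangent_bundle"
      "(c has_vector_derivative \<xi>) (at 0)"
    unfolding tangent_space_def by blast
  define p \<nu> where "p t = fst (c t)" and "\<nu> t = snd (c t)" for t
  have p: "p t \<in> SU2" and \<nu>: "\<nu> t \<in> cotangent_space (p t)" for t
    using c(2)[of t] by (simp_all add: cotangent_bundle_def p_def \<nu>_def case_prod_unfold)
  have p0: "p 0 = q" "\<nu> 0 = q ** su2 m" by (simp_all add: p_def \<nu>_def c(1))
  have dp: "(p has_vector_derivative fst \<xi>) (at 0)"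
    unfolding p_def by (rule bounded_linear.has_vector_derivative[OF bounded_linear_fst c(3)])
  have d\<nu>: "(\<nu> has_vector_derivative snd \<xi>) (at 0)"
    unfolding \<nu>_def by (rule bounded_linear.has_vector_derivative[OF bounded_linear_snd c(3)])
  obtain a where a: "fst \<xi> = q ** su2 a"
    by (rule tangent_space_SU2[of p, OF p dp]) (simp add: p0)
  \<comment> \<open>Left translation makes the covector a curve in the linear space su(2), so its
    velocity stays there; this forces the shape of the second component.\<close>
  define N where "N t = adjoint_mat (p t) ** \<nu> t" for t
  define N' where "N' = adjoint_mat (p 0) ** snd \<xi> + adjoint_mat (fst \<xi>) ** \<nu> 0"
  have dN: "(N has_vector_derivative N') (at 0)"
    unfolding N_def N'_def
    by (rule has_vector_derivative_cmat_mult[OF has_vector_derivative_adjoint_mat[OF dp] d\<nu>])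
  have "N t = su2 (su2_inv (N t))" for t
    unfolding N_def using su2_of_cotangent[OF p \<nu>, of t] SU2_cancel_left(1)[OF p] by metis
  then have "((\<lambda>t. su2 (su2_inv (N t))) has_vector_derivative N') (at 0)"
    using dN by simp
  moreover have "((\<lambda>t. su2 (su2_inv (N t))) has_vector_derivative su2 (su2_inv N')) (at 0)"
    by (intro bounded_linear.has_vector_derivative[OF bounded_linear_su2]
        bounded_linear.has_vector_derivative[OF bounded_linear_su2_inv] dN)
  ultimately have "N' = su2 (su2_inv N')"
    by (rule vector_derivative_unique_at)
  moreover have "N' = adjoint_mat q ** snd \<xi> - su2 a ** su2 m"
    unfolding N'_def p0 a
    by (simp add: adjoint_mat_mult adjoint_mat_su2 matrix_mul_assoc[symmetric] q
        bounded_bilinear.minus_left[OF bounded_bilinear_cmat_mult])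
  ultimately have "adjoint_mat q ** snd \<xi> = su2 a ** su2 m + su2 (su2_inv N')"
    by simp
  then have "snd \<xi> = q ** (su2 a ** su2 m + su2 (su2_inv N'))"
    using SU2_cancel_left(2)[OF q] by metis
  then have "\<xi> = (q ** su2 a, q ** (su2 a ** su2 m + su2 (su2_inv N')))"
    using a by (simp add: prod_eq_iff)
  then show "\<xi> \<in> {(q ** su2 a, q ** (su2 a ** su2 m + su2 b)) | a b. True}"
    by blast
next
  fix \<xi> assume "\<xi> \<in> {(q ** su2 a, q ** (su2 a ** su2 m + su2 b)) | a b. True}"
  then obtain a b where \<xi>: "\<xi> = (q ** su2 a, q ** (su2 a ** su2 m + su2 b))" by blast
  obtain \<kappa> where \<kappa>: "\<kappa> 0 = mat 1" "\<And>t. \<kappa> t \<in> SU2" "(\<kappa> has_vector_derivative su2 a) (at 0)"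
    using SU2_curve by blast
  define c where "c t = (q ** \<kappa> t, q ** (\<kappa> t ** su2 (m + t *\<^sub>R b)))" for t
  have "c t \<in> cotangent_bundle" for t
    unfolding c_def cotangent_bundle_def using SU2_mult[OF q \<kappa>(2)]
    by (simp add: cotangent_space_eq matrix_mul_assoc)
  moreover have "c 0 = (q, q ** su2 m)"
    by (simp add: c_def \<kappa>(1))
  moreover have "(c has_vector_derivative \<xi>) (at 0)"
  proof -
    have 1: "((\<lambda>t. m + t *\<^sub>R b) has_vector_derivative b) (at 0)"
      by (auto intro!: derivative_eq_intros)
    have "((\<lambda>t. \<kappa> t ** su2 (m + t *\<^sub>R b)) has_vector_derivative
        \<kappa> 0 ** su2 b + su2 a ** su2 (m + 0 *\<^sub>R b)) (at 0)"
      by (rule has_vector_derivative_cmat_mult[OF \<kappa>(3) bounded_linear.has_vector_derivative[OF bounded_linear_su2 1]])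
    then have 2: "((\<lambda>t. \<kappa> t ** su2 (m + t *\<^sub>R b)) has_vector_derivative su2 a ** su2 m + su2 b) (at 0)"
      by (simp add: \<kappa>(1) add.commute)
    show ?thesis
      unfolding c_def \<xi>
      by (intro has_vector_derivative_Pair bounded_linear.has_vector_derivative[OF bounded_linear_cmat_mult_right] \<kappa>(3) 2)
  qed
  ultimately show "\<xi> \<in> tangent_space cotangent_bundle (q, q ** su2 m)"
    unfolding tangent_space_def by blast
qed

lemma bounded_bilinear_metric: "bounded_bilinear metric"
proof -
  have *: "metric = (\<lambda>V. (\<bullet>) (2 *\<^sub>R V))"
    by (simp add: fun_eq_iff metric_def)
  show ?thesis
    unfolding * by (rule bounded_bilinear.comp1[OF bounded_bilinear_inner bounded_linear_scaleR_right])
qed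

text \<open>The tautological form is linear in the point, so its exterior derivative has constant
  coefficients.\<close>

lemma symplectic_form_eq:
  "symplectic_form p \<xi> \<eta> = metric (snd \<eta>) (fst \<xi>) - metric (snd \<xi>) (fst \<eta>)"
proof -
  have "frechet_derivative (\<lambda>p. tautological_form p \<eta>) (at p) = (\<lambda>\<xi>. metric (snd \<xi>) (fst \<eta>))" for p \<eta>
  proof (rule frechet_derivative_at[symmetric])
    have "bounded_linear (\<lambda>\<xi>::cmat \<times> cmat. metric (snd \<xi>) (fst \<eta>))"
      by (rule bounded_linear_compose[OF bounded_bilinear.bounded_linear_left[OF bounded_bilinear_metric] bounded_linear_snd])
    then show "((\<lambda>p. tautological_form p \<eta>) has_derivative (\<lambda>\<xi>. metric (snd \<xi>) (fst \<eta>))) (at p)"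
      unfolding tautological_form_def by (rule bounded_linear_imp_has_derivative)
  qed
  then show ?thesis
    by (simp add: symplectic_form_def exterior_derivative_def)
qed

lemma frechet_derivative_Hamiltonian:
  "frechet_derivative Hamiltonian (at p) \<eta> =
    metric (snd p) (fst p ** X1) * (metric (snd p) (fst \<eta> ** X1) + metric (snd \<eta>) (fst p ** X1)) +
    metric (snd p) (fst p ** X2) * (metric (snd p) (fst \<eta> ** X2) + metric (snd \<eta>) (fst p ** X2))"
proof -
  have m: "((\<lambda>p. metric (snd p) (fst p ** X)) has_derivative
      (\<lambda>\<eta>. metric (snd p) (fst \<eta> ** X) + metric (snd \<eta>) (fst p ** X))) (at p)" for X
    by (intro bounded_bilinear.FDERIV[OF bounded_bilinear_metric] has_derivative_snd has_derivative_ident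
        bounded_linear.has_derivative[OF bounded_linear_cmat_mult_left] has_derivative_fst)
  have "(Hamiltonian has_derivative (\<lambda>\<eta>.
    metric (snd p) (fst p ** X1) * (metric (snd p) (fst \<eta> ** X1) + metric (snd \<eta>) (fst p ** X1)) +
    metric (snd p) (fst p ** X2) * (metric (snd p) (fst \<eta> ** X2) + metric (snd \<eta>) (fst p ** X2)))) (at p)"
  proof (rule has_derivative_eq_rhs)
    have H: "Hamiltonian = (\<lambda>p. (1/2) *\<^sub>R (metric (snd p) (fst p ** X1) * metric (snd p) (fst p ** X1) +
        metric (snd p) (fst p ** X2) * metric (snd p) (fst p ** X2)))"
      by (simp add: Hamiltonian_def fun_eq_iff power2_eq_square)
    show "(Hamiltonian has_derivative (\<lambda>\<eta>. (1/2) *\<^sub>R (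
      (metric (snd p) (fst p ** X1) * (metric (snd p) (fst \<eta> ** X1) + metric (snd \<eta>) (fst p ** X1)) +
       (metric (snd p) (fst \<eta> ** X1) + metric (snd \<eta>) (fst p ** X1)) * metric (snd p) (fst p ** X1)) +
      (metric (snd p) (fst p ** X2) * (metric (snd p) (fst \<eta> ** X2) + metric (snd \<eta>) (fst p ** X2)) +
       (metric (snd p) (fst \<eta> ** X2) + metric (snd \<eta>) (fst p ** X2)) * metric (snd p) (fst p ** X2))))) (at p)"
      unfolding H by (intro has_derivative_scaleR_right has_derivative_add has_derivative_mult m)
  qed (simp add: fun_eq_iff algebra_simps)
  from fun_cong[OF frechet_derivative_at[OF this]] show ?thesis by (rule sym)
qed

definition horizontal :: "real^3 \<Rightarrow> real^3" where
  "horizontal m = vector [m $ 1, m $ 2, 0]"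

text \<open>In the left trivialisation the symplectic form becomes d \<bullet> a - c \<bullet> (b -
  m \<times> a), while left invariance of H removes c from its differential. Comparing the terms in
  c and d for all c and d gives a = horizontal m and b = m \<times> a, which is Euler's equation and
  the uniqueness required by the definite description.\<close>

lemma Hamiltonian_field_su2:
  assumes q: "q \<in> SU2"
  shows "Hamiltonian_field (q, q ** su2 m) = (q ** su2 (horizontal m), q ** su2 m ** su2 (horizontal m))"
proof -
  let ?T = "tangent_space cotangent_bundle (q, q ** su2 m)"
  let ?v = "\<lambda>a b. (q ** su2 a, q ** (su2 a ** su2 m + su2 b))"
  have T: "\<xi> \<in> ?T \<longleftrightarrow> (\<exists>a b. \<xi> = ?v a b)" for \<xi>
    unfolding tangent_space_cotangent_bundle[OF q] by blast
  note li = metric_left_invariant[OF q] matrix_mul_assoc[symmetric]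
  have \<omega>: "symplectic_form (q, q ** su2 m) (?v a b) (?v c d) =
      d \<bullet> a - c \<bullet> (b - cross3 m a)" for a b c d
    unfolding symplectic_form_eq fst_conv snd_conv li bounded_bilinear.add_left[OF bounded_bilinear_metric]
      metric_su2 metric_su2_mult
    by (simp add: inner_vec_def sum_3 cross3_def field_simps)
  have dH: "frechet_derivative Hamiltonian (at (q, q ** su2 m)) (?v c d) = d \<bullet> horizontal m" for c d
    unfolding frechet_derivative_Hamiltonian fst_conv snd_conv li bounded_bilinear.add_left[OF bounded_bilinear_metric]
      X_su2 metric_su2 bounded_bilinear.add_left[OF bounded_bilinear_metric]
      metric_su2_mult
    by (simp add: su2_def metric_quat quat_mult inner_complex_def inner_vec_def sum_3 cross3_def axis_def horizontal_def field_simps)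
  \<comment> \<open>The commutator turns \<open>su2 a ** su2 m + su2 b\<close> into
    \<open>su2 m ** su2 a\<close>. Both components of the field are thus multiplied on the right by
    the same element, so base point and covector solve the same linear equation.\<close>
  have eq: "?v (horizontal m) (cross3 m (horizontal m)) = (q ** su2 (horizontal m), q ** su2 m ** su2 (horizontal m))"
    unfolding su2_commutator[symmetric] by (simp add: matrix_mul_assoc)
  show ?thesis
    unfolding Hamiltonian_field_def eq[symmetric]
  proof (rule the_equality)
    show "?v (horizontal m) (cross3 m (horizontal m)) \<in> ?T \<and> (\<forall>\<eta>\<in>?T.
        symplectic_form (q, q ** su2 m) (?v (horizontal m) (cross3 m (horizontal m))) \<eta> =
        frechet_derivative Hamiltonian (at (q, q ** su2 m)) \<eta>)"
      unfolding T Ball_def using \<omega> dH by auto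
  next
    fix \<xi> assume \<xi>: "\<xi> \<in> ?T \<and> (\<forall>\<eta>\<in>?T.
        symplectic_form (q, q ** su2 m) \<xi> \<eta> = frechet_derivative Hamiltonian (at (q, q ** su2 m)) \<eta>)"
    then obtain a b where ab: "\<xi> = ?v a b" using T by blast
    have "d \<bullet> a - c \<bullet> (b - cross3 m a) = d \<bullet> horizontal m" for c d
    proof -
      have "?v c d \<in> ?T" using T by blast
      then show ?thesis using \<xi> unfolding ab \<omega>[symmetric] dH[symmetric, of d c] by blast
    qed
    from this[of _ 0] this[of 0] have "\<forall>d. d \<bullet> a = d \<bullet> horizontal m" "\<forall>c. c \<bullet> (b - cross3 m a) = 0"
      by simp_all
    then have "a = horizontal m" "b - cross3 m a = 0"
      using inner_eq_zero_iff[of "b - cross3 m a"] unfolding vector_eq_ldot by blast+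
    then show "\<xi> = ?v (horizontal m) (cross3 m (horizontal m))"
      using ab by simp
  qed
qed

section \<open>The Hamiltonian flow\<close>

text \<open>With \<open>m = u X1 + v X2 + w X0\<close>, the curve below is \<open>exp (t m) exp (- t w X0)\<close>, for
  \<open>m \<noteq> 0\<close>. In the body frame the covector rotates with speed \<open>w\<close>.\<close>

definition geodesic :: "real^3 \<Rightarrow> real \<Rightarrow> cmat" where
  "geodesic m t =
    quat (Complex (cos (norm m / 2 * t)) (sin (norm m / 2 * t) / norm m * m $ 3))
      ((sin (norm m / 2 * t) / norm m) *\<^sub>R Complex (m $ 1) (m $ 2)) **
    quat (cis (- (m $ 3 / 2 * t))) 0"

definition body_covector :: "real^3 \<Rightarrow> real \<Rightarrow> real^3" where
  "body_covector m t = (let z = Complex (m $ 1) (m $ 2) * cis (m $ 3 * t) in vector [Re z, Im z, m $ 3])"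

lemma geodesic_0: "geodesic m 0 = mat 1"
  by (simp add: geodesic_def quat_mult mat_1_quat quat_eq_iff complex_eq_iff)

lemma norm_real3_square: "(norm m)\<^sup>2 = (m $ 1)\<^sup>2 + (m $ 2)\<^sup>2 + (m $ 3)\<^sup>2" for m :: "real^3"
  by (simp add: norm_vec_def L2_set_def sum_3)

lemma geodesic_SU2:
  assumes "m \<noteq> 0"
  shows "geodesic m t \<in> SU2"
  unfolding geodesic_def
proof (rule SU2_mult)
  let ?c = "cos (norm m / 2 * t)" and ?s = "sin (norm m / 2 * t) / norm m"
  have "(cmod (Complex ?c (?s * m $ 3)))\<^sup>2 + (cmod (?s *\<^sub>R Complex (m $ 1) (m $ 2)))\<^sup>2
    = ?c\<^sup>2 + ?s\<^sup>2 * ((m $ 1)\<^sup>2 + (m $ 2)\<^sup>2 + (m $ 3)\<^sup>2)"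
    unfolding cmod_power2 by (simp add: power_mult_distrib power_divide distrib_left)
  also have "\<dots> = 1"
    unfolding norm_real3_square[symmetric] using assms by (simp add: power_divide)
  finally show "quat (Complex ?c (?s * m $ 3)) (?s *\<^sub>R Complex (m $ 1) (m $ 2)) \<in> SU2"
    unfolding quat_in_SU2_iff .
  show "quat (cis (- (m $ 3 / 2 * t))) 0 \<in> SU2"
    by (simp add: quat_in_SU2_iff)
qed

lemma has_vector_derivative_Complex:
  assumes "(f has_real_derivative f') (at t)" "(g has_real_derivative g') (at t)"
  shows "((\<lambda>t. Complex (f t) (g t)) has_vector_derivative Complex f' g') (at t)"
  using assms by (simp add: has_vector_derivative_complex_iff)

text \<open>Conservation of the right-translated momentum: m commutes with exp (t m), and
  conjugation by exp (- t w X0) rotates the plane of \<open>X1\<close> and \<open>X2\<close>. Hence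
  the covector along the trajectory can be written
  \<open>q ** su2 m ** geodesic m t\<close>.\<close>

lemma geodesic_intertwines: "su2 m ** geodesic m t = geodesic m t ** su2 (body_covector m t)"
proof -
  define k where "k = cis (- (m $ 3 / 2 * t))"
  have k: "k * cnj k = 1" "cnj k * cnj k = cis (m $ 3 * t)"
    by (simp_all add: k_def cis_cnj cis_mult mult.commute)
  have 1: "quat k 0 ** su2 (body_covector m t) = su2 m ** quat k 0"
  proof -
    have "su2 (body_covector m t) = quat (Complex 0 (m $ 3 / 2)) (Complex (m $ 1 / 2) (m $ 2 / 2) * (cnj k * cnj k))"
      unfolding k(2) by (simp add: su2_def body_covector_def quat_eq_iff complex_eq_iff Let_def)
    moreover have "k * (z * (cnj k * cnj k)) = z * cnj k" for z
    proof -
      have "k * (z * (cnj k * cnj k)) = (k * cnj k) * (z * cnj k)" by (simp only: ac_simps)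
      then show ?thesis unfolding k(1) by simp
    qed
    ultimately have "quat k 0 ** su2 (body_covector m t) =
        quat (k * Complex 0 (m $ 3 / 2)) (Complex (m $ 1 / 2) (m $ 2 / 2) * cnj k)"
      by (simp only: quat_mult quat_eq_iff mult_zero_left diff_zero add_0_right simp_thms)
    then show ?thesis
      by (simp add: su2_def[of m] quat_mult mult.commute[of k])
  qed
  define c s where "c = cos (norm m / 2 * t)" and "s = sin (norm m / 2 * t) / norm m"
  define E where "E = quat (Complex c (s * m $ 3)) (s *\<^sub>R Complex (m $ 1) (m $ 2))"
  have E: "E = c *\<^sub>R mat 1 + (2 * s) *\<^sub>R su2 m"
    by (simp add: E_def mat_1_quat su2_def quat_scaleR quat_add quat_eq_iff complex_eq_iff)
  have comm: "su2 m ** E = E ** su2 m"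
    unfolding E by (simp add: bounded_bilinear.add_left[OF bounded_bilinear_cmat_mult] bounded_bilinear.add_right[OF bounded_bilinear_cmat_mult]
        bounded_bilinear.scaleR_left[OF bounded_bilinear_cmat_mult] bounded_bilinear.scaleR_right[OF bounded_bilinear_cmat_mult])
  have g: "geodesic m t = E ** quat k 0"
    by (simp only: geodesic_def E_def k_def c_def s_def)
  show ?thesis
    unfolding g using comm 1 by (metis matrix_mul_assoc)
qed

text \<open>Write the geodesic as E K. Then E' = m E and K' = - K (w X0), and by the intertwining
  relation m E K - E K (w X0) is E K times the body covector without its \<open>X0\<close>
  part.\<close>

lemma has_vector_derivative_geodesic:
  assumes "m \<noteq> 0"
  shows "(geodesic m has_vector_derivative geodesic m t ** su2 (horizontal (body_covector m t))) (at t)"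
proof -
  define E where "E t = quat (Complex (cos (norm m / 2 * t)) (sin (norm m / 2 * t) / norm m * m $ 3))
      ((sin (norm m / 2 * t) / norm m) *\<^sub>R Complex (m $ 1) (m $ 2))" for t
  define K where "K t = quat (cis (- (m $ 3 / 2 * t))) 0" for t
  define v where "v = (vector [0, 0, m $ 3] :: real^3)"
  have g: "geodesic m = (\<lambda>t. E t ** K t)"
    by (simp add: fun_eq_iff geodesic_def E_def K_def)
  have "(E has_vector_derivative quat
      (Complex (- sin (norm m / 2 * t) * (norm m / 2)) (cos (norm m / 2 * t) * (norm m / 2) / norm m * m $ 3))
      ((cos (norm m / 2 * t) * (norm m / 2) / norm m) *\<^sub>R Complex (m $ 1) (m $ 2))) (at t)"
    unfolding E_def
    by (intro has_vector_derivative_quat has_vector_derivative_Complex)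
      (auto intro!: derivative_eq_intros has_vector_derivative_scaleR[THEN has_vector_derivative_eq_rhs] simp: has_real_derivative_iff_has_vector_derivative[symmetric])
  moreover have "quat
      (Complex (- sin (norm m / 2 * t) * (norm m / 2)) (cos (norm m / 2 * t) * (norm m / 2) / norm m * m $ 3))
      ((cos (norm m / 2 * t) * (norm m / 2) / norm m) *\<^sub>R Complex (m $ 1) (m $ 2)) = su2 m ** E t"
  proof -
    define s c k where "s = sin (norm m / 2 * t)" and "c = cos (norm m / 2 * t)" and "k = s / norm m"
    have "k * ((m $ 1)\<^sup>2 + (m $ 2)\<^sup>2 + (m $ 3)\<^sup>2) = s * norm m"
      unfolding norm_real3_square[symmetric] k_def by (simp add: power2_eq_square)
    then have re: "- s * (norm m / 2) = - (m $ 3 / 2 * (k * m $ 3)) - (m $ 1 / 2 * (k * m $ 1) + m $ 2 / 2 * (k * m $ 2))"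
      by (simp add: power2_eq_square algebra_simps)
    have c: "c * (norm m / 2) / norm m = c / 2"
      using assms by simp
    show ?thesis
      unfolding E_def s_def[symmetric] c_def[symmetric] k_def[symmetric] su2_def quat_mult quat_eq_iff re c
      by (simp add: complex_eq_iff algebra_simps)
  qed
  ultimately have dE: "(E has_vector_derivative su2 m ** E t) (at t)" by simp
  have "((\<lambda>t. cis (- (m $ 3 / 2 * t))) has_vector_derivative (- \<i> * (m $ 3 / 2)) * cis (- (m $ 3 / 2 * t))) (at t)"
    unfolding has_vector_derivative_complex_iff
    by (auto intro!: derivative_eq_intros)
  from has_vector_derivative_quat[OF this has_vector_derivative_const[of 0]]
  have "(K has_vector_derivative quat ((- \<i> * (m $ 3 / 2)) * cis (- (m $ 3 / 2 * t))) 0) (at t)"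
    unfolding K_def .
  moreover have "quat ((- \<i> * (m $ 3 / 2)) * cis (- (m $ 3 / 2 * t))) 0 = - (K t ** su2 v)"
    by (simp add: K_def su2_def v_def quat_mult quat_minus quat_eq_iff complex_eq_iff)
  ultimately have dK: "(K has_vector_derivative - (K t ** su2 v)) (at t)" by simp
  have "(geodesic m has_vector_derivative E t ** (- (K t ** su2 v)) + (su2 m ** E t) ** K t) (at t)"
    unfolding g by (rule has_vector_derivative_cmat_mult[OF dE dK])
  moreover have "E t ** (- (K t ** su2 v)) + (su2 m ** E t) ** K t = geodesic m t ** su2 (horizontal (body_covector m t))"
  proof -
    have "body_covector m t = horizontal (body_covector m t) + v"
      by (simp add: horizontal_def v_def body_covector_def Let_def vec_eq_iff forall_3)
    then have "su2 (body_covector m t) = su2 (horizontal (body_covector m t)) + su2 v"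
      by (metis su2_add)
    moreover have "(su2 m ** E t) ** K t = geodesic m t ** su2 (body_covector m t)"
      unfolding geodesic_intertwines[symmetric] by (simp add: g matrix_mul_assoc)
    ultimately show ?thesis
      by (simp add: g bounded_bilinear.minus_right[OF bounded_bilinear_cmat_mult]
          bounded_bilinear.add_right[OF bounded_bilinear_cmat_mult] matrix_mul_assoc)
  qed
  ultimately show ?thesis by simp
qed

lemma Hamiltonian_trajectory_geodesic:
  assumes q: "q \<in> SU2" and m: "m \<noteq> 0"
  shows "Hamiltonian_trajectory (\<lambda>t. (q ** geodesic m t, q ** su2 m ** geodesic m t))"
  unfolding Hamiltonian_trajectory_def
proof
  fix t
  let ?n = "body_covector m t"
  have p: "q ** geodesic m t \<in> SU2"
    by (rule SU2_mult[OF q geodesic_SU2[OF m]])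
  have \<mu>: "q ** su2 m ** geodesic m t = q ** geodesic m t ** su2 ?n"
    by (simp add: matrix_mul_assoc[symmetric] geodesic_intertwines)
  have "((\<lambda>t. (q ** geodesic m t, q ** su2 m ** geodesic m t)) has_vector_derivative
      (q ** (geodesic m t ** su2 (horizontal ?n)), q ** su2 m ** (geodesic m t ** su2 (horizontal ?n)))) (at t)"
    by (intro has_vector_derivative_Pair bounded_linear.has_vector_derivative[OF bounded_linear_cmat_mult_right]
        has_vector_derivative_geodesic[OF m])
  moreover have "(q ** (geodesic m t ** su2 (horizontal ?n)), q ** su2 m ** (geodesic m t ** su2 (horizontal ?n)))
      = Hamiltonian_field (q ** geodesic m t, q ** su2 m ** geodesic m t)"
    unfolding \<mu> Hamiltonian_field_su2[OF p] by (simp add: \<mu>[symmetric] matrix_mul_assoc)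
  moreover have "(q ** geodesic m t, q ** su2 m ** geodesic m t) \<in> cotangent_bundle"
    unfolding \<mu> using p by (simp add: cotangent_bundle_def cotangent_space_eq)
  ultimately show "(q ** geodesic m t, q ** su2 m ** geodesic m t) \<in> cotangent_bundle \<and>
      ((\<lambda>t. (q ** geodesic m t, q ** su2 m ** geodesic m t)) has_vector_derivative
        Hamiltonian_field (q ** geodesic m t, q ** su2 m ** geodesic m t)) (at t)"
    by simp
qed

lemma constant_if_derivative_0:
  fixes f :: "real \<Rightarrow> 'a::real_normed_vector"
  assumes "\<And>t. (f has_vector_derivative 0) (at t)"
  shows "f t = f 0"
  using has_vector_derivative_zero_constant[of UNIV f] assms by (metis UNIV_I convex_UNIV)

text \<open>The body covector of any trajectory rotates with constant speed \<open>w\<close>, so the trajectory solves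
  a linear equation which the geodesic solves as well, and the quotient of the two is constant.\<close>

lemma Hamiltonian_trajectory_unique:
  assumes \<gamma>: "Hamiltonian_trajectory \<gamma>" "\<gamma> 0 = (q, q ** su2 m)" and m: "m \<noteq> 0"
  shows "\<gamma> = (\<lambda>t. (q ** geodesic m t, q ** su2 m ** geodesic m t))"
proof -
  define p \<mu> where "p t = fst (\<gamma> t)" and "\<mu> t = snd (\<gamma> t)" for t
  have p: "p t \<in> SU2" and "\<mu> t \<in> cotangent_space (p t)" for t
    using \<gamma>(1) unfolding Hamiltonian_trajectory_def cotangent_bundle_def p_def \<mu>_def
    by (simp_all add: case_prod_unfold)
  then have "\<exists>n. \<mu> t = p t ** su2 n" for t
    using cotangent_spaceE by metis
  then obtain n where \<mu>: "\<And>t. \<mu> t = p t ** su2 (n t)" by metis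
  define h where "h t = su2 (horizontal (n t))" for t
  have "(\<gamma> has_vector_derivative (p t ** h t, \<mu> t ** h t)) (at t)" for t
  proof -
    have "\<gamma> t = (p t, p t ** su2 (n t))"
      using \<mu>[of t] by (simp add: p_def \<mu>_def prod_eq_iff)
    then have "Hamiltonian_field (\<gamma> t) = (p t ** h t, \<mu> t ** h t)"
      using Hamiltonian_field_su2[OF p, of t "n t"] by (simp add: h_def \<mu>)
    then show ?thesis
      using \<gamma>(1) unfolding Hamiltonian_trajectory_def by metis
  qed
  from bounded_linear.has_vector_derivative[OF bounded_linear_fst this]
    bounded_linear.has_vector_derivative[OF bounded_linear_snd this]
  have dp: "(p has_vector_derivative p t ** h t) (at t)"
    and d\<mu>: "(\<mu> has_vector_derivative \<mu> t ** h t) (at t)" for t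
    unfolding p_def \<mu>_def by simp_all
  have n: "n t = body_covector m t" for t
  proof -
    define N where "N t = adjoint_mat (p t) ** \<mu> t" for t
    have N: "N t = su2 (n t)" for t
      unfolding N_def \<mu> by (rule SU2_cancel_left(1)[OF p])
    have "N 0 = su2 m"
      unfolding N_def p_def \<mu>_def \<gamma>(2) using p[of 0] by (simp add: p_def \<gamma>(2))
    then have n0: "n 0 = m" using N[of 0] by (simp add: su2_eq_iff)
    \<comment> \<open>A Lax equation: N' is the commutator of N with its horizontal part. The
      diagonal entry of this commutator is zero, so w is conserved; the off-diagonal entry then says
      that u + i v rotates with speed w.\<close>
    have dN: "(N has_vector_derivative su2 (n t) ** h t - h t ** su2 (n t)) (at t)" for t
    proof -
      have "(N has_vector_derivative adjoint_mat (p t) ** (\<mu> t ** h t) + adjoint_mat (p t ** h t) ** \<mu> t) (at t)"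
        unfolding N_def by (rule has_vector_derivative_cmat_mult[OF has_vector_derivative_adjoint_mat[OF dp] d\<mu>])
      moreover have "adjoint_mat (p t) ** (\<mu> t ** h t) = su2 (n t) ** h t"
        unfolding \<mu> by (simp add: matrix_mul_assoc[symmetric] p)
      moreover have "adjoint_mat (p t ** h t) ** \<mu> t = - (h t ** su2 (n t))"
        unfolding \<mu> adjoint_mat_mult h_def adjoint_mat_su2
        by (simp add: matrix_mul_assoc[symmetric] p bounded_bilinear.minus_left[OF bounded_bilinear_cmat_mult])
      ultimately show ?thesis by simp
    qed
    have N': "su2 (n t) ** h t - h t ** su2 (n t) = quat 0 (\<i> * of_real (n t $ 3) * Complex (n t $ 1 / 2) (n t $ 2 / 2))" for t
      unfolding h_def
      by (simp add: su2_def horizontal_def quat_mult quat_diff quat_eq_iff complex_eq_iff algebra_simps)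
    note dN1 = bounded_linear.has_vector_derivative[OF bounded_linear_cmat_nth dN, unfolded N']
    have "(N t $ 1 $ 1) = N 0 $ 1 $ 1" for t
      by (rule constant_if_derivative_0) (use dN1[of 1 1] in simp)
    then have n3: "n t $ 3 = m $ 3" for t
      unfolding N n0 by (simp add: su2_def complex_eq_iff)
    have dN2: "((\<lambda>t. N t $ 1 $ 2) has_vector_derivative \<i> * of_real (m $ 3) * N t $ 1 $ 2) (at t)" for t
      using dN1[of 1 2 t] by (simp add: n3 N su2_def)
    have "N t $ 1 $ 2 * cis (- (m $ 3 * t)) = N 0 $ 1 $ 2 * cis (- (m $ 3 * 0))" for t
    proof (rule constant_if_derivative_0)
      fix t
      have "((\<lambda>t. cis (- (m $ 3 * t))) has_vector_derivative (- \<i> * m $ 3) * cis (- (m $ 3 * t))) (at t)"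
        unfolding has_vector_derivative_complex_iff by (auto intro!: derivative_eq_intros)
      from has_vector_derivative_mult[OF dN2 this]
      show "((\<lambda>t. N t $ 1 $ 2 * cis (- (m $ 3 * t))) has_vector_derivative 0) (at t)"
        by (simp add: algebra_simps)
    qed
    then have "N t $ 1 $ 2 * (cis (- (m $ 3 * t)) * cis (m $ 3 * t)) = N 0 $ 1 $ 2 * cis (m $ 3 * t)"
      by (simp add: mult.assoc[symmetric])
    then have "N t $ 1 $ 2 = N 0 $ 1 $ 2 * cis (m $ 3 * t)"
      by (simp add: cis_mult)
    then have "Complex (m $ 1) (m $ 2) * cis (m $ 3 * t) = Complex (n t $ 1) (n t $ 2)"
      unfolding N n0 by (simp add: su2_def complex_eq_iff field_simps)
    then show ?thesis
      unfolding body_covector_def Let_def by (simp only: complex.sel) (simp add: vec_eq_iff forall_3 n3)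
  qed
  have dg: "(geodesic m has_vector_derivative geodesic m t ** h t) (at t)" for t
    unfolding h_def n by (rule has_vector_derivative_geodesic[OF m])
  \<comment> \<open>Applied to the base point and to the covector. Since \<open>h t\<close> is
    skew-Hermitian, the two terms of the product rule cancel.\<close>
  have const: "f t = f 0 ** geodesic m t"
    if df: "\<And>t. (f has_vector_derivative f t ** h t) (at t)" for f :: "real \<Rightarrow> cmat" and t
  proof -
    have "f t ** adjoint_mat (geodesic m t) = f 0 ** adjoint_mat (geodesic m 0)"
    proof (rule constant_if_derivative_0[of "\<lambda>t. f t ** adjoint_mat (geodesic m t)"])
      fix t
      have "((\<lambda>t. f t ** adjoint_mat (geodesic m t)) has_vector_derivative
          f t ** adjoint_mat (geodesic m t ** h t) + (f t ** h t) ** adjoint_mat (geodesic m t)) (at t)"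
        by (rule has_vector_derivative_cmat_mult[OF df has_vector_derivative_adjoint_mat[OF dg]])
      then show "((\<lambda>t. f t ** adjoint_mat (geodesic m t)) has_vector_derivative 0) (at t)"
        unfolding adjoint_mat_mult h_def adjoint_mat_su2
        by (simp add: matrix_mul_assoc bounded_bilinear.minus_left[OF bounded_bilinear_cmat_mult]
            bounded_bilinear.minus_right[OF bounded_bilinear_cmat_mult])
    qed
    then have "f t ** (adjoint_mat (geodesic m t) ** geodesic m t) = f 0 ** geodesic m t"
      by (simp add: geodesic_0 adjoint_mat_1 matrix_mul_assoc)
    then show ?thesis
      by (simp add: SU2_adjoint(1)[OF geodesic_SU2[OF m]])
  qed
  show ?thesis
  proof
    fix t
    show "\<gamma> t = (q ** geodesic m t, q ** su2 m ** geodesic m t)"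
      using const[of p t, OF dp] const[of \<mu> t, OF d\<mu>] \<gamma>(2)
      by (simp add: p_def \<mu>_def prod_eq_iff)
  qed
qed

section \<open>The exponential map in quaternionic coordinates\<close>

definition exp_coord_1 :: "real^3 \<Rightarrow> complex" where
  "exp_coord_1 m = Complex (cos (norm m / 2)) (sin (norm m / 2) / norm m * m $ 3) * cis (- (m $ 3 / 2))"

definition exp_coord_2 :: "real^3 \<Rightarrow> complex" where
  "exp_coord_2 m = of_real (sin (norm m / 2) / norm m) * (Complex (m $ 1) (m $ 2) * cis (m $ 3 / 2))"

lemma exp_map_su2:
  assumes q: "q \<in> SU2" and m: "m \<noteq> 0"
  shows "exp_map q (q ** su2 m) = q ** quat (exp_coord_1 m) (exp_coord_2 m)"
proof -
  have "(THE \<gamma>. Hamiltonian_trajectory \<gamma> \<and> \<gamma> 0 = (q, q ** su2 m)) =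
      (\<lambda>t. (q ** geodesic m t, q ** su2 m ** geodesic m t))"
  proof (rule the_equality)
    show "Hamiltonian_trajectory (\<lambda>t. (q ** geodesic m t, q ** su2 m ** geodesic m t)) \<and>
        (q ** geodesic m 0, q ** su2 m ** geodesic m 0) = (q, q ** su2 m)"
      using Hamiltonian_trajectory_geodesic[OF q m] by (simp add: geodesic_0)
  qed (use Hamiltonian_trajectory_unique m in blast)
  then have "exp_map q (q ** su2 m) = q ** geodesic m 1"
    by (simp add: exp_map_def Hamiltonian_flow_def)
  also have "geodesic m 1 = quat (exp_coord_1 m) (exp_coord_2 m)"
    by (simp add: geodesic_def exp_coord_1_def exp_coord_2_def quat_mult quat_eq_iff cis_cnj scaleR_conv_of_real mult.assoc)
  finally show ?thesis .
qed

lemma exp_coords_norm: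
  assumes "m \<noteq> 0"
  shows "(cmod (exp_coord_1 m))\<^sup>2 + (cmod (exp_coord_2 m))\<^sup>2 = 1"
proof -
  have "geodesic m 1 = quat (exp_coord_1 m) (exp_coord_2 m)"
    by (simp add: geodesic_def exp_coord_1_def exp_coord_2_def quat_mult quat_eq_iff cis_cnj scaleR_conv_of_real mult.assoc)
  then show ?thesis
    using geodesic_SU2[OF assms, of 1] by (simp add: quat_in_SU2_iff)
qed

section \<open>Charts\<close>

lemma smooth_open_cong:
  assumes "open S" "\<And>x. x \<in> S \<Longrightarrow> f x = g x" "smooth_open f S"
  shows "smooth_open g S"
  unfolding smooth_open_def by (intro allI Ck_on_cong[OF assms(1,2) smooth_openD[OF assms(3)]])

text \<open>Reduces charts of an embedded M to the inverse function theorem: P parametrises M near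
  the point, and \<Psi> \<circ> P is a map between Euclidean spaces of equal dimension. The ambient
  map Q, inverse to P near the point, shows that images of open sets are relatively open in M; W
  allows the domain to be shrunk.\<close>

lemma centered_chart_of_parametrization:
  fixes P :: "real^'n \<Rightarrow> 'a::euclidean_space" and \<Psi> :: "'a \<Rightarrow> real^'n"
  assumes B: "open B" "x0 \<in> B" "\<And>x. x \<in> B \<Longrightarrow> smooth_at P x" "P ` B \<subseteq> M"
    and Q: "continuous_on UNIV Q" "\<And>x. x \<in> B \<Longrightarrow> Q (P x) = x"
    and N: "open N" "P x0 \<in> N" "\<And>y. y \<in> M \<Longrightarrow> y \<in> N \<Longrightarrow> P (Q y) = y"
    and \<Psi>: "smooth_at \<Psi> (P x0)" "\<Psi> (P x0) = 0"
    and D: "((\<lambda>x. \<Psi> (P x)) has_derivative D) (at x0)" "\<And>h. D h = 0 \<Longrightarrow> h = 0"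
    and W: "open W" "P x0 \<in> W"
  obtains U where "U \<subseteq> W" "centered_chart M (P x0) U \<Psi>"
proof -
  obtain W' where W': "open W'" "P x0 \<in> W'" "smooth_open \<Psi> W'"
    using \<Psi>(1) unfolding smooth_at_def by blast
  have sP: "smooth_open P B"
    using B(3) smooth_open_iff_smooth_at[OF B(1)] by blast
  define S where "S = B \<inter> P -` (W \<inter> N \<inter> W')"
  have "open S"
    unfolding S_def
    by (intro continuous_open_preimage Ck_on_imp_continuous_on[OF smooth_openD[OF sP]] open_Int B(1) W(1) N(1) W'(1))
  have "x0 \<in> S"
    using B(2) W(2) N(2) W'(2) by (simp add: S_def)
  obtain T g where T: "open T" "x0 \<in> T" "T \<subseteq> S" "open ((\<lambda>x. \<Psi> (P x)) ` T)"
    and "smooth_open (\<lambda>x. \<Psi> (P x)) T"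
    and g: "\<And>x. x \<in> T \<Longrightarrow> g (\<Psi> (P x)) = x" "smooth_open g ((\<lambda>x. \<Psi> (P x)) ` T)"
    by (rule smooth_inverse_function[OF smooth_at_compose[OF \<Psi>(1) B(3)[OF B(2)]] D \<open>open S\<close> \<open>x0 \<in> S\<close>]) (assumption | rule that | blast)+
  have TS: "x \<in> B" "P x \<in> W" "P x \<in> N" "P x \<in> W'" "P x \<in> M" if "x \<in> T" for x
    using that T(3) B(4) unfolding S_def by auto
  define U where "U = P ` T"
  have \<Psi>U: "\<Psi> ` U = (\<lambda>x. \<Psi> (P x)) ` T"
    unfolding U_def by (rule image_image)
  have inj: "inj_on \<Psi> U"
    unfolding U_def inj_on_def using g(1) by (metis imageE)
  have "U = M \<inter> (N \<inter> Q -` T)"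
  proof (intro equalityI subsetI)
    fix y assume "y \<in> U"
    then obtain x where "x \<in> T" "y = P x" unfolding U_def by blast
    then show "y \<in> M \<inter> (N \<inter> Q -` T)" using TS[of x] Q(2)[of x] by simp
  next
    fix y assume "y \<in> M \<inter> (N \<inter> Q -` T)"
    then have "y = P (Q y)" "Q y \<in> T" using N(3)[of y] by auto
    then show "y \<in> U" unfolding U_def by (rule image_eqI)
  qed
  moreover have "open (N \<inter> Q -` T)"
    by (intro open_Int N(1) open_vimage[OF T(1) Q(1)])
  ultimately have "openin (top_of_set M) U"
    unfolding openin_open by blast
  moreover have "smooth_subset \<Psi> U"
    unfolding smooth_subset_def
  proof
    fix y assume "y \<in> U"
    then have "y \<in> W'" using TS unfolding U_def by blast
    with W' show "\<exists>W F. open W \<and> y \<in> W \<and> smooth_open F W \<and> (\<forall>z\<in>U \<inter> W. F z = \<Psi> z)"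
      by blast
  qed
  moreover have "smooth_open (inv_into U \<Psi>) (\<Psi> ` U)"
    unfolding \<Psi>U
  proof (rule smooth_open_cong[OF T(4)])
    show "smooth_open (\<lambda>z. P (g z)) ((\<lambda>x. \<Psi> (P x)) ` T)"
      by (rule smooth_open_compose[OF T(4) B(1) sP g(2)]) (use g(1) TS(1) in auto)
    fix z assume "z \<in> (\<lambda>x. \<Psi> (P x)) ` T"
    then obtain x where "x \<in> T" "z = \<Psi> (P x)" by blast
    then show "P (g z) = inv_into U \<Psi> z"
      using inv_into_f_f[OF inj, of "P x"] g(1)[of x] unfolding U_def by simp
  qed
  moreover have "open (\<Psi> ` U)" unfolding \<Psi>U by (rule T(4))
  moreover have "P x0 \<in> U" unfolding U_def using T(2) by blast
  ultimately have "centered_chart M (P x0) U \<Psi>"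
    unfolding centered_chart_def using inj \<Psi>(2) by blast
  moreover have "U \<subseteq> W" unfolding U_def using TS(2) by blast
  ultimately show ?thesis using that by blast
qed

lemma cotangent_chart:
  fixes \<Phi> :: "real^3 \<Rightarrow> real^3"
  assumes q: "q \<in> SU2"
    and \<Phi>: "smooth_at \<Phi> x0" "\<Phi> x0 = 0" "(\<Phi> has_derivative D) (at x0)" "\<And>h. D h = 0 \<Longrightarrow> h = 0"
    and W: "open W" "q ** su2 x0 \<in> W"
  obtains U where "U \<subseteq> W"
    "centered_chart (cotangent_space q) (q ** su2 x0) U (\<lambda>\<mu>. \<Phi> (su2_inv (adjoint_mat q ** \<mu>)))"
proof -
  let ?P = "\<lambda>x. q ** su2 x" and ?Q = "\<lambda>\<mu>. su2_inv (adjoint_mat q ** \<mu>)"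
  have P: "bounded_linear ?P"
    by (rule bounded_linear_compose[OF bounded_linear_cmat_mult_right bounded_linear_su2])
  have Q: "bounded_linear ?Q"
    by (rule bounded_linear_compose[OF bounded_linear_su2_inv bounded_linear_cmat_mult_right])
  have QP: "?Q (?P x) = x" for x
    using q by simp
  show ?thesis
  proof (rule centered_chart_of_parametrization[of UNIV x0 ?P "cotangent_space q" ?Q UNIV "\<lambda>\<mu>. \<Phi> (?Q \<mu>)" D W])
    show "smooth_at ?P x" for x by (rule smooth_at_linear[OF P])
    show "range ?P \<subseteq> cotangent_space q" by (simp add: cotangent_space_eq)
    show "continuous_on UNIV ?Q" by (rule linear_continuous_on[OF Q])
    show "?P (?Q y) = y" if "y \<in> cotangent_space q" for y
      using su2_of_cotangent[OF q that] by simp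
    show "smooth_at (\<lambda>\<mu>. \<Phi> (?Q \<mu>)) (?P x0)"
      by (rule smooth_at_compose[OF _ smooth_at_linear[OF Q]]) (simp add: q \<Phi>(1))
  qed (use \<Phi> W QP that in simp_all)
qed

lemma bounded_linear_cmat_mult_nth: "bounded_linear (\<lambda>p::cmat. (A ** p) $ i $ j)" for A :: cmat
  by (rule bounded_linear_compose[OF bounded_linear_cmat_nth bounded_linear_cmat_mult_right])

lemma has_derivative_vec_nth: "((\<lambda>x. x $ i) has_derivative (\<lambda>h. h $ i)) (at x)"
  by (rule bounded_linear_imp_has_derivative[OF bounded_linear_vec_nth])

text \<open>A hemisphere of the 3-sphere around \<open>quat a b\<close>, seen as a graph over the
  unit ball, gives the parametrisation. The equation a \<bullet> s + b \<bullet> t = 0 describes the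
  tangent space of the 3-sphere at (a, b), and injectivity of the derivative is asked on that
  space.\<close>

lemma SU2_chart:
  fixes \<psi> :: "complex \<times> complex \<Rightarrow> real^3"
  assumes q: "q \<in> SU2" and ab: "(cmod a)\<^sup>2 + (cmod b)\<^sup>2 = 1"
    and \<psi>: "smooth_at \<psi> (a, b)" "\<psi> (a, b) = 0" "(\<psi> has_derivative D) (at (a, b))"
      "\<And>s t. a \<bullet> s + b \<bullet> t = 0 \<Longrightarrow> D (s, t) = 0 \<Longrightarrow> s = 0 \<and> t = 0"
  obtains U where "centered_chart SU2 (q ** quat a b) U
      (\<lambda>p. \<psi> ((adjoint_mat q ** p) $ 1 $ 1, (adjoint_mat q ** p) $ 1 $ 2))"
proof -
  \<comment> \<open>The positive real part that completes an imaginary part x to a unit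
    quaternion.\<close>
  define r where "r x = sqrt (1 - (x $ 1 * x $ 1 + x $ 2 * x $ 2 + x $ 3 * x $ 3))" for x :: "real^3"
  define R where "R x = quat (Complex (r x) (x $ 3)) (Complex (x $ 1) (x $ 2))" for x :: "real^3"
  define P where "P x = q ** quat a b ** R x" for x
  \<comment> \<open>\<open>su2_inv\<close> doubles the coordinates of a quaternion, hence the factor
    1/2.\<close>
  define Q where "Q p = (1/2) *\<^sub>R su2_inv (adjoint_mat (q ** quat a b) ** p)" for p :: cmat
  define N where "N = (\<lambda>p::cmat. Re ((adjoint_mat (q ** quat a b) ** p) $ 1 $ 1)) -` {0<..}"
  define E where "E p = ((adjoint_mat q ** p) $ 1 $ 1, (adjoint_mat q ** p) $ 1 $ 2)" for p :: cmat
  have ab': "quat a b \<in> SU2" using ab by (simp add: quat_in_SU2_iff)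
  have qab: "q ** quat a b \<in> SU2" by (rule SU2_mult[OF q ab'])
  have nx: "x $ 1 * x $ 1 + x $ 2 * x $ 2 + x $ 3 * x $ 3 = (norm x)\<^sup>2" for x :: "real^3"
    unfolding norm_real3_square by (simp add: power2_eq_square)
  have pos: "1 - (x $ 1 * x $ 1 + x $ 2 * x $ 2 + x $ 3 * x $ 3) > 0" if "x \<in> ball 0 1" for x :: "real^3"
    using that by (simp add: nx power_less_one_iff)
  have C: "Complex 1 0 = 1" "Complex 0 0 = 0"
    by (simp_all add: complex_eq_iff)
  have P0: "P 0 = q ** quat a b"
    by (simp add: P_def R_def r_def C mat_1_quat[symmetric])
  have linE: "bounded_linear E"
    unfolding E_def
    by (intro bounded_linear_Pair bounded_linear_cmat_mult_nth)
  have EP: "E (P x) = (a * Complex (r x) (x $ 3) - b * cnj (Complex (x $ 1) (x $ 2)),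
      a * Complex (x $ 1) (x $ 2) + b * cnj (Complex (r x) (x $ 3)))" for x
    unfolding E_def P_def R_def by (simp add: matrix_mul_assoc[symmetric] q quat_mult)
  have E0: "E (P 0) = (a, b)"
    unfolding EP by (simp add: r_def C)
  define D' where "D' h = (a * (\<i> * of_real (h $ 3)) - b * cnj (Complex (h $ 1) (h $ 2)),
      a * Complex (h $ 1) (h $ 2) - b * (\<i> * of_real (h $ 3)))" for h :: "real^3"
  have "(r has_derivative (\<lambda>h. 0)) (at 0)"
    unfolding r_def by (auto intro!: derivative_eq_intros has_derivative_vec_nth)
  then have dEP: "((\<lambda>x. E (P x)) has_derivative D') (at 0)"
    unfolding EP D'_def Complex_eq complex_cnj_add complex_cnj_mult complex_cnj_complex_of_real complex_cnj_i
    by (auto intro!: derivative_eq_intros has_derivative_vec_nth simp: algebra_simps)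
  show ?thesis
  proof (rule centered_chart_of_parametrization[of "ball 0 1" 0 P SU2 Q N "\<lambda>p. \<psi> (E p)" "\<lambda>h. D (D' h)" UNIV])
    show "smooth_at P x" if "x \<in> ball 0 1" for x
    proof -
      have "smooth_at (\<lambda>x. (Complex (r x) (x $ 3), Complex (x $ 1) (x $ 2))) x"
        unfolding r_def using pos[OF that] by (intro smooth_intros)
      from smooth_at_linear_compose[OF bounded_linear_quat this]
      show ?thesis
        unfolding P_def R_def by (simp add: smooth_at_linear_compose[OF bounded_linear_cmat_mult_right])
    qed
    show "P ` ball 0 1 \<subseteq> SU2"
    proof
      fix p assume "p \<in> P ` ball 0 1"
      then obtain x where x: "p = P x" "x \<in> ball 0 1" by blast
      have "R x \<in> SU2"
        unfolding R_def quat_in_SU2_iff cmod_power2 r_def using pos[OF x(2)] by (simp add: power2_eq_square)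
      then show "p \<in> SU2" unfolding x P_def by (rule SU2_mult[OF qab])
    qed
    show "continuous_on UNIV Q"
      unfolding Q_def
      by (intro linear_continuous_on bounded_linear_compose[OF bounded_linear_scaleR_right]
          bounded_linear_compose[OF bounded_linear_su2_inv bounded_linear_cmat_mult_right])
    show "Q (P x) = x" if "x \<in> ball 0 1" for x
      unfolding Q_def P_def SU2_cancel_left(1)[OF qab] R_def
      by (simp add: su2_inv_def vec_eq_iff forall_3)
    show "open N"
      unfolding N_def
      by (intro open_vimage open_greaterThan linear_continuous_on bounded_linear_compose[OF bounded_linear_Re]
          bounded_linear_cmat_mult_nth)
    show "P 0 \<in> N"
      unfolding N_def P0 by (simp add: SU2_adjoint(1)[OF qab] mat_1_quat)
    show "P (Q y) = y" if y: "y \<in> SU2" "y \<in> N" for y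
    proof -
      define A where "A = adjoint_mat (q ** quat a b) ** y"
      have "A \<in> SU2" unfolding A_def by (intro SU2_mult SU2_adjoint_mem qab y)
      then obtain \<alpha> \<beta> where A: "A = quat \<alpha> \<beta>" "(cmod \<alpha>)\<^sup>2 + (cmod \<beta>)\<^sup>2 = 1"
        by (rule SU2_quatE)
      have "Re (A $ 1 $ 1) > 0" using y(2) by (simp add: N_def A_def)
      then have "Re \<alpha> > 0" unfolding A(1) by simp
      moreover have "1 - (Re \<beta> * Re \<beta> + Im \<beta> * Im \<beta> + Im \<alpha> * Im \<alpha>) = (Re \<alpha>)\<^sup>2"
        using A(2) unfolding cmod_power2 by (simp add: power2_eq_square)
      ultimately have "R (Q y) = A"
        unfolding R_def r_def Q_def A_def[symmetric] A(1)
        by (simp add: su2_inv_def quat_eq_iff complex_eq_iff)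
      then show ?thesis
        unfolding P_def A_def by (simp add: SU2_cancel_left(2)[OF qab])
    qed
    show "smooth_at (\<lambda>p. \<psi> (E p)) (P 0)"
      by (rule smooth_at_compose[OF _ smooth_at_linear[OF linE]]) (simp add: E0 \<psi>(1))
    show "\<psi> (E (P 0)) = 0"
      unfolding E0 by (rule \<psi>(2))
    show "((\<lambda>x. \<psi> (E (P x))) has_derivative (\<lambda>h. D (D' h))) (at 0)"
      by (rule has_derivative_compose[OF dEP]) (simp add: E0 \<psi>(3))
    show "h = 0" if "D (D' h) = 0" for h
    proof -
      \<comment> \<open>\<open>D' h\<close> is the product of the unit quaternion (a, b) and an
        imaginary quaternion, so it is tangent to the sphere at (a, b).\<close>
      have "a \<bullet> fst (D' h) + b \<bullet> snd (D' h) = 0"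
        by (simp add: D'_def inner_complex_def algebra_simps)
      then have "D' h = 0"
        using \<psi>(4)[of "fst (D' h)" "snd (D' h)"] that by (simp add: prod_eq_iff)
      then have "quat a b ** quat (\<i> * of_real (h $ 3)) (Complex (h $ 1) (h $ 2)) = quat a b ** quat 0 0"
        by (simp add: quat_mult D'_def prod_eq_iff quat_eq_iff)
      then have "quat (\<i> * of_real (h $ 3)) (Complex (h $ 1) (h $ 2)) = quat 0 0"
        unfolding SU2_left_eq_iff[OF ab'] .
      then have "h $ 3 = 0" "Complex (h $ 1) (h $ 2) = 0"
        unfolding quat_eq_iff by simp_all
      then show "h = 0"
        by (simp add: complex_eq_iff[of "Complex (h $ 1) (h $ 2)"] vec_eq_iff forall_3)
    qed
  next
    fix U assume "centered_chart SU2 (P 0) U (\<lambda>p. \<psi> (E p))"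
    then show ?thesis
      unfolding P0 E_def by (rule that)
  qed simp_all
qed

lemma smooth_at_cis [smooth_intros]:
  assumes "smooth_at f x"
  shows "smooth_at (\<lambda>x. cis (f x)) x"
proof -
  have "smooth_at (\<lambda>x. Complex (cos (f x)) (sin (f x))) x"
    by (intro smooth_intros assms)
  moreover have "(\<lambda>x. Complex (cos (f x)) (sin (f x))) = (\<lambda>x. cis (f x))"
    by (simp add: complex_eq_iff fun_eq_iff)
  ultimately show ?thesis by simp
qed

lemma smooth_at_norm_real3:
  assumes "m \<noteq> (0 :: real^3)"
  shows "smooth_at norm m"
proof -
  have norm: "norm = (\<lambda>m::real^3. sqrt ((m $ 1)\<^sup>2 + (m $ 2)\<^sup>2 + (m $ 3)\<^sup>2))"
    unfolding norm_real3_square[symmetric] by simp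
  have "0 < (m $ 1)\<^sup>2 + (m $ 2)\<^sup>2 + (m $ 3)\<^sup>2"
    unfolding norm_real3_square[symmetric] using assms by simp
  then show ?thesis
    unfolding norm by (intro smooth_intros)
qed

lemma smooth_at_exp_coords:
  assumes "m \<noteq> 0"
  shows "smooth_at exp_coord_1 m" "smooth_at exp_coord_2 m"
proof -
  have "norm m \<noteq> 0" using assms by simp
  then show "smooth_at exp_coord_1 m" "smooth_at exp_coord_2 m"
    unfolding exp_coord_1_def exp_coord_2_def
    by (intro smooth_intros smooth_at_norm_real3 assms; simp)+
qed

text \<open>This disposes of manifolds: what is left is to find germs \<Phi> at m and \<psi> at the
  image point with the right derivatives and with \<psi> \<circ> exp = f \<circ> \<Phi> near m. The
  target chart is fixed first, and the domain of the source chart is then shrunk into the preimage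
  of its domain.\<close>

lemma locally_equivalent_exp_map:
  fixes \<Phi> :: "real^3 \<Rightarrow> real^3" and \<psi> :: "complex \<times> complex \<Rightarrow> real^3"
  assumes q: "q \<in> SU2" and m: "m \<noteq> 0"
    and \<Phi>: "smooth_at \<Phi> m" "\<Phi> m = 0" "(\<Phi> has_derivative D) (at m)" "\<And>h. D h = 0 \<Longrightarrow> h = 0"
    and ab: "a = exp_coord_1 m" "b = exp_coord_2 m"
    and \<psi>: "smooth_at \<psi> (a, b)" "\<psi> (a, b) = 0" "(\<psi> has_derivative D') (at (a, b))"
      "\<And>s t. a \<bullet> s + b \<bullet> t = 0 \<Longrightarrow> D' (s, t) = 0 \<Longrightarrow> s = 0 \<and> t = 0"
    and f: "\<forall>\<^sub>F x in nhds m. \<psi> (exp_coord_1 x, exp_coord_2 x) = f (\<Phi> x)"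
  shows "locally_equivalent (cotangent_space q) SU2 (exp_map q) (q ** su2 m) f"
proof -
  let ?\<psi> = "\<lambda>p. \<psi> ((adjoint_mat q ** p) $ 1 $ 1, (adjoint_mat q ** p) $ 1 $ 2)"
  let ?Q = "\<lambda>\<mu>. su2_inv (adjoint_mat q ** \<mu>)"
  let ?e = "\<lambda>x. q ** quat (exp_coord_1 x) (exp_coord_2 x)"
  have "(cmod a)\<^sup>2 + (cmod b)\<^sup>2 = 1" unfolding ab by (rule exp_coords_norm[OF m])
  from SU2_chart[OF q this \<psi>]
  obtain V where V: "centered_chart SU2 (q ** quat a b) V ?\<psi>" .
  then obtain V' where V': "open V'" "V = SU2 \<inter> V'" and "q ** quat a b \<in> V'"
    unfolding centered_chart_def openin_open by blast
  have "smooth_at ?e m"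
    using smooth_at_linear_compose[OF bounded_linear_compose[OF bounded_linear_cmat_mult_right bounded_linear_quat]
      smooth_at_Pair[OF smooth_at_exp_coords[OF m]]] by simp
  then have "\<forall>\<^sub>F x in nhds m. ?e x \<in> V'"
    using topological_tendstoD[OF smooth_at_tendsto V'(1)] \<open>q ** quat a b \<in> V'\<close> ab by blast
  moreover have "\<forall>\<^sub>F x in nhds m. x \<noteq> 0"
    by (rule t1_space_nhds[OF m])
  ultimately have "\<forall>\<^sub>F x in nhds m. x \<noteq> 0 \<and> ?e x \<in> V' \<and> \<psi> (exp_coord_1 x, exp_coord_2 x) = f (\<Phi> x)"
    using f by eventually_elim blast
  then obtain S where S: "open S" "m \<in> S"
    "\<And>x. x \<in> S \<Longrightarrow> x \<noteq> 0 \<and> ?e x \<in> V' \<and> \<psi> (exp_coord_1 x, exp_coord_2 x) = f (\<Phi> x)"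
    unfolding eventually_nhds by blast
  have Qo: "open (?Q -` S)"
    by (rule open_vimage[OF S(1)])
      (intro linear_continuous_on bounded_linear_compose[OF bounded_linear_su2_inv bounded_linear_cmat_mult_right])
  have Qm: "q ** su2 m \<in> ?Q -` S" using S(2) q by simp
  obtain U where U: "U \<subseteq> ?Q -` S"
      "centered_chart (cotangent_space q) (q ** su2 m) U (\<lambda>\<mu>. \<Phi> (?Q \<mu>))"
    by (rule cotangent_chart[OF q \<Phi> Qo Qm]) (assumption | rule that | blast)+
  have U_cotangent: "U \<subseteq> cotangent_space q"
    using U(2) unfolding centered_chart_def by (metis openin_imp_subset)
  have e: "exp_map q \<mu> = ?e (?Q \<mu>)" and QS: "?Q \<mu> \<in> S" if "\<mu> \<in> U" for \<mu>
  proof -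
    show "?Q \<mu> \<in> S" using U(1) that by blast
    then have "exp_map q (q ** su2 (?Q \<mu>)) = ?e (?Q \<mu>)"
      by (intro exp_map_su2[OF q]) (use S(3) in blast)
    moreover have "\<mu> = q ** su2 (?Q \<mu>)"
      using su2_of_cotangent[OF q] U_cotangent that by blast
    ultimately show "exp_map q \<mu> = ?e (?Q \<mu>)" by metis
  qed
  have "exp_map q \<mu> \<in> V" if "\<mu> \<in> U" for \<mu>
    unfolding e[OF that] V'(2)
    using S(3)[OF QS[OF that]] SU2_mult[OF q] exp_coords_norm by (simp add: quat_in_SU2_iff)
  moreover have "?\<psi> (exp_map q \<mu>) = f (\<Phi> (?Q \<mu>))" if "\<mu> \<in> U" for \<mu>
    unfolding e[OF that] SU2_cancel_left(1)[OF q] using S(3)[OF QS[OF that]] by simp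
  moreover have "centered_chart SU2 (exp_map q (q ** su2 m)) V ?\<psi>"
    using V unfolding exp_map_su2[OF q m] ab .
  ultimately show ?thesis
    unfolding locally_equivalent_def using U(2) by blast
qed

section \<open>Derivatives of the coordinates of the exponential map\<close>

lemma has_derivative_vector3:
  assumes "(f has_derivative f') F" "(g has_derivative g') F" "(h has_derivative h') F"
  shows "((\<lambda>x. vector [f x, g x, h x] :: real^3) has_derivative (\<lambda>v. vector [f' v, g' v, h' v])) F"
proof -
  have eq: "(vector [a, b, c] :: real^3) = a *\<^sub>R axis 1 1 + b *\<^sub>R axis 2 1 + c *\<^sub>R axis 3 1" for a b c
    by (simp add: vec_eq_iff forall_3 axis_def)
  show ?thesis
    unfolding eq by (intro has_derivative_add has_derivative_scaleR_left assms)
qed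

lemma vector3_eq_0_iff: "(vector [a, b, c] :: real^3) = 0 \<longleftrightarrow> a = 0 \<and> b = 0 \<and> c = 0"
  by (simp add: vec_eq_iff forall_3)

lemma has_derivative_Complex:
  assumes "(f has_derivative f') F" "(g has_derivative g') F"
  shows "((\<lambda>x. Complex (f x) (g x)) has_derivative (\<lambda>v. Complex (f' v) (g' v))) F"
  unfolding Complex_eq by (intro has_derivative_add has_derivative_mult_right has_derivative_of_real assms)

lemma has_derivative_cis:
  assumes "(f has_derivative f') (at x)"
  shows "((\<lambda>x. cis (f x)) has_derivative (\<lambda>v. \<i> * of_real (f' v) * cis (f x))) (at x)"
proof -
  have cis: "cis = (\<lambda>y. Complex (cos y) (sin y))"
    by (simp add: fun_eq_iff complex_eq_iff)
  have "((\<lambda>x. Complex (cos (f x)) (sin (f x))) has_derivative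
      (\<lambda>v. Complex (- sin (f x) * f' v) (cos (f x) * f' v))) (at x)"
    using assms by (intro has_derivative_Complex) (auto intro!: derivative_eq_intros)
  moreover have "(\<lambda>v. Complex (- sin (f x) * f' v) (cos (f x) * f' v)) = (\<lambda>v. \<i> * of_real (f' v) * cis (f x))"
    by (simp add: fun_eq_iff complex_eq_iff)
  ultimately show ?thesis
    by (simp add: cis)
qed

text \<open>The tangent of the argument of L is the angular coordinate of all charts below. At a
  point where L is real, the quotient rule collapses to one term.\<close>

lemma has_derivative_Im_over_Re:
  assumes "(L has_derivative L') (at x)" "Im (L x) = 0" "Re (L x) \<noteq> 0"
  shows "((\<lambda>x. Im (L x) / Re (L x)) has_derivative (\<lambda>v. Im (L' v) / Re (L x))) (at x)"
proof -
  have "((\<lambda>x. Im (L x) / Re (L x)) has_derivative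
      (\<lambda>v. (Im (L' v) * Re (L x) - Im (L x) * Re (L' v)) / (Re (L x) * Re (L x)))) (at x)"
    by (intro has_derivative_divide' has_derivative_Im has_derivative_Re assms)
  then show ?thesis
    using assms(2,3) by simp
qed

text \<open>The real part of \<open>z * cnj w\<close> is \<open>w \<bullet> z\<close>.\<close>

lemma complex_eq_0_of_orthogonal:
  assumes "Im (z * cnj w) = 0" "w \<bullet> z = 0" "w \<noteq> 0"
  shows "z = 0"
proof -
  have "z * cnj w = 0"
    using assms(1,2) by (simp add: complex_eq_iff inner_complex_def algebra_simps)
  then show ?thesis using assms(3) by simp
qed

lemma has_derivative_norm_real3:
  assumes "m \<noteq> (0 :: real^3)"
  shows "(norm has_derivative (\<lambda>h. (m \<bullet> h) / norm m)) (at m)"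
  using has_derivative_norm[OF assms] by (simp add: sgn_div_norm inner_commute divide_inverse mult.commute)

text \<open>The real factor of \<zeta>, depending on |m| alone; the other factor
  \<open>planar\<close> has no zeros where H \<noteq> 0.\<close>

definition radial :: "real^3 \<Rightarrow> real" where
  "radial x = sin (norm x / 2) / norm x"

definition planar :: "real^3 \<Rightarrow> complex" where
  "planar x = Complex (x $ 1) (x $ 2) * cis (x $ 3 / 2)"

lemma exp_coord_1_radial: "exp_coord_1 x = Complex (cos (norm x / 2)) (radial x * x $ 3) * cis (- (x $ 3 / 2))"
  by (simp add: exp_coord_1_def radial_def)

lemma exp_coord_2_radial: "exp_coord_2 x = of_real (radial x) * planar x"
  by (simp add: exp_coord_2_def radial_def planar_def)

text \<open>The numerator is the left side of the equation of C^0, so \<open>radial\<close> is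
  stationary there. On C^1 it reduces to |m| cos (|m| / 2), which is nonzero.\<close>

lemma has_derivative_radial:
  assumes "m \<noteq> 0"
  shows "(radial has_derivative
    (\<lambda>h. (norm m * cos (norm m / 2) - 2 * sin (norm m / 2)) / (2 * norm m ^ 3) * (m \<bullet> h))) (at m)"
proof -
  have n: "norm m \<noteq> 0" using assms by simp
  have "(radial has_derivative (\<lambda>h. ((m \<bullet> h) / norm m / 2 * cos (norm m / 2) * norm m -
      sin (norm m / 2) * ((m \<bullet> h) / norm m)) / (norm m * norm m))) (at m)"
    unfolding radial_def
    by (intro has_derivative_divide' has_derivative_sin has_derivative_norm_real3 assms n
        bounded_linear.has_derivative[OF bounded_linear_divide])
  then show ?thesis
    by (rule has_derivative_eq_rhs) (use n in \<open>simp add: fun_eq_iff field_simps power3_eq_cube\<close>)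
qed

text \<open>A logarithmic derivative; the phase cis (w / 2) contributes the last term. Division by
  \<open>planar m\<close> normalises the value at m to 1, where
  \<open>has_derivative_Im_over_Re\<close> applies.\<close>

lemma has_derivative_planar_ratio:
  assumes "Complex (m $ 1) (m $ 2) \<noteq> 0"
  shows "((\<lambda>x. planar x / planar m) has_derivative
    (\<lambda>h. Complex (h $ 1) (h $ 2) / Complex (m $ 1) (m $ 2) + \<i> * of_real (h $ 3 / 2))) (at m)"
proof -
  have "((\<lambda>x. planar x / planar m) has_derivative
    (\<lambda>h. (Complex (m $ 1) (m $ 2) * (\<i> * of_real (h $ 3 / 2) * cis (m $ 3 / 2)) +
      Complex (h $ 1) (h $ 2) * cis (m $ 3 / 2)) / planar m)) (at m)"
    unfolding planar_def
    by (intro bounded_linear.has_derivative[OF bounded_linear_divide] has_derivative_mult has_derivative_Complex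
        has_derivative_cis has_derivative_vec_nth)
  then show ?thesis
    by (rule has_derivative_eq_rhs) (use assms in \<open>simp add: fun_eq_iff planar_def field_simps\<close>)
qed

lemma smooth_at_radial: "m \<noteq> 0 \<Longrightarrow> smooth_at radial m"
  unfolding radial_def by (intro smooth_intros smooth_at_norm_real3) simp_all

lemma smooth_at_planar: "smooth_at planar m"
  unfolding planar_def by (intro smooth_intros) simp_all

lemma smooth_at_planar_ratio: "smooth_at (\<lambda>x. planar x / z) m"
  unfolding divide_inverse by (intro smooth_intros smooth_at_planar)

text \<open>The common end of both injectivity proofs in the source: once the w component is gone, h
  is a complex number whose components along and across u + i v vanish.\<close>

lemma eq_0_of_radial_angular:
  fixes m h :: "real^3"
  assumes "Complex (m $ 1) (m $ 2) \<noteq> 0" "h $ 3 = 0" "m $ 1 * h $ 1 + m $ 2 * h $ 2 = 0"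
    "Im (Complex (h $ 1) (h $ 2) / Complex (m $ 1) (m $ 2) + \<i> * of_real (h $ 3 / 2)) = 0"
  shows "h = 0"
proof -
  let ?z = "Complex (h $ 1) (h $ 2)" and ?w = "Complex (m $ 1) (m $ 2)"
  have "?z / ?w = ?z * cnj ?w / of_real ((cmod ?w)\<^sup>2)"
    by (rule complex_div_cnj)
  then have "Im (?z * cnj ?w) / (cmod ?w)\<^sup>2 = 0"
    using assms(2,4) by (simp add: Im_divide_of_real)
  then have "Im (?z * cnj ?w) = 0" using assms(1) by simp
  moreover have "?w \<bullet> ?z = 0"
    using assms(3) by (simp add: inner_complex_def)
  ultimately have "?z = 0"
    using assms(1) by (rule complex_eq_0_of_orthogonal)
  then show ?thesis
    using assms(2) by (simp add: complex_eq_iff vec_eq_iff forall_3)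
qed

section \<open>The points where the sine vanishes\<close>

text \<open>There \<open>exp_coord_2 = radial * planar\<close> is a blow-down: \<open>radial\<close> vanishes to first order,
  while the argument of \<open>planar\<close> is an independent coordinate.\<close>

lemma locally_equivalent_conj_locus_1:
  assumes q: "q \<in> SU2" and m12: "Complex (m $ 1) (m $ 2) \<noteq> 0" and sin0: "sin (norm m / 2) = 0"
  shows "locally_equivalent (cotangent_space q) SU2 (exp_map q) (q ** su2 m)
    (\<lambda>x :: real^3. vector [x $ 1 * x $ 3, x $ 2, x $ 3] :: real^3)"
proof -
  have m: "m \<noteq> 0" using m12 by (auto simp: complex_eq_iff)
  then have n: "norm m \<noteq> 0" by simp
  define a where "a = exp_coord_1 m"
  have k0: "radial m = 0" by (simp add: radial_def sin0)
  have cos0: "cos (norm m / 2) \<noteq> 0" using sin0 sin_cos_squared_add[of "norm m / 2"] by auto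
  have b0: "exp_coord_2 m = 0" by (simp add: exp_coord_2_radial k0)
  have a: "a = of_real (cos (norm m / 2)) * cis (- (m $ 3 / 2))"
    by (simp add: a_def exp_coord_1_radial k0 complex_eq_iff)
  have "(cmod a)\<^sup>2 = 1"
    using exp_coords_norm[OF m] by (simp add: a_def b0)
  then have aa: "a * cnj a = 1"
    unfolding complex_norm_square[symmetric] by simp
  have a_ne: "a \<noteq> 0" using aa by auto
  have planar_ne: "planar m \<noteq> 0" using m12 by (simp add: planar_def)
  define \<Lambda> where "\<Lambda> x = planar x / planar m" for x
  define \<delta> where "\<delta> h = Complex (h $ 1) (h $ 2) / Complex (m $ 1) (m $ 2) + \<i> * of_real (h $ 3 / 2)" for h :: "real^3"
  have d\<Lambda>: "(\<Lambda> has_derivative \<delta>) (at m)"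
    unfolding \<Lambda>_def \<delta>_def by (rule has_derivative_planar_ratio[OF m12])
  have \<Lambda>m: "\<Lambda> m = 1" using planar_ne by (simp add: \<Lambda>_def)
  have s\<Lambda>: "smooth_at \<Lambda> m"
    unfolding \<Lambda>_def by (rule smooth_at_planar_ratio)
  define \<kappa> where "\<kappa> = (norm m * cos (norm m / 2) - 2 * sin (norm m / 2)) / (2 * norm m ^ 3)"
  have \<kappa>: "\<kappa> \<noteq> 0" using n cos0 by (simp add: \<kappa>_def sin0)
  have dk: "(radial has_derivative (\<lambda>h. \<kappa> * (m \<bullet> h))) (at m)"
    unfolding \<kappa>_def by (rule has_derivative_radial[OF m])
  define e' where "e' h = Complex (cos (norm m / 2)) (radial m * m $ 3) * (\<i> * of_real (- (h $ 3 / 2)) * cis (- (m $ 3 / 2)))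
      + Complex ((m \<bullet> h) / norm m / 2 * - sin (norm m / 2)) (radial m * h $ 3 + \<kappa> * (m \<bullet> h) * m $ 3) * cis (- (m $ 3 / 2))" for h
  have de: "(exp_coord_1 has_derivative e') (at m)"
    unfolding exp_coord_1_radial e'_def
    by (intro has_derivative_mult has_derivative_Complex has_derivative_cis has_derivative_cos has_derivative_vec_nth
        dk has_derivative_minus bounded_linear.has_derivative[OF bounded_linear_divide] has_derivative_norm_real3 m)
  \<comment> \<open>The third coordinate is the real part of \<zeta> / \<open>planar m\<close> and
    the first is the quotient of imaginary by real part of \<open>\<Lambda>\<close>, so their
    product is the imaginary part of \<zeta> / \<open>planar m\<close>. The target chart reads off
    these two parts.\<close>
  define \<Phi> where "\<Phi> x = (vector [Im (\<Lambda> x) / Re (\<Lambda> x), Im (exp_coord_1 x * cnj a), radial x * Re (\<Lambda> x)] :: real^3)" for x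
  define \<psi> where "\<psi> z = (vector [Im (snd z / planar m), Im (fst z * cnj a), Re (snd z / planar m)] :: real^3)" for z
  show ?thesis
  proof (rule locally_equivalent_exp_map[where \<Phi> = \<Phi> and \<psi> = \<psi> and D' = \<psi> and a = a and b = 0 and
        D = "\<lambda>h. vector [Im (\<delta> h) / Re (\<Lambda> m), Im (e' h * cnj a), radial m * Re (\<delta> h) + \<kappa> * (m \<bullet> h) * Re (\<Lambda> m)]"])
    show "smooth_at \<Phi> m"
      unfolding \<Phi>_def by (intro smooth_intros s\<Lambda> smooth_at_exp_coords m smooth_at_radial) (simp add: \<Lambda>m)
    show "\<Phi> m = 0"
      by (simp add: \<Phi>_def \<Lambda>m k0 a_def[symmetric] aa vector3_eq_0_iff)
    show "(\<Phi> has_derivative (\<lambda>h. vector [Im (\<delta> h) / Re (\<Lambda> m), Im (e' h * cnj a), radial m * Re (\<delta> h) + \<kappa> * (m \<bullet> h) * Re (\<Lambda> m)])) (at m)"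
      unfolding \<Phi>_def
      by (intro has_derivative_vector3 has_derivative_Im_over_Re d\<Lambda> has_derivative_Im has_derivative_Re
          has_derivative_mult dk de has_derivative_mult_left) (simp_all add: \<Lambda>m)
    show "h = 0" if "vector [Im (\<delta> h) / Re (\<Lambda> m), Im (e' h * cnj a), radial m * Re (\<delta> h) + \<kappa> * (m \<bullet> h) * Re (\<Lambda> m)] = (0 :: real^3)" for h
    proof -
      have 1: "Im (\<delta> h) = 0" and 2: "Im (e' h * cnj a) = 0" and 3: "m \<bullet> h = 0"
        using that \<kappa> unfolding vector3_eq_0_iff k0 \<Lambda>m by simp_all
      \<comment> \<open>Along m \<bullet> h = 0, and with \<open>radial m = 0\<close>, only the
        phase cis (- w / 2) of z moves to first order.\<close>
      have "e' h = - (\<i> * of_real (h $ 3 / 2)) * a"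
        unfolding e'_def k0 3 a by (simp add: complex_eq_iff)
      then have "e' h * cnj a = - (\<i> * of_real (h $ 3 / 2)) * (a * cnj a)"
        by (simp only: mult.assoc)
      then have h3: "h $ 3 = 0" using 2 unfolding aa by simp
      show ?thesis
        by (rule eq_0_of_radial_angular[OF m12 h3 _ 1[unfolded \<delta>_def]])
          (use 3 h3 in \<open>simp add: inner_vec_def sum_3\<close>)
    qed
    show "a = exp_coord_1 m" "0 = exp_coord_2 m" by (simp_all add: a_def b0)
    have "(r *\<^sub>R z) / w = r *\<^sub>R (z / w)" for r and z w :: complex
      by (simp add: scaleR_conv_of_real)
    then have lin: "bounded_linear \<psi>"
      unfolding linear_conv_bounded_linear[symmetric] \<psi>_def
      by (intro linearI) (simp_all add: vec_eq_iff forall_3 add_divide_distrib distrib_right)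
    show "smooth_at \<psi> (a, 0)" by (rule smooth_at_linear[OF lin])
    show "(\<psi> has_derivative \<psi>) (at (a, 0))" by (rule bounded_linear_imp_has_derivative[OF lin])
    show "\<psi> (a, 0) = 0" by (simp add: \<psi>_def aa vector3_eq_0_iff)
    show "s = 0 \<and> t = 0" if "a \<bullet> s + 0 \<bullet> t = 0" "\<psi> (s, t) = 0" for s t
    proof -
      have "t / planar m = 0" and s: "Im (s * cnj a) = 0"
        using that(2) unfolding \<psi>_def vector3_eq_0_iff by (simp_all add: complex_eq_iff)
      then show ?thesis
        using planar_ne complex_eq_0_of_orthogonal[OF s _ a_ne] that(1) by simp
    qed
    have "\<forall>\<^sub>F x in nhds m. Re (\<Lambda> x) \<noteq> 0"
    proof -
      have "smooth_at (\<lambda>x. Re (\<Lambda> x)) m" by (intro smooth_intros s\<Lambda>)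
      from tendsto_imp_eventually_ne[OF smooth_at_tendsto[OF this], of 0] show ?thesis
        by (simp add: \<Lambda>m)
    qed
    then show "\<forall>\<^sub>F x in nhds m. \<psi> (exp_coord_1 x, exp_coord_2 x) =
        vector [\<Phi> x $ 1 * \<Phi> x $ 3, \<Phi> x $ 2, \<Phi> x $ 3]"
    proof eventually_elim
      case (elim x)
      have "exp_coord_2 x / planar m = of_real (radial x) * \<Lambda> x"
        by (simp add: exp_coord_2_radial \<Lambda>_def)
      then show ?case
        using elim by (simp add: \<psi>_def \<Phi>_def mult.commute[of "Im (\<Lambda> x)"])
    qed
  qed (use q m in simp_all)
qed

section \<open>The points where \<open>tan \<theta> = \<theta>\<close>\<close>

text \<open>With \<open>\<theta> = norm m / 2\<close> and \<open>c = w / norm m\<close>, the first coordinate of the exponential map is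
  \<open>profile \<theta> c\<close> and the second one has square modulus \<open>(1 - c\<^sup>2) (sin \<theta>)\<^sup>2\<close>.\<close>

definition profile :: "real \<Rightarrow> real \<Rightarrow> complex" where
  "profile \<theta> c = cis (- (c * \<theta>)) * Complex (cos \<theta>) (c * sin \<theta>)"

lemma cmod_profile: "(cmod (profile \<theta> c))\<^sup>2 = (cos \<theta>)\<^sup>2 + c\<^sup>2 * (sin \<theta>)\<^sup>2"
  by (simp add: profile_def norm_mult cmod_power2 power_mult_distrib)

lemma exp_coord_1_profile:
  "m \<noteq> 0 \<Longrightarrow> exp_coord_1 m = profile (norm m / 2) (m $ 3 / norm m)"
  by (simp add: exp_coord_1_def profile_def mult.commute)

text \<open>The hypothesis on \<open>c'\<close> says that \<open>(1 - c\<^sup>2) (sin \<theta>)\<^sup>2\<close> is stationary.\<close>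

lemma has_vector_derivative_profile:
  assumes c: "(c has_real_derivative c') (at \<theta>)" and c': "c \<theta> * c' * sin \<theta> = (1 - (c \<theta>)\<^sup>2) * cos \<theta>"
  shows "((\<lambda>\<theta>. profile \<theta> (c \<theta>)) has_vector_derivative
    (sin \<theta> - \<theta> * cos \<theta>) *\<^sub>R (cis (- (c \<theta> * \<theta>)) * Complex (- (1 - (c \<theta>)\<^sup>2)) c')) (at \<theta>)"
proof -
  let ?e = "cis (- (c \<theta> * \<theta>))"
  have "((\<lambda>\<theta>. - (c \<theta> * \<theta>)) has_derivative (\<lambda>h. - (c \<theta> * h + c' * h * \<theta>))) (at \<theta>)"
    by (intro has_derivative_minus has_derivative_mult has_derivative_ident c[unfolded has_field_derivative_def])
  from has_derivative_cis[OF this]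
  have 1: "((\<lambda>\<theta>. cis (- (c \<theta> * \<theta>))) has_vector_derivative - \<i> * of_real (c' * \<theta> + c \<theta>) * ?e) (at \<theta>)"
    unfolding has_vector_derivative_def
    by (rule has_derivative_eq_rhs) (simp add: fun_eq_iff scaleR_conv_of_real algebra_simps)
  have 2: "((\<lambda>\<theta>. Complex (cos \<theta>) (c \<theta> * sin \<theta>)) has_vector_derivative
      Complex (- sin \<theta>) (c' * sin \<theta> + c \<theta> * cos \<theta>)) (at \<theta>)"
    by (rule has_vector_derivative_Complex) (auto intro!: derivative_eq_intros c)
  \<comment> \<open>The stationarity of y enters through the real part; the imaginary part is an
    identity.\<close>
  have *: "- \<i> * of_real (c' * \<theta> + c \<theta>) * Complex (cos \<theta>) (c \<theta> * sin \<theta>) +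
      Complex (- sin \<theta>) (c' * sin \<theta> + c \<theta> * cos \<theta>) = (sin \<theta> - \<theta> * cos \<theta>) *\<^sub>R Complex (- (1 - (c \<theta>)\<^sup>2)) c'"
  proof (rule complex_eqI)
    have "(c' * \<theta> + c \<theta>) * (c \<theta> * sin \<theta>) - sin \<theta> = \<theta> * (c \<theta> * c' * sin \<theta>) - (1 - (c \<theta>)\<^sup>2) * sin \<theta>"
      by (simp add: power2_eq_square algebra_simps)
    also have "\<dots> = (sin \<theta> - \<theta> * cos \<theta>) * - (1 - (c \<theta>)\<^sup>2)"
      unfolding c' by (simp add: algebra_simps)
    finally show "Re (- \<i> * of_real (c' * \<theta> + c \<theta>) * Complex (cos \<theta>) (c \<theta> * sin \<theta>) +
      Complex (- sin \<theta>) (c' * sin \<theta> + c \<theta> * cos \<theta>)) = Re ((sin \<theta> - \<theta> * cos \<theta>) *\<^sub>R Complex (- (1 - (c \<theta>)\<^sup>2)) c')"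
      by simp
  qed (simp add: algebra_simps)
  have "((\<lambda>\<theta>. profile \<theta> (c \<theta>)) has_vector_derivative
      ?e * Complex (- sin \<theta>) (c' * sin \<theta> + c \<theta> * cos \<theta>) +
      - \<i> * of_real (c' * \<theta> + c \<theta>) * ?e * Complex (cos \<theta>) (c \<theta> * sin \<theta>)) (at \<theta>)"
    unfolding profile_def by (rule has_vector_derivative_mult[OF 1 2])
  also have "?e * Complex (- sin \<theta>) (c' * sin \<theta> + c \<theta> * cos \<theta>) +
      - \<i> * of_real (c' * \<theta> + c \<theta>) * ?e * Complex (cos \<theta>) (c \<theta> * sin \<theta>) =
      ?e * (- \<i> * of_real (c' * \<theta> + c \<theta>) * Complex (cos \<theta>) (c \<theta> * sin \<theta>) +
      Complex (- sin \<theta>) (c' * sin \<theta> + c \<theta> * cos \<theta>))"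
    by (simp only: distrib_left ac_simps)
  also have "\<dots> = (sin \<theta> - \<theta> * cos \<theta>) *\<^sub>R (?e * Complex (- (1 - (c \<theta>)\<^sup>2)) c')"
    unfolding * by simp
  finally show ?thesis .
qed

text \<open>The slope \<open>c\<close> on the branch of sign \<open>\<sigma>\<close>, as a function of \<open>\<theta>\<close> and \<open>y = (1 - c\<^sup>2) (sin \<theta>)\<^sup>2\<close>.\<close>

definition slope :: "real \<Rightarrow> real \<times> real \<Rightarrow> real" where
  "slope \<sigma> p = \<sigma> * sqrt (1 - snd p / (sin (fst p))\<^sup>2)"

text \<open>On the intended domain both values of \<open>profile\<close> have square modulus 1 - y,
  so this is 1 - y times the sine of the difference of their arguments.\<close>

definition fold_function :: "real \<Rightarrow> real \<Rightarrow> real \<times> real \<Rightarrow> real" where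
  "fold_function \<sigma> \<theta>\<^sub>0 p = Im (profile (fst p) (slope \<sigma> p) * cnj (profile \<theta>\<^sub>0 (slope \<sigma> (\<theta>\<^sub>0, snd p))))"

lemma slope_square: "\<sigma>\<^sup>2 = 1 \<Longrightarrow> 1 - y / (sin \<theta>)\<^sup>2 \<ge> 0 \<Longrightarrow> (slope \<sigma> (\<theta>, y))\<^sup>2 = 1 - y / (sin \<theta>)\<^sup>2"
  by (simp add: slope_def power_mult_distrib)

lemma slope_nonzero: "\<sigma>\<^sup>2 = 1 \<Longrightarrow> 1 - y / (sin \<theta>)\<^sup>2 > 0 \<Longrightarrow> slope \<sigma> (\<theta>, y) \<noteq> 0"
  by (auto simp: slope_def)

lemma smooth_at_slope:
  "sin \<theta> \<noteq> 0 \<Longrightarrow> 1 - y / (sin \<theta>)\<^sup>2 > 0 \<Longrightarrow> smooth_at (slope \<sigma>) (\<theta>, y)"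
  unfolding slope_def by (intro smooth_intros) simp_all

lemma smooth_at_profile:
  "smooth_at f x \<Longrightarrow> smooth_at g x \<Longrightarrow> smooth_at (\<lambda>x. profile (f x) (g x)) x"
  unfolding profile_def by (intro smooth_intros)

lemma smooth_at_profile_slope:
  assumes "sin \<theta> \<noteq> 0" "1 - y / (sin \<theta>)\<^sup>2 > 0"
  shows "smooth_at (\<lambda>y. profile \<theta> (slope \<sigma> (\<theta>, y))) y"
  by (intro smooth_at_profile smooth_at_const)
    (rule smooth_at_compose[OF smooth_at_slope[OF assms] smooth_at_Pair[OF smooth_at_const smooth_at_id]])

lemma smooth_at_fold_function:
  assumes "sin \<theta>\<^sub>0 \<noteq> 0" "1 - y / (sin \<theta>\<^sub>0)\<^sup>2 > 0"
  shows "smooth_at (fold_function \<sigma> \<theta>\<^sub>0) (\<theta>\<^sub>0, y)"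
proof -
  have "smooth_at (\<lambda>p::real \<times> real. profile \<theta>\<^sub>0 (slope \<sigma> (\<theta>\<^sub>0, snd p))) (\<theta>\<^sub>0, y)"
    by (rule smooth_at_compose[OF _ smooth_at_snd[OF smooth_at_id]])
      (unfold snd_conv, rule smooth_at_profile_slope[OF assms])
  from smooth_at_Im[OF smooth_at_mult[OF smooth_at_profile[OF smooth_at_fst[OF smooth_at_id] smooth_at_slope[OF assms]]
        smooth_at_cnj[OF this]]]
  show ?thesis
    unfolding fold_function_def .
qed

text \<open>The value is the one given by implicit differentiation of (1 - c^2) (sin \<theta>)^2 = y
  at constant y, as \<open>has_vector_derivative_profile\<close> requires.\<close>

lemma has_real_derivative_slope:
  assumes \<sigma>: "\<sigma>\<^sup>2 = 1" and \<theta>: "sin \<theta> \<noteq> 0" "1 - y / (sin \<theta>)\<^sup>2 > 0"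
  shows "((\<lambda>\<theta>. slope \<sigma> (\<theta>, y)) has_real_derivative
    (1 - (slope \<sigma> (\<theta>, y))\<^sup>2) * cos \<theta> / (slope \<sigma> (\<theta>, y) * sin \<theta>)) (at \<theta>)"
proof -
  define s where "s = sqrt (1 - y / (sin \<theta>)\<^sup>2)"
  have s: "s > 0" using \<theta>(2) by (simp add: s_def)
  have c: "slope \<sigma> (\<theta>, y) = \<sigma> * s" by (simp add: slope_def s_def)
  have c2: "1 - (slope \<sigma> (\<theta>, y))\<^sup>2 = y / (sin \<theta>)\<^sup>2"
    using slope_square[OF \<sigma>, of y \<theta>] \<theta>(2) by simp
  have "((\<lambda>\<theta>. 1 - y / (sin \<theta>)\<^sup>2) has_real_derivative 2 * y * cos \<theta> / (sin \<theta>) ^ 3) (at \<theta>)"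
    using \<theta>(1) by (auto intro!: derivative_eq_intros simp: field_simps power2_eq_square power3_eq_cube)
  from DERIV_cmult[OF DERIV_chain2[OF DERIV_real_sqrt[OF \<theta>(2)] this], of \<sigma>]
  have "((\<lambda>\<theta>. slope \<sigma> (\<theta>, y)) has_real_derivative
      \<sigma> * (inverse s / 2 * (2 * y * cos \<theta> / (sin \<theta>) ^ 3))) (at \<theta>)"
    unfolding slope_def s_def by simp
  moreover have "\<sigma> * (inverse s / 2 * (2 * y * cos \<theta> / (sin \<theta>) ^ 3)) =
      (1 - (slope \<sigma> (\<theta>, y))\<^sup>2) * cos \<theta> / (slope \<sigma> (\<theta>, y) * sin \<theta>)"
  proof -
    have "\<sigma> \<noteq> 0" and \<sigma>\<sigma>: "\<sigma> * (\<sigma> * x) = x" for x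
      using \<sigma> by (auto simp: power2_eq_square mult.assoc[symmetric])
    then show ?thesis
      by (subst c2) (use s \<theta>(1) in \<open>simp add: c field_simps power2_eq_square power3_eq_cube \<sigma>\<sigma>\<close>)
  qed
  ultimately show ?thesis by simp
qed

text \<open>The cofactor of sin \<theta> - \<theta> cos \<theta> in the \<theta>-derivative of
  \<open>fold_function\<close>, so that the zero of this derivative sits in an explicit
  factor.\<close>

definition fold_slope :: "real \<Rightarrow> real \<Rightarrow> real \<Rightarrow> real \<Rightarrow> real" where
  "fold_slope \<sigma> \<theta>\<^sub>0 y \<theta> = (let c = slope \<sigma> (\<theta>, y) in
    Im (cis (- (c * \<theta>)) * Complex (- (1 - c\<^sup>2)) ((1 - c\<^sup>2) * cos \<theta> / (c * sin \<theta>)) *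
      cnj (profile \<theta>\<^sub>0 (slope \<sigma> (\<theta>\<^sub>0, y)))))"

lemma has_real_derivative_fold_function:
  assumes \<sigma>: "\<sigma>\<^sup>2 = 1" and \<theta>: "sin \<theta> \<noteq> 0" "1 - y / (sin \<theta>)\<^sup>2 > 0"
  shows "((\<lambda>\<theta>. fold_function \<sigma> \<theta>\<^sub>0 (\<theta>, y)) has_real_derivative
    (sin \<theta> - \<theta> * cos \<theta>) * fold_slope \<sigma> \<theta>\<^sub>0 y \<theta>) (at \<theta>)"
proof -
  let ?z = "cnj (profile \<theta>\<^sub>0 (slope \<sigma> (\<theta>\<^sub>0, y)))"
  have "((\<lambda>\<theta>. profile \<theta> (slope \<sigma> (\<theta>, y))) has_vector_derivative (sin \<theta> - \<theta> * cos \<theta>) *\<^sub>R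
      (cis (- (slope \<sigma> (\<theta>, y) * \<theta>)) * Complex (- (1 - (slope \<sigma> (\<theta>, y))\<^sup>2))
        ((1 - (slope \<sigma> (\<theta>, y))\<^sup>2) * cos \<theta> / (slope \<sigma> (\<theta>, y) * sin \<theta>)))) (at \<theta>)"
    by (rule has_vector_derivative_profile[OF has_real_derivative_slope[OF \<sigma> \<theta>]])
      (use slope_nonzero[OF \<sigma> \<theta>(2)] \<theta>(1) in simp)
  from bounded_linear.has_vector_derivative[OF bounded_linear_Im
      bounded_linear.has_vector_derivative[OF bounded_linear_mult_left[of ?z] this]]
  show ?thesis
    unfolding has_real_derivative_iff_has_vector_derivative fold_function_def fold_slope_def Let_def fst_conv snd_conv
    by (simp only: mult_scaleR_left scaleR_complex.sel)
qed

text \<open>At the critical angle the two \<open>cis\<close> factors cancel and leave \<open>(1 -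
  c\<^sup>2) * ((c * sin \<theta>\<^sub>0)\<^sup>2 + (cos \<theta>\<^sub>0)\<^sup>2) / (c * sin
  \<theta>\<^sub>0)\<close>. Here y > 0 gives c^2 < 1, and the positive radicand gives c \<noteq>
  0.\<close>

lemma fold_slope_nonzero:
  assumes \<sigma>: "\<sigma>\<^sup>2 = 1" and \<theta>\<^sub>0: "sin \<theta>\<^sub>0 \<noteq> 0" and y: "0 < y" "1 - y / (sin \<theta>\<^sub>0)\<^sup>2 > 0"
  shows "fold_slope \<sigma> \<theta>\<^sub>0 y \<theta>\<^sub>0 \<noteq> 0"
proof -
  define c where "c = slope \<sigma> (\<theta>\<^sub>0, y)"
  have c: "c \<noteq> 0" unfolding c_def by (rule slope_nonzero[OF \<sigma> y(2)])
  have c2: "1 - c\<^sup>2 > 0"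
    using slope_square[OF \<sigma>, of y \<theta>\<^sub>0] y \<theta>\<^sub>0 by (simp add: c_def)
  have u: "cis (- (c * \<theta>\<^sub>0)) * cnj (cis (- (c * \<theta>\<^sub>0))) = 1"
    by (simp add: cis_cnj cis_mult)
  have "fold_slope \<sigma> \<theta>\<^sub>0 y \<theta>\<^sub>0 = Im ((cis (- (c * \<theta>\<^sub>0)) * cnj (cis (- (c * \<theta>\<^sub>0)))) *
      (Complex (- (1 - c\<^sup>2)) ((1 - c\<^sup>2) * cos \<theta>\<^sub>0 / (c * sin \<theta>\<^sub>0)) * cnj (Complex (cos \<theta>\<^sub>0) (c * sin \<theta>\<^sub>0))))"
    unfolding fold_slope_def profile_def Let_def c_def[symmetric] by (simp only: complex_cnj_mult ac_simps)
  also have "\<dots> = (1 - c\<^sup>2) * (c * sin \<theta>\<^sub>0) + (1 - c\<^sup>2) * cos \<theta>\<^sub>0 / (c * sin \<theta>\<^sub>0) * cos \<theta>\<^sub>0"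
    unfolding u by (simp add: algebra_simps)
  also have "\<dots> = (1 - c\<^sup>2) * ((c * sin \<theta>\<^sub>0)\<^sup>2 + (cos \<theta>\<^sub>0)\<^sup>2) / (c * sin \<theta>\<^sub>0)"
    using c \<theta>\<^sub>0 by (simp add: field_simps power2_eq_square)
  also have "\<dots> \<noteq> 0"
  proof -
    have "(c * sin \<theta>\<^sub>0)\<^sup>2 + (cos \<theta>\<^sub>0)\<^sup>2 > 0"
      using c \<theta>\<^sub>0 by (intro add_pos_nonneg) simp_all
    then show ?thesis using c \<theta>\<^sub>0 c2 by simp
  qed
  finally show ?thesis .
qed

text \<open>Hadamard's lemma is applied twice: the fold function vanishes on the line
  \<open>\<theta> = \<theta>\<^sub>0\<close>, and so does its \<theta>-derivative, by the factor sin
  \<theta> - \<theta> cos \<theta>. To see that h is nonzero at the point, its value is found as a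
  limit of quotients by l'Hospital's rule, which avoids second partial derivatives.\<close>

lemma fold_normal_form:
  assumes \<sigma>: "\<sigma>\<^sup>2 = 1" and crit: "sin \<theta>\<^sub>0 = \<theta>\<^sub>0 * cos \<theta>\<^sub>0" and \<theta>\<^sub>0: "\<theta>\<^sub>0 \<noteq> 0" "sin \<theta>\<^sub>0 \<noteq> 0"
    and y\<^sub>0: "0 < y\<^sub>0" "1 - y\<^sub>0 / (sin \<theta>\<^sub>0)\<^sup>2 > 0"
  obtains h where "smooth_at h (\<theta>\<^sub>0, y\<^sub>0)" "h (\<theta>\<^sub>0, y\<^sub>0) \<noteq> 0"
    "\<forall>\<^sub>F p in nhds (\<theta>\<^sub>0, y\<^sub>0). fold_function \<sigma> \<theta>\<^sub>0 p = (fst p - \<theta>\<^sub>0)\<^sup>2 * h p"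
proof -
  let ?F = "fold_function \<sigma> \<theta>\<^sub>0"
  have F0: "?F (\<theta>\<^sub>0, y) = 0" for y
    by (simp add: fold_function_def)
  obtain K where K: "smooth_at K (\<theta>\<^sub>0, y\<^sub>0)" "\<forall>\<^sub>F p in nhds (\<theta>\<^sub>0, y\<^sub>0). ?F p = (fst p - \<theta>\<^sub>0) * K p"
    "\<forall>\<^sub>F y in nhds y\<^sub>0. K (\<theta>\<^sub>0, y) = frechet_derivative ?F (at (\<theta>\<^sub>0, y)) (1, 0)"
    using Hadamard_lemma[OF smooth_at_fold_function[OF \<theta>\<^sub>0(2) y\<^sub>0(2), where \<sigma> = \<sigma>] always_eventually[OF allI[OF F0]]]
    by blast
  have dF0: "frechet_derivative ?F (at (\<theta>\<^sub>0, y)) (1, 0) = 0" if y: "1 - y / (sin \<theta>\<^sub>0)\<^sup>2 > 0" for y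
  proof -
    have "(?F has_derivative frechet_derivative ?F (at (\<theta>\<^sub>0, y))) (at (\<theta>\<^sub>0, y))"
      by (intro has_frechet_derivative smooth_at_imp_differentiable smooth_at_fold_function \<theta>\<^sub>0 y)
    moreover have "((\<lambda>\<theta>. (\<theta>, y)) has_derivative (\<lambda>h. (h, 0))) (at \<theta>\<^sub>0)"
      by (auto intro!: derivative_eq_intros)
    ultimately have "((\<lambda>\<theta>. ?F (\<theta>, y)) has_derivative (\<lambda>h. frechet_derivative ?F (at (\<theta>\<^sub>0, y)) (h, 0))) (at \<theta>\<^sub>0)"
      using has_derivative_compose by blast
    moreover have "((\<lambda>\<theta>. ?F (\<theta>, y)) has_derivative (\<lambda>h. 0)) (at \<theta>\<^sub>0)"
      using has_real_derivative_fold_function[OF \<sigma> \<theta>\<^sub>0(2) y, of \<theta>\<^sub>0] crit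
      by (simp add: has_field_derivative_def lambda_zero)
    ultimately show ?thesis
      using has_derivative_unique by metis
  qed
  have "smooth_at (\<lambda>y. 1 - y / (sin \<theta>\<^sub>0)\<^sup>2) y\<^sub>0"
    by (intro smooth_intros) (use \<theta>\<^sub>0 in simp)
  from order_tendstoD(1)[OF smooth_at_tendsto[OF this] y\<^sub>0(2)]
  have "\<forall>\<^sub>F y in nhds y\<^sub>0. 1 - y / (sin \<theta>\<^sub>0)\<^sup>2 > 0" .
  with K(3) have "\<forall>\<^sub>F y in nhds y\<^sub>0. K (\<theta>\<^sub>0, y) = 0"
    by eventually_elim (simp add: dF0)
  then obtain h where h: "smooth_at h (\<theta>\<^sub>0, y\<^sub>0)" "\<forall>\<^sub>F p in nhds (\<theta>\<^sub>0, y\<^sub>0). K p = (fst p - \<theta>\<^sub>0) * h p"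
    using Hadamard_lemma[OF K(1)] by metis
  have Fh: "\<forall>\<^sub>F p in nhds (\<theta>\<^sub>0, y\<^sub>0). ?F p = (fst p - \<theta>\<^sub>0)\<^sup>2 * h p"
    using K(2) h(2) by eventually_elim (simp add: power2_eq_square)
  have nhds_pair: "filterlim (\<lambda>\<theta>. (\<theta>, y\<^sub>0)) (nhds (\<theta>\<^sub>0, y\<^sub>0)) (nhds \<theta>\<^sub>0)"
    by (rule smooth_at_tendsto[OF smooth_at_Pair[OF smooth_at_id smooth_at_const]])
  have lim_h: "((\<lambda>\<theta>. ?F (\<theta>, y\<^sub>0) / (\<theta> - \<theta>\<^sub>0)\<^sup>2) \<longlongrightarrow> h (\<theta>\<^sub>0, y\<^sub>0)) (at \<theta>\<^sub>0)"
  proof (rule Lim_transform_eventually)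
    show "((\<lambda>\<theta>. h (\<theta>, y\<^sub>0)) \<longlongrightarrow> h (\<theta>\<^sub>0, y\<^sub>0)) (at \<theta>\<^sub>0)"
      by (rule filterlim_mono[OF filterlim_compose[OF smooth_at_tendsto[OF h(1)] nhds_pair] order_refl at_within_le_nhds])
    have "\<forall>\<^sub>F \<theta> in nhds \<theta>\<^sub>0. ?F (\<theta>, y\<^sub>0) = (\<theta> - \<theta>\<^sub>0)\<^sup>2 * h (\<theta>, y\<^sub>0)"
      using eventually_compose_filterlim[OF Fh nhds_pair] by simp
    then show "\<forall>\<^sub>F \<theta> in at \<theta>\<^sub>0. h (\<theta>, y\<^sub>0) = ?F (\<theta>, y\<^sub>0) / (\<theta> - \<theta>\<^sub>0)\<^sup>2"
      unfolding eventually_at_filter by eventually_elim simp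
  qed
  have good: "\<forall>\<^sub>F \<theta> in nhds \<theta>\<^sub>0. sin \<theta> \<noteq> 0 \<and> 1 - y\<^sub>0 / (sin \<theta>)\<^sup>2 > 0"
  proof (rule eventually_conj)
    have s: "smooth_at sin \<theta>\<^sub>0" by (rule smooth_at_sin[OF smooth_at_id])
    show "\<forall>\<^sub>F \<theta> in nhds \<theta>\<^sub>0. sin \<theta> \<noteq> 0"
      by (rule tendsto_imp_eventually_ne[OF smooth_at_tendsto[OF s] \<theta>\<^sub>0(2)])
    have "smooth_at (\<lambda>\<theta>. 1 - y\<^sub>0 / (sin \<theta>)\<^sup>2) \<theta>\<^sub>0"
      by (intro smooth_intros) (use \<theta>\<^sub>0 in simp)
    from order_tendstoD(1)[OF smooth_at_tendsto[OF this] y\<^sub>0(2)]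
    show "\<forall>\<^sub>F \<theta> in nhds \<theta>\<^sub>0. 1 - y\<^sub>0 / (sin \<theta>)\<^sup>2 > 0" .
  qed
  let ?J = "fold_slope \<sigma> \<theta>\<^sub>0 y\<^sub>0"
  have sJ: "smooth_at ?J \<theta>\<^sub>0"
  proof -
    have "smooth_at (\<lambda>\<theta>. slope \<sigma> (\<theta>, y\<^sub>0)) \<theta>\<^sub>0"
      by (rule smooth_at_compose[OF smooth_at_slope[OF \<theta>\<^sub>0(2) y\<^sub>0(2)] smooth_at_Pair[OF smooth_at_id smooth_at_const]])
    then show ?thesis
      unfolding fold_slope_def Let_def
      by (intro smooth_intros) (use slope_nonzero[OF \<sigma> y\<^sub>0(2)] \<theta>\<^sub>0 in auto)
  qed
  \<comment> \<open>The derivative \<theta> sin \<theta> is nonzero at the critical angle, so the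
    factor has a simple zero and the fold is nondegenerate.\<close>
  have "((\<lambda>\<theta>. sin \<theta> - \<theta> * cos \<theta>) has_real_derivative \<theta>\<^sub>0 * sin \<theta>\<^sub>0) (at \<theta>\<^sub>0)"
    by (auto intro!: derivative_eq_intros)
  then have "((\<lambda>\<theta>. (sin \<theta> - \<theta> * cos \<theta>) / (\<theta> - \<theta>\<^sub>0)) \<longlongrightarrow> \<theta>\<^sub>0 * sin \<theta>\<^sub>0) (at \<theta>\<^sub>0)"
    unfolding has_field_derivative_iff using crit by simp
  moreover have "(?J \<longlongrightarrow> ?J \<theta>\<^sub>0) (at \<theta>\<^sub>0)"
    by (rule filterlim_mono[OF smooth_at_tendsto[OF sJ] order_refl at_within_le_nhds])
  ultimately have "((\<lambda>\<theta>. (sin \<theta> - \<theta> * cos \<theta>) / (\<theta> - \<theta>\<^sub>0) * ?J \<theta> / 2) \<longlongrightarrow> \<theta>\<^sub>0 * sin \<theta>\<^sub>0 * ?J \<theta>\<^sub>0 / 2) (at \<theta>\<^sub>0)"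
    by (intro tendsto_intros) simp_all
  then have lim_quot: "((\<lambda>\<theta>. (sin \<theta> - \<theta> * cos \<theta>) * ?J \<theta> / (2 * (\<theta> - \<theta>\<^sub>0))) \<longlongrightarrow> \<theta>\<^sub>0 * sin \<theta>\<^sub>0 * ?J \<theta>\<^sub>0 / 2) (at \<theta>\<^sub>0)"
    by (rule Lim_transform_eventually) (simp add: field_simps)
  have "((\<lambda>\<theta>. ?F (\<theta>, y\<^sub>0) / (\<theta> - \<theta>\<^sub>0)\<^sup>2) \<longlongrightarrow> \<theta>\<^sub>0 * sin \<theta>\<^sub>0 * ?J \<theta>\<^sub>0 / 2) (at \<theta>\<^sub>0)"
  proof (rule lhopital[OF _ _ _ _ _ _ lim_quot])
    have "smooth_at (\<lambda>\<theta>. ?F (\<theta>, y\<^sub>0)) \<theta>\<^sub>0"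
      by (rule smooth_at_compose[OF smooth_at_fold_function[OF \<theta>\<^sub>0(2) y\<^sub>0(2)] smooth_at_Pair[OF smooth_at_id smooth_at_const]])
    from filterlim_mono[OF smooth_at_tendsto[OF this] order_refl at_within_le_nhds]
    show "((\<lambda>\<theta>. ?F (\<theta>, y\<^sub>0)) \<longlongrightarrow> 0) (at \<theta>\<^sub>0)" by (simp add: F0)
    show "((\<lambda>\<theta>. (\<theta> - \<theta>\<^sub>0)\<^sup>2) \<longlongrightarrow> 0) (at \<theta>\<^sub>0)"
      by (rule tendsto_eq_intros | simp)+
    show "\<forall>\<^sub>F \<theta> in at \<theta>\<^sub>0. (\<theta> - \<theta>\<^sub>0)\<^sup>2 \<noteq> 0" "\<forall>\<^sub>F \<theta> in at \<theta>\<^sub>0. 2 * (\<theta> - \<theta>\<^sub>0) \<noteq> 0"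
      by (simp_all add: eventually_at_filter)
    show "\<forall>\<^sub>F \<theta> in at \<theta>\<^sub>0. ((\<lambda>\<theta>. ?F (\<theta>, y\<^sub>0)) has_real_derivative (sin \<theta> - \<theta> * cos \<theta>) * ?J \<theta>) (at \<theta>)"
      unfolding eventually_at_filter using good
      by eventually_elim (simp add: has_real_derivative_fold_function[OF \<sigma>])
    show "\<forall>\<^sub>F \<theta> in at \<theta>\<^sub>0. ((\<lambda>\<theta>. (\<theta> - \<theta>\<^sub>0)\<^sup>2) has_real_derivative 2 * (\<theta> - \<theta>\<^sub>0)) (at \<theta>)"
      by (intro always_eventually allI) (auto intro!: derivative_eq_intros)
  qed
  then have h0: "h (\<theta>\<^sub>0, y\<^sub>0) = \<theta>\<^sub>0 * sin \<theta>\<^sub>0 * ?J \<theta>\<^sub>0 / 2"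
    using lim_h by (intro tendsto_unique[OF trivial_limit_at])
  have "h (\<theta>\<^sub>0, y\<^sub>0) \<noteq> 0"
    unfolding h0 using fold_slope_nonzero[OF \<sigma> \<theta>\<^sub>0(2) y\<^sub>0] \<theta>\<^sub>0 by simp
  then show ?thesis
    using that h(1) Fh by blast
qed

section \<open>The function y on the source, and the charts at a fold\<close>

definition planar_square :: "real^3 \<Rightarrow> real" where
  "planar_square x = (radial x)\<^sup>2 * ((x $ 1)\<^sup>2 + (x $ 2)\<^sup>2)"

lemma planar_square_exp_coord_2: "Re (exp_coord_2 x) * Re (exp_coord_2 x) + Im (exp_coord_2 x) * Im (exp_coord_2 x) = planar_square x"
proof -
  have "(cmod (exp_coord_2 x))\<^sup>2 = planar_square x"
    by (simp add: exp_coord_2_radial planar_def planar_square_def norm_mult power_mult_distrib cmod_power2)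
  then show ?thesis unfolding cmod_power2 by (simp add: power2_eq_square)
qed

text \<open>Recovers c^2 from \<theta> and y: the sine cancels against the one in
  \<open>radial\<close>.\<close>

lemma radicand_planar_square:
  assumes "x \<noteq> 0" "sin (norm x / 2) \<noteq> 0"
  shows "1 - planar_square x / (sin (norm x / 2))\<^sup>2 = (x $ 3 / norm x)\<^sup>2"
proof -
  have "planar_square x / (sin (norm x / 2))\<^sup>2 = ((x $ 1)\<^sup>2 + (x $ 2)\<^sup>2) / (norm x)\<^sup>2"
    using assms by (simp add: planar_square_def radial_def power_divide)
  moreover have "(x $ 1)\<^sup>2 + (x $ 2)\<^sup>2 = (norm x)\<^sup>2 - (x $ 3)\<^sup>2"
    by (simp add: norm_real3_square)
  ultimately show ?thesis
    using assms(1) by (simp add: diff_divide_distrib power_divide)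
qed

lemma slope_planar_square:
  assumes "x \<noteq> 0" "sin (norm x / 2) \<noteq> 0" "sgn (x $ 3) = \<sigma>"
  shows "slope \<sigma> (norm x / 2, planar_square x) = x $ 3 / norm x"
proof -
  have "\<sigma> * \<bar>x $ 3 / norm x\<bar> = (sgn (x $ 3) * \<bar>x $ 3\<bar>) / norm x"
    by (simp add: assms(3))
  then show ?thesis
    unfolding slope_def fst_conv snd_conv radicand_planar_square[OF assms(1,2)] real_sqrt_abs
    by (simp only: sgn_mult_abs)
qed

lemma smooth_at_planar_square: "m \<noteq> 0 \<Longrightarrow> smooth_at planar_square m"
  unfolding planar_square_def by (intro smooth_intros smooth_at_radial)

text \<open>On \<open>w = 0\<close> the kernel of the differential is tangent to the conjugate locus, which is
  why these points are left out.\<close>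

lemma locally_equivalent_conj_locus_0:
  assumes q: "q \<in> SU2" and m12: "Complex (m $ 1) (m $ 2) \<noteq> 0" and m3: "m $ 3 \<noteq> 0"
    and conj: "norm m * cos (norm m / 2) - 2 * sin (norm m / 2) = 0"
  shows "locally_equivalent (cotangent_space q) SU2 (exp_map q) (q ** su2 m)
    (\<lambda>x :: real^3. vector [(x $ 1)\<^sup>2, x $ 2, x $ 3] :: real^3)"
proof -
  have m: "m \<noteq> 0" using m3 by auto
  then have n: "norm m \<noteq> 0" by simp
  define \<theta>\<^sub>0 where "\<theta>\<^sub>0 = norm m / 2"
  have \<theta>\<^sub>0: "\<theta>\<^sub>0 \<noteq> 0" using n by (simp add: \<theta>\<^sub>0_def)
  have crit: "sin \<theta>\<^sub>0 = \<theta>\<^sub>0 * cos \<theta>\<^sub>0" using conj by (simp add: \<theta>\<^sub>0_def)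
  have sin0: "sin \<theta>\<^sub>0 \<noteq> 0" and cos0: "cos \<theta>\<^sub>0 \<noteq> 0"
    using crit \<theta>\<^sub>0 sin_cos_squared_add[of \<theta>\<^sub>0] by auto
  have sin_n: "sin (norm m / 2) \<noteq> 0" using sin0 by (simp add: \<theta>\<^sub>0_def)
  define \<sigma> where "\<sigma> = sgn (m $ 3)"
  have \<sigma>: "\<sigma>\<^sup>2 = 1" using m3 by (simp add: \<sigma>_def sgn_if)
  define y\<^sub>0 where "y\<^sub>0 = planar_square m"
  have rad0: "radial m \<noteq> 0" using sin0 n by (simp add: radial_def \<theta>\<^sub>0_def)
  have r2: "(m $ 1)\<^sup>2 + (m $ 2)\<^sup>2 > 0"
    using m12 by (simp add: complex_eq_iff sum_power2_gt_zero_iff)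
  have y\<^sub>0_pos: "y\<^sub>0 > 0"
    unfolding y\<^sub>0_def planar_square_def using rad0 r2 by simp
  have radicand: "1 - y\<^sub>0 / (sin \<theta>\<^sub>0)\<^sup>2 > 0"
    unfolding y\<^sub>0_def \<theta>\<^sub>0_def radicand_planar_square[OF m sin_n] using m3 n by simp
  obtain h where h: "smooth_at h (\<theta>\<^sub>0, y\<^sub>0)" "h (\<theta>\<^sub>0, y\<^sub>0) \<noteq> 0"
    "\<forall>\<^sub>F p in nhds (\<theta>\<^sub>0, y\<^sub>0). fold_function \<sigma> \<theta>\<^sub>0 p = (fst p - \<theta>\<^sub>0)\<^sup>2 * h p"
    by (rule fold_normal_form[OF \<sigma> crit \<theta>\<^sub>0 sin0 y\<^sub>0_pos radicand])
  \<comment> \<open>The fold may open either way. The sign goes into the first coordinate of the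
    target chart and leaves a positive number under the root in B.\<close>
  define \<tau> where "\<tau> = sgn (h (\<theta>\<^sub>0, y\<^sub>0))"
  have \<tau>h: "\<tau> * h (\<theta>\<^sub>0, y\<^sub>0) > 0" and \<tau>: "\<tau> \<noteq> 0"
    using h(2) by (simp_all add: \<tau>_def sgn_if)
  define p where "p x = (norm x / 2, planar_square x)" for x :: "real^3"
  have pm: "p m = (\<theta>\<^sub>0, y\<^sub>0)" by (simp add: p_def \<theta>\<^sub>0_def y\<^sub>0_def)
  have s_norm: "smooth_at (\<lambda>x. norm x / 2) m"
    by (intro smooth_intros smooth_at_norm_real3 m) simp
  have sp: "smooth_at p m"
    unfolding p_def by (intro smooth_at_Pair s_norm smooth_at_planar_square m)
  define a b where "a = exp_coord_1 m" and "b = exp_coord_2 m"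
  have planar_ne: "planar m \<noteq> 0" using m12 by (simp add: planar_def)
  have b: "b = of_real (radial m) * planar m" by (simp add: b_def exp_coord_2_radial)
  have b_ne: "b \<noteq> 0" using rad0 planar_ne by (simp add: b)
  \<comment> \<open>The value of z on the critical sphere as a function of y, which the target chart
    evaluates at y = |\<zeta>|^2.\<close>
  define W where "W y = profile \<theta>\<^sub>0 (slope \<sigma> (\<theta>\<^sub>0, y))" for y
  have sW: "smooth_at W y\<^sub>0"
    unfolding W_def by (rule smooth_at_profile_slope[OF sin0 radicand])
  have exp1: "exp_coord_1 x = profile (norm x / 2) (slope \<sigma> (p x))"
    if "x \<noteq> 0" "sin (norm x / 2) \<noteq> 0" "sgn (x $ 3) = \<sigma>" for x
    unfolding p_def slope_planar_square[OF that] by (rule exp_coord_1_profile[OF that(1)])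
  have Wy\<^sub>0: "W y\<^sub>0 = a"
    unfolding W_def a_def using exp1[OF m sin_n \<sigma>_def[symmetric]] by (simp add: pm \<theta>\<^sub>0_def)
  have a_ne: "a \<noteq> 0"
  proof -
    have "(cmod a)\<^sup>2 > 0"
      unfolding Wy\<^sub>0[symmetric] W_def cmod_profile using cos0 by (intro add_pos_nonneg) simp_all
    then show ?thesis by auto
  qed
  define W' where "W' = frechet_derivative W (at y\<^sub>0)"
  have dW: "(W has_derivative W') (at y\<^sub>0)"
    unfolding W'_def by (intro has_frechet_derivative smooth_at_imp_differentiable sW)
  define \<Lambda> where "\<Lambda> x = planar x / planar m" for x
  define \<delta> where "\<delta> h = Complex (h $ 1) (h $ 2) / Complex (m $ 1) (m $ 2) + \<i> * of_real (h $ 3 / 2)" for h :: "real^3"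
  have d\<Lambda>: "(\<Lambda> has_derivative \<delta>) (at m)"
    unfolding \<Lambda>_def \<delta>_def by (rule has_derivative_planar_ratio[OF m12])
  have \<Lambda>m: "\<Lambda> m = 1" using planar_ne by (simp add: \<Lambda>_def)
  have s\<Lambda>: "smooth_at \<Lambda> m"
    unfolding \<Lambda>_def by (rule smooth_at_planar_ratio)
  define B where "B x = sqrt (\<tau> * h (p x))" for x
  have shp: "smooth_at (\<lambda>x. \<tau> * h (p x)) m"
    by (intro smooth_at_mult smooth_at_const smooth_at_compose[of h p] sp) (simp add: pm h(1))
  have sB: "smooth_at B m"
    unfolding B_def by (rule smooth_at_sqrt[OF shp]) (simp add: pm \<tau>h)
  have Bm: "B m > 0" using \<tau>h by (simp add: B_def pm)
  define B' where "B' = frechet_derivative B (at m)"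
  have dB: "(B has_derivative B') (at m)"
    unfolding B'_def by (intro has_frechet_derivative smooth_at_imp_differentiable sB)
  \<comment> \<open>Since \<open>radial\<close> is stationary here, y varies to first order through
    u^2 + v^2 only.\<close>
  have dk: "(radial has_derivative (\<lambda>h. 0)) (at m)"
    using has_derivative_radial[OF m] unfolding conj by simp
  define Y' where "Y' h = (radial m)\<^sup>2 * (2 * (m $ 1 * h $ 1 + m $ 2 * h $ 2))" for h :: "real^3"
  have dY: "(planar_square has_derivative Y') (at m)"
  proof -
    have "((\<lambda>x. radial x * radial x * (x $ 1 * x $ 1 + x $ 2 * x $ 2)) has_derivative
      (\<lambda>h. radial m * radial m * ((m $ 1 * h $ 1 + h $ 1 * m $ 1) + (m $ 2 * h $ 2 + h $ 2 * m $ 2)) +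
        (radial m * 0 + 0 * radial m) * (m $ 1 * m $ 1 + m $ 2 * m $ 2))) (at m)"
      by (intro has_derivative_mult has_derivative_add has_derivative_vec_nth dk)
    then have "((\<lambda>x. radial x * radial x * (x $ 1 * x $ 1 + x $ 2 * x $ 2)) has_derivative Y') (at m)"
      by (rule has_derivative_eq_rhs) (simp add: fun_eq_iff Y'_def power2_eq_square algebra_simps)
    moreover have "(\<lambda>x. radial x * radial x * (x $ 1 * x $ 1 + x $ 2 * x $ 2)) = planar_square"
      by (simp add: fun_eq_iff planar_square_def power2_eq_square)
    ultimately show ?thesis by simp
  qed
  have d\<theta>: "((\<lambda>x. norm x / 2 - \<theta>\<^sub>0) has_derivative (\<lambda>h. (m \<bullet> h) / norm m / 2 - 0)) (at m)"
    by (intro has_derivative_diff has_derivative_const bounded_linear.has_derivative[OF bounded_linear_divide]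
        has_derivative_norm_real3 m)
  \<comment> \<open>Since B is the square root of \<open>\<tau> * h (p x)\<close>, the square of the
    first coordinate is \<tau> times the fold function.\<close>
  define \<Phi> where "\<Phi> x = (vector [(norm x / 2 - \<theta>\<^sub>0) * B x, Im (\<Lambda> x) / Re (\<Lambda> x), planar_square x - y\<^sub>0] :: real^3)" for x
  define \<Phi>' where "\<Phi>' h = (vector [(norm m / 2 - \<theta>\<^sub>0) * B' h + ((m \<bullet> h) / norm m / 2 - 0) * B m,
    Im (\<delta> h) / Re (\<Lambda> m), Y' h - 0] :: real^3)" for h
  define N where "N t = Re t * Re t + Im t * Im t" for t :: complex
  define N' where "N' t = (Re b * Re t + Re t * Re b) + (Im b * Im t + Im t * Im b)" for t
  have dN: "(N has_derivative N') (at b)"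
    unfolding N_def N'_def
    by (intro has_derivative_add has_derivative_mult has_derivative_Re has_derivative_Im has_derivative_ident)
  have Nb: "N b = y\<^sub>0"
    unfolding N_def b_def y\<^sub>0_def by (rule planar_square_exp_coord_2)
  have sN: "smooth_at N t" for t
    unfolding N_def by (intro smooth_intros)
  define \<psi> where "\<psi> z = (vector [\<tau> * Im (fst z * cnj (W (N (snd z)))),
    Im (snd z / planar m) / Re (snd z / planar m), N (snd z) - y\<^sub>0] :: real^3)" for z
  define \<psi>' where "\<psi>' z = (vector [\<tau> * Im (a * cnj (W' (N' (snd z))) + fst z * cnj (W (N b))),
    Im (snd z / planar m) / Re (b / planar m), N' (snd z) - 0] :: real^3)" for z
  have b_planar: "b / planar m = of_real (radial m)"
    using planar_ne by (simp add: b)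
  show ?thesis
  proof (rule locally_equivalent_exp_map[where \<Phi> = \<Phi> and \<psi> = \<psi> and D' = \<psi>' and a = a and b = b and D = \<Phi>'])
    show "q \<in> SU2" "m \<noteq> 0" by (rule q, rule m)
    show "a = exp_coord_1 m" "b = exp_coord_2 m" by (simp_all add: a_def b_def)
    show "smooth_at \<Phi> m"
      unfolding \<Phi>_def
      by (intro smooth_at_vector3 smooth_at_mult smooth_at_divide smooth_at_diff smooth_at_const smooth_at_Re smooth_at_Im
          s_norm sB s\<Lambda> smooth_at_planar_square m) (simp add: \<Lambda>m)
    show "\<Phi> m = 0"
      by (simp add: \<Phi>_def \<Lambda>m \<theta>\<^sub>0_def y\<^sub>0_def vector3_eq_0_iff)
    show "(\<Phi> has_derivative \<Phi>') (at m)"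
      unfolding \<Phi>_def \<Phi>'_def
      by (intro has_derivative_vector3 has_derivative_mult[OF d\<theta> dB] has_derivative_Im_over_Re d\<Lambda>
          has_derivative_diff dY has_derivative_const) (simp_all add: \<Lambda>m)
    show "h = 0" if "\<Phi>' h = 0" for h
    proof -
      have 1: "m \<bullet> h = 0" and 2: "Im (\<delta> h) = 0" and 3: "m $ 1 * h $ 1 + m $ 2 * h $ 2 = 0"
        using that Bm n rad0 unfolding \<Phi>'_def vector3_eq_0_iff \<Lambda>m Y'_def by (simp_all add: \<theta>\<^sub>0_def)
      \<comment> \<open>The planar part of m \<bullet> h is zero because y is constant to first
        order, so \<theta> can vary only through w; this is where w \<noteq> 0 makes \<theta> and y
        independent.\<close>
      have "m $ 3 * h $ 3 = 0"
        using 1 3 by (simp add: inner_vec_def sum_3)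
      then have "h $ 3 = 0" using m3 by simp
      then show ?thesis
        by (rule eq_0_of_radial_angular[OF m12 _ 3 2[unfolded \<delta>_def]])
    qed
    show "smooth_at \<psi> (a, b)"
    proof -
      have "smooth_at (\<lambda>z::complex \<times> complex. N (snd z)) (a, b)"
        by (rule smooth_at_compose[OF sN]) (intro smooth_intros)
      moreover have "smooth_at (\<lambda>z::complex \<times> complex. W (N (snd z))) (a, b)"
        by (rule smooth_at_compose[OF _ calculation]) (simp add: Nb sW)
      moreover have "smooth_at (\<lambda>z::complex \<times> complex. snd z / planar m) (a, b)"
        unfolding divide_inverse by (intro smooth_intros)
      ultimately show ?thesis
        unfolding \<psi>_def
        by (intro smooth_at_vector3 smooth_at_mult smooth_at_divide smooth_at_diff smooth_at_const smooth_at_Re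
            smooth_at_Im smooth_at_cnj smooth_at_fst smooth_at_id) (simp_all add: b_planar rad0)
    qed
    show "\<psi> (a, b) = 0"
      by (simp add: \<psi>_def Nb Wy\<^sub>0 b_planar vector3_eq_0_iff)
    show "(\<psi> has_derivative \<psi>') (at (a, b))"
    proof -
      have fst: "((\<lambda>z::complex \<times> complex. fst z) has_derivative (\<lambda>z. fst z)) (at (a, b))"
        and snd: "((\<lambda>z::complex \<times> complex. snd z) has_derivative (\<lambda>z. snd z)) (at (a, b))"
        by (intro has_derivative_fst has_derivative_snd has_derivative_ident)+
      have N: "((\<lambda>z::complex \<times> complex. N (snd z)) has_derivative (\<lambda>z. N' (snd z))) (at (a, b))"
        by (rule has_derivative_compose[OF snd]) (simp add: dN)
      have W: "((\<lambda>z::complex \<times> complex. W (N (snd z))) has_derivative (\<lambda>z. W' (N' (snd z)))) (at (a, b))"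
        by (rule has_derivative_compose[OF N]) (simp add: Nb dW)
      have "((\<lambda>z. \<tau> * Im (fst z * cnj (W (N (snd z))))) has_derivative
        (\<lambda>z. \<tau> * Im (fst (a, b) * cnj (W' (N' (snd z))) + fst z * cnj (W (N (snd (a, b))))))) (at (a, b))"
        by (intro has_derivative_mult_right has_derivative_Im has_derivative_mult[OF fst] has_derivative_cnj W)
      moreover have "((\<lambda>z. Im (snd z / planar m) / Re (snd z / planar m)) has_derivative
        (\<lambda>z. Im (snd z / planar m) / Re (snd (a, b) / planar m))) (at (a, b))"
        by (rule has_derivative_Im_over_Re[OF bounded_linear.has_derivative[OF bounded_linear_divide snd]])
          (simp_all add: b_planar rad0)
      moreover have "((\<lambda>z. N (snd z) - y\<^sub>0) has_derivative (\<lambda>z. N' (snd z) - 0)) (at (a, b))"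
        by (intro has_derivative_diff N has_derivative_const)
      ultimately show ?thesis
        unfolding \<psi>_def \<psi>'_def fst_conv snd_conv by (rule has_derivative_vector3)
    qed
    \<comment> \<open>The derivative is triangular: the modulus and the angle of \<zeta> force t =
      0, after which the correction \<open>W'\<close> disappears and tangency leaves s orthogonal to
      a.\<close>
    show "s = 0 \<and> t = 0" if tangent: "a \<bullet> s + b \<bullet> t = 0" and zero: "\<psi>' (s, t) = 0" for s t
    proof -
      have 1: "Im (a * cnj (W' (N' t)) + s * cnj a) = 0" and 2: "Im (t / planar m) = 0" and 3: "N' t = 0"
      proof -
        have z: "\<tau> * Im (a * cnj (W' (N' t)) + s * cnj a) = 0 \<and> Im (t / planar m) / radial m = 0 \<and> N' t - 0 = 0"
          using zero unfolding \<psi>'_def vector3_eq_0_iff b_planar Nb Wy\<^sub>0 fst_conv snd_conv Re_complex_of_real .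
        show "Im (a * cnj (W' (N' t)) + s * cnj a) = 0"
          using conjunct1[OF z] \<tau> unfolding mult_eq_0_iff by blast
        show "Im (t / planar m) = 0" "N' t = 0"
          using conjunct2[OF z] rad0 by simp_all
      qed
      have bt: "b \<bullet> t = 0"
        using 3 by (simp add: N'_def inner_complex_def)
      have "t * cnj b = of_real (radial m * (cmod (planar m))\<^sup>2) * (t / planar m)"
        using planar_ne by (simp add: b complex_norm_square del: of_real_power)
      then have "t * cnj b = (radial m * (cmod (planar m))\<^sup>2) *\<^sub>R (t / planar m)"
        by (simp only: scaleR_conv_of_real)
      then have "Im (t * cnj b) = 0"
        by (simp only: scaleR_complex.sel 2 mult_zero_right)
      then have t: "t = 0" by (rule complex_eq_0_of_orthogonal[OF _ bt b_ne])
      have "W' 0 = 0" by (rule linear_0[OF has_derivative_linear[OF dW]])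
      then have "Im (s * cnj a) = 0" using 1 3 by simp
      moreover have "a \<bullet> s = 0" using tangent bt by simp
      ultimately have "s = 0" using a_ne by (rule complex_eq_0_of_orthogonal)
      with t show ?thesis by simp
    qed
    have "\<forall>\<^sub>F x in nhds m. x \<noteq> 0" by (rule t1_space_nhds[OF m])
    moreover have "\<forall>\<^sub>F x in nhds m. sin (norm x / 2) \<noteq> 0"
      by (rule tendsto_imp_eventually_ne[OF smooth_at_tendsto[OF smooth_at_sin[OF s_norm]] sin_n])
    \<comment> \<open>An open condition that fixes the sign of w, so that one branch of
      \<open>slope\<close> serves near m.\<close>
    moreover have "\<forall>\<^sub>F x in nhds m. 0 < m $ 3 * x $ 3"
    proof -
      have "smooth_at (\<lambda>x. m $ 3 * x $ 3) m" by (intro smooth_intros)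
      from order_tendstoD(1)[OF smooth_at_tendsto[OF this], of 0] show ?thesis
        using m3 unfolding power2_eq_square[symmetric] zero_less_power2 by blast
    qed
    moreover have "\<forall>\<^sub>F x in nhds m. 0 < \<tau> * h (p x)"
      using order_tendstoD(1)[OF smooth_at_tendsto[OF shp], of 0] \<tau>h by (simp add: pm)
    moreover have "\<forall>\<^sub>F x in nhds m. fold_function \<sigma> \<theta>\<^sub>0 (p x) = (fst (p x) - \<theta>\<^sub>0)\<^sup>2 * h (p x)"
      using eventually_compose_filterlim[OF h(3)] smooth_at_tendsto[OF sp] unfolding pm by blast
    ultimately show "\<forall>\<^sub>F x in nhds m. \<psi> (exp_coord_1 x, exp_coord_2 x) = vector [(\<Phi> x $ 1)\<^sup>2, \<Phi> x $ 2, \<Phi> x $ 3]"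
    proof eventually_elim
      case (elim x)
      have "sgn (x $ 3) = \<sigma>"
        using elim(3) by (auto simp: \<sigma>_def sgn_if zero_less_mult_iff)
      then have e1: "exp_coord_1 x = profile (norm x / 2) (slope \<sigma> (p x))"
        by (rule exp1[OF elim(1,2)])
      have Nx: "N (exp_coord_2 x) = planar_square x"
        unfolding N_def by (rule planar_square_exp_coord_2)
      have "\<tau> * Im (exp_coord_1 x * cnj (W (planar_square x))) = \<tau> * fold_function \<sigma> \<theta>\<^sub>0 (p x)"
        unfolding e1 W_def fold_function_def by (simp add: p_def)
      also have "\<dots> = (norm x / 2 - \<theta>\<^sub>0)\<^sup>2 * (\<tau> * h (p x))"
        unfolding elim(5) by (simp add: p_def)
      also have "\<tau> * h (p x) = (B x)\<^sup>2"
        unfolding B_def using elim(4) by simp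
      finally have "\<tau> * Im (exp_coord_1 x * cnj (W (planar_square x))) = ((norm x / 2 - \<theta>\<^sub>0) * B x)\<^sup>2"
        by (simp only: power_mult_distrib)
      moreover have "exp_coord_2 x / planar m = of_real (radial x) * \<Lambda> x"
        by (simp add: exp_coord_2_radial \<Lambda>_def)
      then have "Im (exp_coord_2 x / planar m) / Re (exp_coord_2 x / planar m) = Im (\<Lambda> x) / Re (\<Lambda> x)"
        using elim(1,2) by (simp add: radial_def)
      ultimately show ?case
        unfolding \<psi>_def \<Phi>_def fst_conv snd_conv Nx by (simp only: vector_3)
    qed
  qed
qed

text \<open>From pi to 3 pi / 2 the function \<theta> cos \<theta> - sin \<theta> passes from - pi
  to 1; starting at pi keeps away from the root 0.\<close>

lemma exists_critical_angle: "\<exists>\<theta>>0. (\<theta>::real) * cos \<theta> = sin \<theta>"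
proof -
  have "\<exists>\<theta>. pi \<le> \<theta> \<and> \<theta> \<le> 3 / 2 * pi \<and> \<theta> * cos \<theta> - sin \<theta> = 0"
  proof (rule IVT')
    show "pi * cos pi - sin pi \<le> 0" by simp
    show "0 \<le> 3 / 2 * pi * cos (3 / 2 * pi) - sin (3 / 2 * pi)"
      by (simp only: cos_3over2_pi sin_3over2_pi)
  qed (auto intro!: continuous_intros)
  then obtain \<theta> where "pi \<le> \<theta>" "\<theta> * cos \<theta> - sin \<theta> = 0" by blast
  then have "\<theta> > 0 \<and> \<theta> * cos \<theta> = sin \<theta>"
    using pi_gt_zero by linarith
  then show ?thesis by blast
qed

section \<open>The conjugate loci in coordinates, density, and conclusion\<close>

lemma conj_locus_0_iff:
  assumes "q \<in> SU2"
  shows "q ** su2 m \<in> conj_locus_0 q \<longleftrightarrow>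
    (m $ 1)\<^sup>2 + (m $ 2)\<^sup>2 \<noteq> 0 \<and> norm m * cos (norm m / 2) - 2 * sin (norm m / 2) = 0"
  by (simp add: conj_locus_0_def cotangent_space_eq Hamiltonian_su2 covector_norm_su2 assms)

lemma conj_locus_1_iff:
  assumes "q \<in> SU2"
  shows "q ** su2 m \<in> conj_locus_1 q \<longleftrightarrow> (m $ 1)\<^sup>2 + (m $ 2)\<^sup>2 \<noteq> 0 \<and> sin (norm m / 2) = 0"
  by (simp add: conj_locus_1_def cotangent_space_eq Hamiltonian_su2 covector_norm_su2 assms)

theorem theorem18:
  fixes q :: cmat
  assumes "q \<in> SU2"
  shows "(\<exists>D. D \<subseteq> conj_locus_0 q \<and> D \<noteq> {} \<and> conj_locus_0 q \<subseteq> closure D \<and>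
            (\<forall>\<mu>\<in>D. locally_equivalent (cotangent_space q) SU2 (exp_map q) \<mu>
               (\<lambda>x :: real^3. vector [(x $ 1)\<^sup>2, x $ 2, x $ 3] :: real^3))) \<and>
         (\<forall>\<mu>\<in>conj_locus_1 q. locally_equivalent (cotangent_space q) SU2 (exp_map q) \<mu>
            (\<lambda>x :: real^3. vector [x $ 1 * x $ 3, x $ 2, x $ 3] :: real^3))"
proof (intro conjI exI ballI)
  have m12: "Complex (m $ 1) (m $ 2) \<noteq> 0" if "(m $ 1)\<^sup>2 + (m $ 2)\<^sup>2 \<noteq> 0" for m :: "real^3"
    using that by (auto simp: complex_eq_iff)
  have cotangent: "\<exists>m. \<mu> = q ** su2 m" if "\<mu> \<in> conj_locus_0 q \<or> \<mu> \<in> conj_locus_1 q" for \<mu>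
    using that by (auto simp: conj_locus_0_def conj_locus_1_def cotangent_space_eq)
  define D where "D = {q ** su2 m | m. m $ 3 \<noteq> 0 \<and> q ** su2 m \<in> conj_locus_0 q}"
  show "D \<subseteq> conj_locus_0 q" unfolding D_def by blast
  show "D \<noteq> {}"
  proof -
    obtain \<theta> :: real where \<theta>: "\<theta> > 0" "\<theta> * cos \<theta> = sin \<theta>" using exists_critical_angle by blast
    \<comment> \<open>The triple 3, 4, 5 gives norm 2 \<theta> with u and w both nonzero.\<close>
    define m where "m = (vector [2 * \<theta> * (3 / 5), 0, 2 * \<theta> * (4 / 5)] :: real^3)"
    have "(norm m)\<^sup>2 = (2 * \<theta>)\<^sup>2"
      unfolding norm_real3_square m_def by (simp add: power2_eq_square)
    then have "norm m = 2 * \<theta>"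
      by (rule power2_eq_imp_eq) (use \<theta>(1) in simp_all)
    then have "q ** su2 m \<in> conj_locus_0 q"
      unfolding conj_locus_0_iff[OF assms] using \<theta> by (simp add: m_def)
    moreover have "m $ 3 \<noteq> 0" using \<theta>(1) by (simp add: m_def)
    ultimately show ?thesis unfolding D_def by blast
  qed
  show "conj_locus_0 q \<subseteq> closure D"
  proof
    fix \<mu> assume \<mu>: "\<mu> \<in> conj_locus_0 q"
    then obtain m where m: "\<mu> = q ** su2 m" using cotangent by blast
    show "\<mu> \<in> closure D"
    proof (cases "m $ 3 = 0")
      case False
      then have "\<mu> \<in> D" using \<mu> unfolding D_def m by blast
      then show ?thesis using closure_subset by blast
    next
      case True
      have m_conj: "(m $ 1)\<^sup>2 + (m $ 2)\<^sup>2 \<noteq> 0" "norm m * cos (norm m / 2) - 2 * sin (norm m / 2) = 0"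
        using \<mu> unfolding m conj_locus_0_iff[OF assms] by blast+
      \<comment> \<open>Rotates m towards the \<open>X0\<close> axis within the sphere of radius
        |m|, where the left side of the equation of C^0 is constant.\<close>
      define r where "r \<epsilon> = (vector [cos \<epsilon> * m $ 1, cos \<epsilon> * m $ 2, sin \<epsilon> * norm m] :: real^3)" for \<epsilon> :: real
      have norm_r: "norm (r \<epsilon>) = norm m" for \<epsilon>
      proof -
        have "(norm (r \<epsilon>))\<^sup>2 = (cos \<epsilon>)\<^sup>2 * ((m $ 1)\<^sup>2 + (m $ 2)\<^sup>2) + (sin \<epsilon>)\<^sup>2 * (norm m)\<^sup>2"
          unfolding norm_real3_square[of "r \<epsilon>"] by (simp add: r_def power_mult_distrib distrib_left)
        also have "(m $ 1)\<^sup>2 + (m $ 2)\<^sup>2 = (norm m)\<^sup>2"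
          using True by (simp add: norm_real3_square)
        also have "(cos \<epsilon>)\<^sup>2 * (norm m)\<^sup>2 + (sin \<epsilon>)\<^sup>2 * (norm m)\<^sup>2 = (norm m)\<^sup>2"
          by (simp flip: distrib_right)
        finally show ?thesis by (rule power2_eq_imp_eq) simp_all
      qed
      have "q ** su2 (r \<epsilon>) \<in> closure D" if \<epsilon>: "\<epsilon> \<in> {0<..<1}" for \<epsilon>
      proof -
        have s: "sin \<epsilon> > 0" "cos \<epsilon> > 0"
          using \<epsilon> pi_gt3 by (auto intro!: sin_gt_zero cos_gt_zero)
        have "(r \<epsilon> $ 1)\<^sup>2 + (r \<epsilon> $ 2)\<^sup>2 = (cos \<epsilon>)\<^sup>2 * ((m $ 1)\<^sup>2 + (m $ 2)\<^sup>2)"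
          by (simp add: r_def power_mult_distrib distrib_left)
        then have "q ** su2 (r \<epsilon>) \<in> conj_locus_0 q"
          unfolding conj_locus_0_iff[OF assms] norm_r using m_conj s by simp
        moreover have "r \<epsilon> $ 3 \<noteq> 0" using s m_conj(1) True by (auto simp: r_def)
        ultimately have "q ** su2 (r \<epsilon>) \<in> D"
          unfolding D_def by blast
        then show ?thesis by (rule subsetD[OF closure_subset])
      qed
      then have ev: "\<forall>\<^sub>F \<epsilon> in at_right 0. q ** su2 (r \<epsilon>) \<in> closure D"
        by (intro eventually_at_rightI[of 0 1]) auto
      have "smooth_at r 0" unfolding r_def by (intro smooth_intros)
      then have "isCont (\<lambda>\<epsilon>. q ** su2 (r \<epsilon>)) 0"
        by (intro smooth_at_imp_isCont smooth_at_linear_compose[OF bounded_linear_cmat_mult_right]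
            smooth_at_linear_compose[OF bounded_linear_su2])
      then have "((\<lambda>\<epsilon>. q ** su2 (r \<epsilon>)) \<longlongrightarrow> q ** su2 (r 0)) (at_right 0)"
        unfolding isCont_def by (rule filterlim_mono[OF _ order_refl at_le]) simp
      moreover have "r 0 = m" using True by (simp add: r_def vec_eq_iff forall_3)
      ultimately show ?thesis
        unfolding m using Lim_in_closed_set[OF closed_closure ev] by simp
    qed
  qed
  show "locally_equivalent (cotangent_space q) SU2 (exp_map q) \<mu>
      (\<lambda>x :: real^3. vector [(x $ 1)\<^sup>2, x $ 2, x $ 3] :: real^3)" if "\<mu> \<in> D" for \<mu>
    using that m12 locally_equivalent_conj_locus_0[OF assms]
    unfolding D_def conj_locus_0_iff[OF assms] by blast
  show "locally_equivalent (cotangent_space q) SU2 (exp_map q) \<mu>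
      (\<lambda>x :: real^3. vector [x $ 1 * x $ 3, x $ 2, x $ 3] :: real^3)" if "\<mu> \<in> conj_locus_1 q" for \<mu>
  proof -
    obtain m where m: "\<mu> = q ** su2 m" using cotangent \<open>\<mu> \<in> conj_locus_1 q\<close> by blast
    then show ?thesis
      using \<open>\<mu> \<in> conj_locus_1 q\<close> m12 locally_equivalent_conj_locus_1[OF assms]
      unfolding m conj_locus_1_iff[OF assms] by blast
  qed
qed

end
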